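(* Consider the sequence of bandwidth sharing networks indexed by $\epsilon\in(0,1)$ described in the context, operated under a weighted proportionally fair policy with weights $\kappa_1,\dots,\kappa_R$, with phase-type file size distributions in the class $\mathcal D$ and arrival rate vector $\bm\lambda^{(\epsilon)}=(1-\epsilon)\bm\lambda^{(0)}$, where under $\bm\lambda^{(0)}$ exactly $L_s$ links are critically loaded. Let $\overline{\bm N}^{(\epsilon)}$ be a random vector distributed according to the stationary distribution of the flow count process $(\bm N^{(\epsilon)}(t):t\ge 0)$, and let $\overline N_r^{(\epsilon)}=\sum_{k}\overline N_{r,k}^{(\epsilon)}$ be the corresponding total number of flows on route $r$. Then as $\epsilon\to0^+$, $$\frac{L_s\cdot\min_r\kappa_r}{\epsilon}+o\Bigl(\frac1\epsilon\Bigr)\le\mathbb E\Bigl[\sum_r\kappa_r\overline N_r^{(\epsilon)}\Bigr]\le\frac{L_s\cdot\max_r\kappa_r}{\epsilon}+o\Bigl(\frac1\epsilon\Bigr).$$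
   Context: **Network.** Links $\mathcal L=\{1,\dots,L\}$ with capacities $C_\ell>0$; routes $\mathcal R=\{1,\dots,R\}$, each route being a nonempty set of links ($\ell\in r$ means link $\ell$ is on route $r$). The routing matrix $H=(h_{\ell r})$, $h_{\ell r}=1$ if $\ell\in r$ and $0$ otherwise, has full row rank. Each route $r$ has a weight $\kappa_r>0$. **File sizes (class $\mathcal D$).** For each route $r$, the file size is the absorption time of a continuous-time Markov chain with an absorbing state $0$ and transient states (phases) $1,\dots,K_r$, initial distribution $\bm\pi_r$ (a $1\times K_r$ row probability vector on the phases), and transient generator $S_r$ ($K_r\times K_r$; the absorption rates are the entries of $-S_r\bm 1$, $\bm 1$ the all-ones column vector). $S_r$ is block diagonal with blocks $S_r^{(1)},\dots,S_r^{(B_r)}$, where each $S_r^{(b)}$ is a square matrix with $-\mu_r^{(b)}$ on the diagonal, $\mu_r^{(b)}>0$ on the superdiagonal, and zeros elsewhere, the $\mu_r^{(b)}$ being distinct for different $b$. Moreover $\pi_{r,k}>0$ for each phase $k$ corresponding to the first row of some block, and $\pi_{r,k}\ge0$ for the other phases. The mean file size is $1/\mu_r=\bm\pi_r(-S_r)^{-1}\bm 1$. Let $K=\sum_rK_r$. **Weighted proportionally fair policy.** A state is $\bm n=(n_{r,k})_{r\in\mathcal R,k\in\{1,\dots,K_r\}}\in\mathbb Z_+^K$, where $n_{r,k}$ is the number of flows in phase $k$ on route $r$; $n_r=\sum_kn_{r,k}$. In state $\bm n$ each flow on route $r$ gets rate $x_r=x_r(\bm n)$, where $(x_r)$ maximizes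 $\sum_r\kappa_rn_r\log x_r$ subject to $\sum_{r:\ell\in r}n_rx_r\le C_\ell$ for all $\ell$ and $x_r\ge0$, with $x_r=0$ when $n_r=0$. **Flow count process.** Flows arrive on route $r$ as independent Poisson processes of rate $\lambda_r$; file sizes are i.i.d. on each route and independent across routes. With $\bm e^{(r,k)}$ the standard basis vectors of $\mathbb R^K$, the flow count process is the continuous-time Markov chain on $\mathbb Z_+^K$ with transition rates: $\bm n\to\bm n+\bm e^{(r,k)}$ at rate $\lambda_r\pi_{r,k}$; $\bm n\to\bm n-\bm e^{(r,k_1)}+\bm e^{(r,k_2)}$ ($k_1\ne k_2$) at rate $n_{r,k_1}x_r(S_r)_{k_1,k_2}$; $\bm n\to\bm n-\bm e^{(r,k)}$ at rate $n_{r,k}x_r\sum_{k'}(-S_r)_{k,k'}$. **Heavy traffic.** Fix $\bm\lambda^{(0)}$ with all $\lambda^{(0)}_r>0$ on the boundary of the capacity region: with $\rho_r^{(0)}=\lambda_r^{(0)}/\mu_r$, $\sum_{r:\ell\in r}\rho_r^{(0)}=C_\ell$ for $\ell$ in a nonempty set $\mathcal L_s\subseteq\mathcal L$ of critically loaded links and $\sum_{r:\ell\in r}\rho_r^{(0)}<C_\ell$ for $\ell\notin\mathcal L_s$; $L_s=|\mathcal L_s|$. The $\epsilon$-th system has $\bm\lambda^{(\epsilon)}=(1-\epsilon)\bm\lambda^{(0)}$, everything else being independent of $\epsilon$. For $0<\epsilon<1$ the flow count process has a unique stationary distribution. *)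

theory Defs
  imports
    "HOL-Probability.Probability"
    "HOL-Library.Landau_Symbols"
    "Jordan_Normal_Form.Matrix"
    "Jordan_Normal_Form.Gauss_Jordan_Elimination"
begin

(* The vectors and matrices of Jordan_Normal_Form have a run-time dimension, which is needed for
   the phase-type data because the number of phases depends on the route.  Only the routing matrix
   uses the type-indexed vectors of HOL-Analysis, whose subscript notation is switched off here. *)
unbundle no vec_syntax

section \<open>Network\<close>

definition routing_matrix :: "('r::finite \<Rightarrow> 'l::finite set) \<Rightarrow> real^'r^'l" where
  "routing_matrix route = vec_lambda (\<lambda>l. vec_lambda (\<lambda>r. if l \<in> route r then 1 else 0))"

definition link_load :: "('r::finite \<Rightarrow> 'l set) \<Rightarrow> ('r \<Rightarrow> real) \<Rightarrow> 'l \<Rightarrow> real" where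
  "link_load route y l = (\<Sum>r | l \<in> route r. y r)"

section \<open>Phase-type file sizes\<close>

definition erlang_block :: "nat \<Rightarrow> real \<Rightarrow> real mat" where
  "erlang_block d \<mu> =
     Matrix.mat d d (\<lambda>(i, j). if i = j then - \<mu> else if j = Suc i then \<mu> else 0)"

(* Phases are numbered from 0.  A block is given by its size d and its rate mu; the first phase of
   block b is the sum of the sizes of the preceding blocks. *)
definition class_D :: "real Matrix.vec \<Rightarrow> real mat \<Rightarrow> bool" where
  "class_D \<pi> S \<longleftrightarrow>
     dim_vec \<pi> = dim_row S \<and>
     (\<forall>k < dim_vec \<pi>. 0 \<le> \<pi> $ k) \<and>
     (\<Sum>k < dim_vec \<pi>. \<pi> $ k) = 1 \<and>
     (\<exists>blocks :: (nat \<times> real) list.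
        (\<forall>(d, \<mu>) \<in> set blocks. 0 < d \<and> 0 < \<mu>) \<and>
        distinct (map snd blocks) \<and>
        S = diag_block_mat (map (\<lambda>(d, \<mu>). erlang_block d \<mu>) blocks) \<and>
        (\<forall>b < length blocks. 0 < \<pi> $ sum_list (map fst (take b blocks))))"

(* pi (-S)^{-1} 1; for S as in class_D the matrix -S is upper triangular with a positive diagonal,
   so mat_inverse does return an inverse. *)
definition mean_file_size :: "real Matrix.vec \<Rightarrow> real mat \<Rightarrow> real" where
  "mean_file_size \<pi> S =
     scalar_prod \<pi> (the (mat_inverse (- S)) *\<^sub>v Matrix.vec (dim_row S) (\<lambda>_. 1))"

definition offered_load ::
  "('r \<Rightarrow> real) \<Rightarrow> ('r \<Rightarrow> real Matrix.vec) \<Rightarrow> ('r \<Rightarrow> real mat) \<Rightarrow> 'r \<Rightarrow> real" where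
  "offered_load lam \<pi> S r = lam r * mean_file_size (\<pi> r) (S r)"

section \<open>States and the weighted proportionally fair allocation\<close>

(* n r k is the number of flows on route r in phase k; the states form a copy of the set of
   nonnegative integer vectors indexed by the pairs (r, k) with k < K_r,
   where K_r = dim_row (S r). *)
type_synonym 'r state = "'r \<Rightarrow> nat \<Rightarrow> nat"

definition states :: "('r \<Rightarrow> real mat) \<Rightarrow> 'r state set" where
  "states S = {n. \<forall>r k. dim_row (S r) \<le> k \<longrightarrow> n r k = 0}"

definition route_count :: "('r \<Rightarrow> real mat) \<Rightarrow> 'r state \<Rightarrow> 'r \<Rightarrow> nat" where
  "route_count S n r = (\<Sum>k < dim_row (S r). n r k)"

definition weighted_count :: "('r::finite \<Rightarrow> real) \<Rightarrow> ('r \<Rightarrow> real mat) \<Rightarrow> 'r state \<Rightarrow> real" where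
  "weighted_count \<kappa> S n = (\<Sum>r\<in>UNIV. \<kappa> r * real (route_count S n r))"

(* On the reals ln 0 = 0, whereas the utility needs log 0 = -infinity. *)
definition ext_log :: "real \<Rightarrow> ereal" where
  "ext_log x = (if x \<le> 0 then - \<infinity> else ereal (ln x))"

(* Routes without flows contribute 0, since 0 * (-infinity) = 0 for extended reals. *)
definition utility :: "('r::finite \<Rightarrow> real) \<Rightarrow> ('r \<Rightarrow> nat) \<Rightarrow> ('r \<Rightarrow> real) \<Rightarrow> ereal" where
  "utility \<kappa> N x = (\<Sum>r\<in>UNIV. ereal (\<kappa> r * real (N r)) * ext_log (x r))"

definition feasible ::
  "('r::finite \<Rightarrow> 'l set) \<Rightarrow> ('l \<Rightarrow> real) \<Rightarrow> ('r \<Rightarrow> nat) \<Rightarrow> ('r \<Rightarrow> real) \<Rightarrow> bool" where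
  "feasible route C N x \<longleftrightarrow>
     (\<forall>r. 0 \<le> x r) \<and> (\<forall>r. N r = 0 \<longrightarrow> x r = 0) \<and>
     (\<forall>l. link_load route (\<lambda>r. real (N r) * x r) l \<le> C l)"

definition prop_fair ::
  "('r::finite \<Rightarrow> 'l set) \<Rightarrow> ('l \<Rightarrow> real) \<Rightarrow> ('r \<Rightarrow> real) \<Rightarrow> ('r \<Rightarrow> nat) \<Rightarrow> ('r \<Rightarrow> real) \<Rightarrow> bool" where
  "prop_fair route C \<kappa> N x \<longleftrightarrow>
     feasible route C N x \<and> (\<forall>y. feasible route C N y \<longrightarrow> utility \<kappa> N y \<le> utility \<kappa> N x)"

section \<open>Transition rates of the flow count process\<close>

definition inc :: "'r \<Rightarrow> nat \<Rightarrow> 'r state \<Rightarrow> 'r state" where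
  "inc r k n = n(r := (n r)(k := n r k + 1))"

definition dec :: "'r \<Rightarrow> nat \<Rightarrow> 'r state \<Rightarrow> 'r state" where
  "dec r k n = n(r := (n r)(k := n r k - 1))"

(* Where dec truncates, i.e. n r k = 0, the corresponding rate is 0 because of the factor n r k. *)
definition flow_rate ::
  "('r::finite \<Rightarrow> real) \<Rightarrow> ('r \<Rightarrow> real Matrix.vec) \<Rightarrow> ('r \<Rightarrow> real mat) \<Rightarrow> ('r state \<Rightarrow> 'r \<Rightarrow> real)
     \<Rightarrow> 'r state \<Rightarrow> 'r state \<Rightarrow> real" where
  "flow_rate lam \<pi> S x n m =
     (\<Sum>r\<in>UNIV. \<Sum>k < dim_row (S r).
        (if m = inc r k n then lam r * \<pi> r $ k else 0)) +
     (\<Sum>r\<in>UNIV. \<Sum>k\<^sub>1 < dim_row (S r). \<Sum>k\<^sub>2 \<in> {..<dim_row (S r)} - {k\<^sub>1}.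
        (if m = inc r k\<^sub>2 (dec r k\<^sub>1 n) then real (n r k\<^sub>1) * x n r * S r $$ (k\<^sub>1, k\<^sub>2) else 0)) +
     (\<Sum>r\<in>UNIV. \<Sum>k < dim_row (S r).
        (if m = dec r k n
         then real (n r k) * x n r * (\<Sum>k' < dim_row (S r). (- S r) $$ (k, k')) else 0))"

section \<open>Continuous-time Markov chains and stationary distributions\<close>

(* P t n is the law at time t of the chain started in n.  The transition rates q n m are only used
   for n different from m; the total rate out of n is their sum. *)
definition ctmc :: "'s set \<Rightarrow> ('s \<Rightarrow> 's \<Rightarrow> real) \<Rightarrow> (real \<Rightarrow> 's \<Rightarrow> 's pmf) \<Rightarrow> bool" where
  "ctmc X q P \<longleftrightarrow>
     (\<forall>n\<in>X. P 0 n = return_pmf n) \<and>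
     (\<forall>t\<ge>0. \<forall>n\<in>X. set_pmf (P t n) \<subseteq> X) \<and>
     (\<forall>s\<ge>0. \<forall>t\<ge>0. \<forall>n\<in>X. P (s + t) n = bind_pmf (P s n) (P t)) \<and>
     (\<forall>n\<in>X. \<forall>m\<in>X. n \<noteq> m \<longrightarrow> ((\<lambda>t. pmf (P t n) m / t) \<longlongrightarrow> q n m) (at_right 0)) \<and>
     (\<forall>n\<in>X. ((\<lambda>t. (1 - pmf (P t n) n) / t) \<longlongrightarrow> (\<Sum>\<^sub>\<infinity>m\<in>X - {n}. q n m)) (at_right 0))"

definition stationary_distribution ::
  "'s set \<Rightarrow> (real \<Rightarrow> 's \<Rightarrow> 's pmf) \<Rightarrow> 's pmf \<Rightarrow> bool" where
  "stationary_distribution X P p \<longleftrightarrow>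
     set_pmf p \<subseteq> X \<and> (\<forall>t\<ge>0. bind_pmf p (P t) = p)"

end

theory Submission
  imports Defs "HOL-Real_Asymp.Real_Asymp" "Jordan_Normal_Form.Determinant"
begin

text \<open>
  Fix the multipliers \<open>p\<close> of the proportionally fair allocation, so that \<open>\<kappa> r * n r k = \<phi> r k * p r\<close>,
  where \<open>p r\<close> sums the multipliers of the links on route \<open>r\<close>, and let \<open>\<rho>\<close> be the critical load per
  phase and \<open>m\<close> the mean residual size. For the weights \<open>A r k = \<kappa> r * m r k / \<rho> r k\<close> the drift of
  \<open>(\<Sum> A * n\<^sup>2) / 2\<close> is at most \<open>- c * \<Sum>r. p r * |\<phi> r - \<rho> r|\<^sup>2\<close> minus \<open>\<epsilon>\<close> times the weighted flow count
  plus a constant; this uses the bidiagonal structure of class D, which makes \<open>A\<close> decrease within each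
  block. The square of this function gives third moments of order \<open>\<epsilon>\<close> to the power \<open>-3\<close>. The square
  of half the squared distance \<open>d\<^sup>2\<close> to the cone spanned by the vectors \<open>\<rho> r k / \<kappa> r\<close> restricted to
  the routes through a critical link gives a bound on \<open>d\<^sup>4 / n\<close>, so \<open>d\<close> is of smaller order than \<open>n\<close>.

  Let \<open>W\<close> be the vector of workloads of the critical links, \<open>B\<close> their Gram matrix for the weights
  \<open>A\<close>, and \<open>U\<close> the unused capacities. The drift of \<open>W\<^sup>T B\<^sup>-\<^sup>1 W / 2\<close> has mean zero, hence \<open>\<epsilon>\<close> times the
  mean of \<open>(B\<^sup>-\<^sup>1 W) \<bullet> C\<close> equals the mean of \<open>(B\<^sup>-\<^sup>1 W) \<bullet> U\<close> plus a trace lying between \<open>Min \<kappa>\<close> and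
  \<open>Max \<kappa>\<close> times the number of critical links. Near the cone, \<open>B\<^sup>-\<^sup>1 W\<close> is close to \<open>p\<close>, which
  annihilates \<open>U\<close>, and \<open>(B\<^sup>-\<^sup>1 W) \<bullet> C\<close> is close to the weighted flow count.
\<close>

section \<open>Stationary distributions of chains with bounded rates\<close>

text \<open>The chain is given only by its transition semigroup and derivatives at time 0, while the
  argument needs mean-zero drift for unbounded functions. The capacities bound the total transition
  rate of every state, so for a nonnegative function integrability alone gives this. Quadratic
  functions would control only first moments; their squares make products of workloads integrable
  and supply the third moments used to cut off rare large states. Two facts repair this: the mean of
  \<open>U\<close> times the workloads stays bounded, and strict concavity bounds the projected
  multiplier of an unsaturated link by a small multiple of the workloads plus a large multiple of
  \<open>d\<close>. Writing \<open>\<epsilon>\<close> as the 16th power of \<open>\<theta>\<close>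
  makes all exponents in this balance integers. The trace does not depend on
  \<open>\<epsilon>\<close>, so \<open>\<epsilon>\<close> times the mean weighted flow count
  converges to it; the two sides of the theorem come from bounding \<open>\<kappa>\<close> inside
  the trace.\<close>

definition generator :: "'j set \<Rightarrow> ('j \<Rightarrow> 's \<Rightarrow> 's) \<Rightarrow> ('j \<Rightarrow> 's \<Rightarrow> real) \<Rightarrow> ('s \<Rightarrow> real) \<Rightarrow> 's \<Rightarrow> real" where
  "generator J \<tau> a f n = (\<Sum>j\<in>J. a j n * (f (\<tau> j n) - f n))"

text \<open>The probability of being away from \<open>n\<close> is subadditive in time, so it is at
  most \<open>k\<close> times its value at \<open>t / k\<close>; letting \<open>k\<close> grow turns
  the derivative at 0 into a bound for all times. This later supplies a dominating constant.\<close>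

lemma ctmc_holding_bound:
  assumes P: "ctmc X q P" and n: "n \<in> X" and t: "0 \<le> t"
  shows "1 - pmf (P t n) n \<le> t * (\<Sum>\<^sub>\<infinity>m\<in>X - {n}. q n m)"
proof (cases "t = 0")
  case True
  then show ?thesis using P n by (simp add: ctmc_def)
next
  case False
  with t have t: "0 < t" by simp
  define h where "h u = 1 - pmf (P u n) n" for u
  have h_add: "h (u + v) \<le> h u + h v" if "0 \<le> u" "0 \<le> v" for u v
  proof -
    have "P (u + v) n = bind_pmf (P u n) (P v)"
      using P n that by (simp add: ctmc_def)
    then have "pmf (P (u + v) n) n = (\<integral>k. pmf (P v k) n \<partial>measure_pmf (P u n))"
      by (simp add: pmf_bind)
    \<comment> \<open>Only the event of being in \<open>n\<close> at the intermediate time is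
      kept.\<close>
    also have "\<dots> \<ge> (\<integral>k. indicator {n} k * pmf (P v n) n \<partial>measure_pmf (P u n))"
      by (intro integral_mono measure_pmf.integrable_const_bound[where B=1])
         (auto simp: pmf_le_1 indicator_def)
    also have "(\<integral>k. indicator {n} k * pmf (P v n) n \<partial>measure_pmf (P u n))
        = pmf (P u n) n * pmf (P v n) n"
      by (simp add: measure_pmf_single)
    finally have "pmf (P u n) n * pmf (P v n) n \<le> pmf (P (u + v) n) n" .
    \<comment> \<open>Expanding this product turns supermultiplicativity of the return probability
      into subadditivity of \<open>h\<close>.\<close>
    moreover have "0 \<le> (1 - pmf (P u n) n) * (1 - pmf (P v n) n)"
      by (intro mult_nonneg_nonneg) (auto simp: pmf_le_1)
    ultimately show ?thesis by (simp add: h_def algebra_simps)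
  qed
  have h_mult: "h (real k * u) \<le> real k * h u" if "0 \<le> u" for k u
  proof (induction k)
    case 0
    then show ?case using P n by (simp add: h_def ctmc_def)
  next
    case (Suc k)
    have "h (real (Suc k) * u) \<le> h (real k * u) + h u"
      using h_add[of "real k * u" u] that by (simp add: algebra_simps)
    with Suc show ?case by (simp add: algebra_simps)
  qed
  have "((\<lambda>u. h u / u) \<longlongrightarrow> (\<Sum>\<^sub>\<infinity>m\<in>X - {n}. q n m)) (at_right 0)"
    using P n by (simp add: ctmc_def h_def)
  moreover have "filterlim (\<lambda>k. t / real (Suc k)) (at_right 0) sequentially"
    using t by real_asymp
  ultimately have lim: "(\<lambda>k. h (t / real (Suc k)) / (t / real (Suc k)))
      \<longlonglongrightarrow> (\<Sum>\<^sub>\<infinity>m\<in>X - {n}. q n m)"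
    by (rule filterlim_compose)
  have "h t / t \<le> h (t / real (Suc k)) / (t / real (Suc k))" for k
    using h_mult[of "t / real (Suc k)" "Suc k"] t
    by (simp add: field_simps del: of_nat_Suc)
  then have "h t / t \<le> (\<Sum>\<^sub>\<infinity>m\<in>X - {n}. q n m)"
    by (intro LIMSEQ_le_const[OF lim]) auto
  then show ?thesis using t by (simp add: h_def field_simps)
qed

text \<open>Jumps carry labels from a finite set \<open>J\<close> instead of being indexed by target
  states, so the generator is always a finite sum; labels with the same target add their rates. The
  uniform bound \<open>Q\<close> on the total rate carries the whole section.\<close>

locale bounded_rate_chain =
  fixes X :: "'s set" and q :: "'s \<Rightarrow> 's \<Rightarrow> real" and P :: "real \<Rightarrow> 's \<Rightarrow> 's pmf" and p :: "'s pmf"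
    and J :: "'j set" and \<tau> :: "'j \<Rightarrow> 's \<Rightarrow> 's" and a :: "'j \<Rightarrow> 's \<Rightarrow> real" and Q :: real
  assumes ctmc: "ctmc X q P" and stat: "stationary_distribution X P p"
    and finJ: "finite J"
    and q_eq: "n \<in> X \<Longrightarrow> m \<in> X \<Longrightarrow> n \<noteq> m \<Longrightarrow> q n m = (\<Sum>j\<in>J. if m = \<tau> j n then a j n else 0)"
    and a_nonneg: "n \<in> X \<Longrightarrow> j \<in> J \<Longrightarrow> 0 \<le> a j n"
    and \<tau>_in: "n \<in> X \<Longrightarrow> j \<in> J \<Longrightarrow> a j n \<noteq> 0 \<Longrightarrow> \<tau> j n \<in> X"
    and \<tau>_neq: "n \<in> X \<Longrightarrow> j \<in> J \<Longrightarrow> a j n \<noteq> 0 \<Longrightarrow> \<tau> j n \<noteq> n"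
    and a_sum_le: "n \<in> X \<Longrightarrow> (\<Sum>j\<in>J. a j n) \<le> Q"
begin

abbreviation gen :: "('s \<Rightarrow> real) \<Rightarrow> 's \<Rightarrow> real" where
  "gen \<equiv> generator J \<tau> a"

lemma p_in_X: "AE n in measure_pmf p. n \<in> X"
  using stat by (auto simp: stationary_distribution_def AE_measure_pmf_iff)

lemma infsum_out_rate:
  assumes n: "n \<in> X"
  shows "(\<Sum>\<^sub>\<infinity>m\<in>X - {n}. q n m) = (\<Sum>j\<in>J. a j n)"
proof -
  let ?T = "(\<lambda>j. \<tau> j n) ` {j\<in>J. a j n \<noteq> 0}"
  have T: "?T \<subseteq> X - {n}" "finite ?T"
    using \<tau>_in[OF n] \<tau>_neq[OF n] finJ by auto
  have "(\<Sum>\<^sub>\<infinity>m\<in>X - {n}. q n m) = (\<Sum>\<^sub>\<infinity>m\<in>?T. q n m)"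
  proof (rule infsum_cong_neutral)
    fix m assume "m \<in> X - {n} - ?T"
    then have "\<And>j. j \<in> J \<Longrightarrow> m = \<tau> j n \<Longrightarrow> a j n = 0" and "m \<in> X" "n \<noteq> m"
      by blast+
    then show "q n m = 0" using n by (auto simp: q_eq intro!: sum.neutral)
  qed (use T(1) in auto)
  also have "\<dots> = (\<Sum>m\<in>?T. q n m)"
    using T by simp
  also have "\<dots> = (\<Sum>m\<in>?T. \<Sum>j\<in>J. if m = \<tau> j n then a j n else 0)"
    using T n by (intro sum.cong refl q_eq) auto
  also have "\<dots> = (\<Sum>j\<in>J. \<Sum>m\<in>?T. if m = \<tau> j n then a j n else 0)"
    by (rule sum.swap)
  also have "\<dots> = (\<Sum>j\<in>J. a j n)"
  proof (intro sum.cong refl)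
    fix j assume "j \<in> J"
    then show "(\<Sum>m\<in>?T. if m = \<tau> j n then a j n else 0) = a j n"
      using T(2) by (cases "a j n = 0") auto
  qed
  finally show ?thesis .
qed

text \<open>Write invariance of \<open>p\<close> at the point \<open>m\<close>, move the
  contribution of paths started in \<open>m\<close> to the left, divide by \<open>t\<close> and let
  \<open>t\<close> tend to 0. The holding bound dominates the integrand by \<open>Q\<close>, so
  limit and integral commute.\<close>

lemma global_balance:
  assumes m: "m \<in> X"
  shows "pmf p m * (\<Sum>j\<in>J. a j m) = (\<integral>n. (if n \<noteq> m \<and> n \<in> X then q n m else 0) \<partial>measure_pmf p)"
proof -
  define t where "t k = 1 / real (Suc k)" for k
  have t_pos: "0 < t k" for k by (simp add: t_def)
  have t_lim: "filterlim t (at_right 0) sequentially"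
    unfolding t_def by real_asymp
  define F where "F k n = (if n \<noteq> m then pmf (P (t k) n) m / t k else 0)" for k n
  have bound: "norm (F k n) \<le> Q" if "n \<in> X" for k n
  proof (cases "n = m")
    case True
    have "0 \<le> (\<Sum>j\<in>J. a j n)" using a_nonneg[OF that] by (simp add: sum_nonneg)
    with True a_sum_le[OF that] show ?thesis by (simp add: F_def)
  next
    case False
    \<comment> \<open>The mass at \<open>m\<close> is part of the mass outside \<open>n\<close>,
      which the holding bound controls.\<close>
    have "pmf (P (t k) n) m + pmf (P (t k) n) n = measure (measure_pmf (P (t k) n)) {m, n}"
      using False by (subst measure_measure_pmf_finite) auto
    also have "\<dots> \<le> 1" by simp
    finally have "pmf (P (t k) n) m \<le> 1 - pmf (P (t k) n) n" by simp
    also have "\<dots> \<le> t k * (\<Sum>j\<in>J. a j n)"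
      using ctmc_holding_bound[OF ctmc that, of "t k"] t_pos[of k] infsum_out_rate[OF that] by simp
    also have "\<dots> \<le> t k * Q"
      using a_sum_le[OF that] t_pos[of k] by simp
    finally show ?thesis using t_pos[of k] False by (simp add: F_def field_simps)
  qed
  have eq: "pmf p m * ((1 - pmf (P (t k) m) m) / t k) = (\<integral>n. F k n \<partial>measure_pmf p)" for k
  proof -
    have int: "integrable (measure_pmf p) (\<lambda>n. if n \<noteq> m then pmf (P (t k) n) m else 0)"
      by (rule measure_pmf.integrable_const_bound[where B=1]) (auto simp: pmf_le_1)
    have "p = bind_pmf p (P (t k))"
      using stat t_pos[of k] by (simp add: stationary_distribution_def)
    then have "pmf p m = (\<integral>n. pmf (P (t k) n) m \<partial>measure_pmf p)"
      by (metis pmf_bind)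
    also have "\<dots> = (\<integral>n. indicator {m} n * pmf (P (t k) m) m +
        (if n \<noteq> m then pmf (P (t k) n) m else 0) \<partial>measure_pmf p)"
      by (rule Bochner_Integration.integral_cong) auto
    also have "\<dots> = (\<integral>n. indicator {m} n * pmf (P (t k) m) m \<partial>measure_pmf p) +
        (\<integral>n. (if n \<noteq> m then pmf (P (t k) n) m else 0) \<partial>measure_pmf p)"
      using int by (intro Bochner_Integration.integral_add
          measure_pmf.integrable_const_bound[where B=1])
        (auto simp: indicator_def pmf_le_1)
    also have "(\<integral>n. indicator {m} n * pmf (P (t k) m) m \<partial>measure_pmf p) = pmf p m * pmf (P (t k) m) m"
      by (simp add: measure_pmf_single)
    finally have *: "pmf p m * (1 - pmf (P (t k) m) m) =
        (\<integral>n. (if n \<noteq> m then pmf (P (t k) n) m else 0) \<partial>measure_pmf p)"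
      by (simp add: algebra_simps)
    have "(\<integral>n. F k n \<partial>measure_pmf p) = (\<integral>n. (if n \<noteq> m then pmf (P (t k) n) m else 0) / t k \<partial>measure_pmf p)"
      by (rule Bochner_Integration.integral_cong) (auto simp: F_def)
    then show ?thesis using * by simp
  qed
  have "(\<lambda>k. \<integral>n. F k n \<partial>measure_pmf p) \<longlonglongrightarrow>
      (\<integral>n. (if n \<noteq> m \<and> n \<in> X then q n m else 0) \<partial>measure_pmf p)"
  proof (rule integral_dominated_convergence[where w="\<lambda>_. Q"])
    show "AE n in measure_pmf p. (\<lambda>k. F k n) \<longlonglongrightarrow> (if n \<noteq> m \<and> n \<in> X then q n m else 0)"
      using p_in_X
    proof eventually_elim
      case (elim n)
      show ?case
      proof (cases "n = m")
        case False
        then have "((\<lambda>u. pmf (P u n) m / u) \<longlongrightarrow> q n m) (at_right 0)"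
          using ctmc elim m by (auto simp: ctmc_def)
        from filterlim_compose[OF this t_lim] show ?thesis
          using False elim by (simp add: F_def)
      qed (simp add: F_def)
    qed
    show "AE n in measure_pmf p. norm (F k n) \<le> Q" for k
      using p_in_X by eventually_elim (rule bound)
  qed auto
  moreover have "(\<lambda>k. pmf p m * ((1 - pmf (P (t k) m) m) / t k)) \<longlonglongrightarrow> pmf p m * (\<Sum>j\<in>J. a j m)"
  proof (intro tendsto_mult tendsto_const)
    have "((\<lambda>u. (1 - pmf (P u m) m) / u) \<longlongrightarrow> (\<Sum>j\<in>J. a j m)) (at_right 0)"
      using ctmc m unfolding infsum_out_rate[OF m, symmetric] by (simp add: ctmc_def)
    from filterlim_compose[OF this t_lim] show "(\<lambda>k. (1 - pmf (P (t k) m) m) / t k) \<longlonglongrightarrow> (\<Sum>j\<in>J. a j m)" .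
  qed
  ultimately show ?thesis
    unfolding eq by (blast intro: LIMSEQ_unique)
qed

text \<open>Global balance at each \<open>m\<close>, weighted by \<open>g m\<close> and summed.
  Working in the extended nonnegative reals lets the order of summation be exchanged for arbitrary
  \<open>g\<close>.\<close>

lemma nn_global_balance:
  "(\<integral>\<^sup>+n. (\<Sum>j\<in>J. ennreal (a j n) * g (\<tau> j n)) \<partial>measure_pmf p)
    = (\<integral>\<^sup>+n. ennreal (\<Sum>j\<in>J. a j n) * g n \<partial>measure_pmf p)"
proof -
  \<comment> \<open>\<open>w\<close> extends the off-diagonal rates by 0: outside \<open>X\<close>,
    and on the diagonal because active jumps change the state.\<close>
  define w where "w n m = (if n \<in> X then (\<Sum>j\<in>J. if m = \<tau> j n then a j n else 0) else 0)" for n m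
  have w_nonneg: "0 \<le> w n m" for n m
    using a_nonneg by (auto simp: w_def intro!: sum_nonneg)
  have w_q: "w n m = (if n \<noteq> m \<and> n \<in> X then q n m else 0)" if "m \<in> X" for n m
    using that \<tau>_neq q_eq by (fastforce simp: w_def intro!: sum.neutral)
  have w_out: "w n m = 0" if "m \<notin> X" for n m
    using that \<tau>_in by (fastforce simp: w_def intro!: sum.neutral)
  have w_le: "w n m \<le> Q" if "n \<in> X" for n m
  proof -
    have "w n m \<le> (\<Sum>j\<in>J. a j n)"
      using that a_nonneg by (auto simp: w_def intro!: sum_mono)
    with a_sum_le[OF that] show ?thesis by simp
  qed
  have sum_eq: "(\<Sum>j\<in>J. ennreal (a j n) * g (\<tau> j n)) = (\<integral>\<^sup>+m. ennreal (w n m) * g m \<partial>count_space UNIV)"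
    if n: "n \<in> X" for n
  proof -
    have "(\<integral>\<^sup>+m. ennreal (w n m) * g m \<partial>count_space UNIV)
        = (\<integral>\<^sup>+m. (\<Sum>j\<in>J. ennreal (a j n) * g (\<tau> j n) * indicator {\<tau> j n} m) \<partial>count_space UNIV)"
    proof (rule nn_integral_cong)
      fix m
      have "ennreal (w n m) = (\<Sum>j\<in>J. ennreal (if m = \<tau> j n then a j n else 0))"
        using n a_nonneg by (simp add: w_def sum_ennreal)
      then show "ennreal (w n m) * g m = (\<Sum>j\<in>J. ennreal (a j n) * g (\<tau> j n) * indicator {\<tau> j n} m)"
        by (simp add: sum_distrib_right) (rule sum.cong, auto)
    qed
    also have "\<dots> = (\<Sum>j\<in>J. ennreal (a j n) * g (\<tau> j n))"
      by (subst nn_integral_sum) (auto simp: nn_integral_cmult_indicator)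
    finally show ?thesis by simp
  qed
  have int_w: "(\<integral>\<^sup>+n. ennreal (w n m) \<partial>measure_pmf p) = ennreal (pmf p m * (\<Sum>j\<in>J. a j m))" for m
  proof (cases "m \<in> X")
    case True
    have "AE n in measure_pmf p. norm (w n m) \<le> Q"
      using p_in_X by eventually_elim (use w_le w_nonneg in auto)
    then have "integrable (measure_pmf p) (\<lambda>n. w n m)"
      by (intro measure_pmf.integrable_const_bound[where B=Q]) auto
    then have "(\<integral>\<^sup>+n. ennreal (w n m) \<partial>measure_pmf p) = ennreal (\<integral>n. w n m \<partial>measure_pmf p)"
      by (intro nn_integral_eq_integral) (auto simp: w_nonneg)
    then show ?thesis
      using global_balance[OF True] by (simp add: w_q[OF True])
  next
    case False
    then have "pmf p m = 0"
      using stat by (auto simp: stationary_distribution_def set_pmf_iff)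
    with False show ?thesis by (simp add: w_out)
  qed
  have "(\<integral>\<^sup>+n. (\<Sum>j\<in>J. ennreal (a j n) * g (\<tau> j n)) \<partial>measure_pmf p)
      = (\<integral>\<^sup>+n. (\<integral>\<^sup>+m. ennreal (w n m) * g m \<partial>count_space UNIV) \<partial>measure_pmf p)"
    by (rule nn_integral_cong_AE) (use p_in_X in eventually_elim, rule sum_eq)
  also have "\<dots> = (\<integral>\<^sup>+n. (\<integral>\<^sup>+m. ennreal (pmf p n) * (ennreal (w n m) * g m) \<partial>count_space UNIV) \<partial>count_space UNIV)"
    by (simp add: nn_integral_measure_pmf nn_integral_cmult)
  also have "\<dots> = (\<integral>\<^sup>+(n, m). ennreal (pmf p n) * (ennreal (w n m) * g m) \<partial>count_space UNIV)"
    using nn_integral_fst_count_space[of "\<lambda>(n, m). ennreal (pmf p n) * (ennreal (w n m) * g m)"] by simp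
  also have "\<dots> = (\<integral>\<^sup>+m. (\<integral>\<^sup>+n. ennreal (pmf p n) * (ennreal (w n m) * g m) \<partial>count_space UNIV) \<partial>count_space UNIV)"
    using nn_integral_snd_count_space[of "\<lambda>(n, m). ennreal (pmf p n) * (ennreal (w n m) * g m)"] by simp
  also have "\<dots> = (\<integral>\<^sup>+m. (\<integral>\<^sup>+n. ennreal (w n m) \<partial>measure_pmf p) * g m \<partial>count_space UNIV)"
    by (simp add: nn_integral_measure_pmf nn_integral_multc mult.assoc[symmetric])
  also have "\<dots> = (\<integral>\<^sup>+m. ennreal (pmf p m) * (ennreal (\<Sum>j\<in>J. a j m) * g m) \<partial>count_space UNIV)"
  proof (rule nn_integral_cong)
    fix m
    show "(\<integral>\<^sup>+n. ennreal (w n m) \<partial>measure_pmf p) * g m = ennreal (pmf p m) * (ennreal (\<Sum>j\<in>J. a j m) * g m)"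
      unfolding int_w by (simp add: ennreal_mult' mult.assoc)
  qed
  also have "\<dots> = (\<integral>\<^sup>+n. ennreal (\<Sum>j\<in>J. a j n) * g n \<partial>measure_pmf p)"
    by (simp add: nn_integral_measure_pmf)
  finally show ?thesis .
qed

text \<open>Split the generator into inflow \<open>F\<close> and outflow \<open>G\<close>. The
  outflow is at most \<open>Q * f\<close>, hence integrable, and \<open>nn_global_balance\<close>
  gives the inflow the same integral. With unbounded rates, integrability of \<open>f\<close> would
  not control \<open>G\<close>.\<close>

lemma
  assumes f: "integrable (measure_pmf p) f" and f_nonneg: "\<And>n. n \<in> X \<Longrightarrow> 0 \<le> f n"
  shows gen_integrable: "integrable (measure_pmf p) (gen f)"
    and gen_expectation: "(\<integral>n. gen f n \<partial>measure_pmf p) = 0"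
proof -
  define F where "F n = (\<Sum>j\<in>J. a j n * f (\<tau> j n))" for n
  define G where "G n = (\<Sum>j\<in>J. a j n) * f n" for n
  have gen_eq: "gen f n = F n - G n" for n
    by (simp add: generator_def F_def G_def sum_distrib_right sum_subtractf right_diff_distrib)
  have a_sum_nonneg: "0 \<le> (\<Sum>j\<in>J. a j n)" if "n \<in> X" for n
    using a_nonneg[OF that] by (simp add: sum_nonneg)
  have F_nonneg: "0 \<le> a j n * f (\<tau> j n)" if "n \<in> X" "j \<in> J" for n j
    using that a_nonneg f_nonneg \<tau>_in by (cases "a j n = 0") auto
  have G_int: "integrable (measure_pmf p) G"
  proof (rule Bochner_Integration.integrable_bound[where f="\<lambda>n. Q * f n"])
    show "AE n in measure_pmf p. norm (G n) \<le> norm (Q * f n)"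
      using p_in_X
    proof eventually_elim
      case (elim n)
      show ?case
        using a_sum_nonneg[OF elim] a_sum_le[OF elim] f_nonneg[OF elim]
        by (simp add: G_def abs_mult mult_right_mono)
    qed
  qed (use f in auto)
  have "(\<integral>\<^sup>+n. ennreal (F n) \<partial>measure_pmf p)
      = (\<integral>\<^sup>+n. (\<Sum>j\<in>J. ennreal (a j n) * ennreal (f (\<tau> j n))) \<partial>measure_pmf p)"
  proof (rule nn_integral_cong_AE, use p_in_X in eventually_elim)
    case (elim n)
    have "ennreal (F n) = (\<Sum>j\<in>J. ennreal (a j n * f (\<tau> j n)))"
      unfolding F_def using F_nonneg[OF elim] by (simp add: sum_ennreal)
    also have "\<dots> = (\<Sum>j\<in>J. ennreal (a j n) * ennreal (f (\<tau> j n)))"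
      using a_nonneg[OF elim] by (intro sum.cong refl ennreal_mult') auto
    finally show ?case .
  qed
  also have "\<dots> = (\<integral>\<^sup>+n. ennreal (\<Sum>j\<in>J. a j n) * ennreal (f n) \<partial>measure_pmf p)"
    by (rule nn_global_balance)
  also have "\<dots> = (\<integral>\<^sup>+n. ennreal (G n) \<partial>measure_pmf p)"
    by (rule nn_integral_cong_AE, use p_in_X in eventually_elim)
       (simp add: G_def ennreal_mult' a_sum_nonneg)
  also have "\<dots> = ennreal (\<integral>n. G n \<partial>measure_pmf p)"
  proof (rule nn_integral_eq_integral[OF G_int])
    show "AE n in measure_pmf p. 0 \<le> G n"
      using p_in_X by eventually_elim (simp add: G_def a_sum_nonneg f_nonneg)
  qed
  finally have nn_F: "(\<integral>\<^sup>+n. ennreal (F n) \<partial>measure_pmf p) = ennreal (\<integral>n. G n \<partial>measure_pmf p)" .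
  have F_pos: "AE n in measure_pmf p. 0 \<le> F n"
    using p_in_X by eventually_elim (simp add: F_def F_nonneg sum_nonneg)
  have F_int: "integrable (measure_pmf p) F"
    using F_pos by (rule integrableI_nonneg[rotated]) (auto simp: nn_F)
  have "0 \<le> (\<integral>n. G n \<partial>measure_pmf p)"
    by (rule integral_nonneg_AE, use p_in_X in eventually_elim) (simp add: G_def a_sum_nonneg f_nonneg)
  with nn_F nn_integral_eq_integral[OF F_int F_pos] integral_nonneg_AE[OF F_pos]
  have "(\<integral>n. F n \<partial>measure_pmf p) = (\<integral>n. G n \<partial>measure_pmf p)"
    by simp
  with F_int G_int show "integrable (measure_pmf p) (gen f)" "(\<integral>n. gen f n \<partial>measure_pmf p) = 0"
    by (simp_all add: gen_eq[abs_def])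
qed

section \<open>Foster bounds by truncation\<close>

lemma gen_min_le:
  assumes "n \<in> X"
  shows "gen (\<lambda>m. min (f m) M) n \<le> (if f n < M then gen f n else 0)"
proof (cases "f n < M")
  case True
  then have "gen (\<lambda>m. min (f m) M) n \<le> gen f n"
    unfolding generator_def by (intro sum_mono mult_left_mono a_nonneg[OF assms]) auto
  with True show ?thesis by simp
next
  case False
  then have "gen (\<lambda>m. min (f m) M) n \<le> 0"
    unfolding generator_def by (intro sum_nonpos mult_nonneg_nonpos a_nonneg[OF assms]) auto
  with False show ?thesis by simp
qed

text \<open>The integrability of \<open>f\<close> is not known in advance, so the mean-zero property
  is applied to the bounded truncations of \<open>f\<close>. Truncation keeps the drift inequality
  below the level and makes the drift nonpositive above it; monotone convergence then removes the
  level.\<close>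

lemma
  assumes f: "\<And>n. n \<in> X \<Longrightarrow> 0 \<le> f n"
    and g: "\<And>n. n \<in> X \<Longrightarrow> 0 \<le> g n" and h: "\<And>n. n \<in> X \<Longrightarrow> 0 \<le> h n"
    and h_int: "integrable (measure_pmf p) h"
    and drift: "\<And>n. n \<in> X \<Longrightarrow> gen f n \<le> h n - g n"
  shows foster_integrable: "integrable (measure_pmf p) g"
    and foster_expectation: "(\<integral>n. g n \<partial>measure_pmf p) \<le> (\<integral>n. h n \<partial>measure_pmf p)"
proof -
  have h_pos: "AE n in measure_pmf p. 0 \<le> h n"
    using p_in_X by eventually_elim (rule h)
  define T where "T k n = (if f n < real k then g n else 0)" for k n
  have T_le: "(\<integral>\<^sup>+n. ennreal (T k n) \<partial>measure_pmf p) \<le> ennreal (\<integral>n. h n \<partial>measure_pmf p)" for k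
  proof -
    let ?f = "\<lambda>m. min (f m) (real k)"
    have "AE n in measure_pmf p. norm (?f n) \<le> real k"
      using p_in_X by eventually_elim (use f in auto)
    then have int: "integrable (measure_pmf p) ?f"
      by (intro measure_pmf.integrable_const_bound) auto
    have nonneg: "0 \<le> ?f n" if "n \<in> X" for n using f[OF that] by simp
    \<comment> \<open>This function has the same mean as \<open>h\<close> and dominates
      \<open>T k\<close>: below level \<open>k\<close> by the drift inequality, above it because
      \<open>h\<close> is nonnegative.\<close>
    let ?g = "\<lambda>n. h n - gen ?f n"
    have g_int: "integrable (measure_pmf p) ?g"
      using h_int gen_integrable[of ?f, OF int nonneg] by simp
    have le: "AE n in measure_pmf p. 0 \<le> T k n \<and> T k n \<le> ?g n"
      using p_in_X
    proof eventually_elim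
      case (elim n)
      then show ?case
        using gen_min_le[OF elim, of f "real k"] drift[OF elim] h[OF elim] g[OF elim]
        by (auto simp: T_def split: if_splits)
    qed
    have "(\<integral>\<^sup>+n. ennreal (T k n) \<partial>measure_pmf p) \<le> (\<integral>\<^sup>+n. ennreal (?g n) \<partial>measure_pmf p)"
      by (rule nn_integral_mono_AE, use le in eventually_elim) (auto intro: ennreal_leI)
    also have "\<dots> = ennreal (\<integral>n. ?g n \<partial>measure_pmf p)"
      by (rule nn_integral_eq_integral[OF g_int]) (use le in eventually_elim, auto)
    also have "(\<integral>n. ?g n \<partial>measure_pmf p) = (\<integral>n. h n \<partial>measure_pmf p)"
      using h_int gen_integrable[of ?f, OF int nonneg] gen_expectation[of ?f, OF int nonneg] by simp
    finally show ?thesis .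
  qed
  have g_pos: "AE n in measure_pmf p. 0 \<le> g n"
    using p_in_X by eventually_elim (rule g)
  have "(\<integral>\<^sup>+n. ennreal (g n) \<partial>measure_pmf p) = (\<integral>\<^sup>+n. (SUP k. ennreal (T k n)) \<partial>measure_pmf p)"
  proof (rule nn_integral_cong_AE, use p_in_X in eventually_elim)
    case (elim n)
    show ?case
    proof (rule antisym)
      obtain k where "f n < real k" using reals_Archimedean2 by blast
      then have "ennreal (g n) = ennreal (T k n)" by (simp add: T_def)
      then show "ennreal (g n) \<le> (SUP k. ennreal (T k n))"
        by (auto intro: SUP_upper)
    qed (auto simp: T_def intro!: SUP_least)
  qed
  also have "\<dots> = (\<integral>\<^sup>+n. (SUP k. ennreal (T k n) * indicator X n) \<partial>measure_pmf p)"
    by (rule nn_integral_cong_AE, use p_in_X in eventually_elim) simp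
  also have "\<dots> = (SUP k. \<integral>\<^sup>+n. ennreal (T k n) * indicator X n \<partial>measure_pmf p)"
  proof (rule nn_integral_monotone_convergence_SUP)
    show "incseq (\<lambda>k n. ennreal (T k n) * indicator X n)"
      using g by (fastforce simp: incseq_def le_fun_def T_def indicator_def intro: ennreal_leI)
  qed auto
  also have "\<dots> \<le> (SUP k. \<integral>\<^sup>+n. ennreal (T k n) \<partial>measure_pmf p)"
    by (intro SUP_mono bexI nn_integral_mono) (auto simp: indicator_def)
  also have "\<dots> \<le> ennreal (\<integral>n. h n \<partial>measure_pmf p)"
    by (intro SUP_least T_le)
  finally have le: "(\<integral>\<^sup>+n. ennreal (g n) \<partial>measure_pmf p) \<le> ennreal (\<integral>n. h n \<partial>measure_pmf p)" .
  show g_int: "integrable (measure_pmf p) g"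
    using g_pos by (rule integrableI_nonneg[rotated]) (use le in \<open>auto simp: top_unique less_top intro: le_less_trans\<close>)
  show "(\<integral>n. g n \<partial>measure_pmf p) \<le> (\<integral>n. h n \<partial>measure_pmf p)"
    using le nn_integral_eq_integral[OF g_int g_pos] integral_nonneg_AE[OF h_pos] by simp
qed

end

section \<open>File sizes of class D\<close>

text \<open>The predicate \<open>link k\<close> records that phases \<open>k\<close> and
  \<open>Suc k\<close> lie in the same block, which replaces nested block indices by a single
  bidiagonal description. The last conjunct identifies phases without an incoming link with block
  starts, where the initial law is positive.\<close>

lemma diag_erlang_blocks:
  fixes blocks :: "(nat \<times> real) list"
  assumes "\<forall>(d, \<nu>) \<in> set blocks. 0 < d \<and> 0 < \<nu>"
  shows "\<exists>\<mu> link. let K = sum_list (map fst blocks);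
       S = diag_block_mat (map (\<lambda>(d, \<nu>). erlang_block d \<nu>) blocks) in
     S \<in> carrier_mat K K \<and>
     (\<forall>k<K. 0 < \<mu> k \<and> (link k \<longrightarrow> Suc k < K \<and> \<mu> (Suc k) = \<mu> k)) \<and>
     (\<forall>i<K. \<forall>j<K. S $$ (i, j) = (if j = i then - \<mu> i else if j = Suc i \<and> link i then \<mu> i else 0)) \<and>
     (\<forall>k<K. k = 0 \<or> \<not> link (k - 1) \<longrightarrow> (\<exists>b<length blocks. k = sum_list (map fst (take b blocks))))"
  using assms
proof (induction blocks)
  case Nil
  then show ?case by auto
next
  case (Cons blk blocks)
  obtain d \<nu> where blk: "blk = (d, \<nu>)" by (cases blk)
  with Cons.prems have d: "0 < d" "0 < \<nu>" by auto
  define K where "K = sum_list (map fst blocks)"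
  define S where "S = diag_block_mat (map (\<lambda>(d, \<nu>). erlang_block d \<nu>) blocks)"
  have "\<forall>(d, \<nu>) \<in> set blocks. 0 < d \<and> 0 < \<nu>"
    using Cons.prems by simp
  from Cons.IH[OF this, unfolded Let_def, folded K_def S_def]
  obtain \<mu> link where IH: "S \<in> carrier_mat K K"
    "\<forall>k<K. 0 < \<mu> k \<and> (link k \<longrightarrow> Suc k < K \<and> \<mu> (Suc k) = \<mu> k)"
    "\<forall>i<K. \<forall>j<K. S $$ (i, j) = (if j = i then - \<mu> i else if j = Suc i \<and> link i then \<mu> i else 0)"
    "\<forall>k<K. k = 0 \<or> \<not> link (k - 1) \<longrightarrow> (\<exists>b<length blocks. k = sum_list (map fst (take b blocks)))"
    by (elim exE conjE)
  note S = IH(1) and S_eq = IH(3)[rule_format] and start = IH(4)[rule_format]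
  have \<mu>: "0 < \<mu> k" "link k \<Longrightarrow> Suc k < K \<and> \<mu> (Suc k) = \<mu> k" if "k < K" for k
    using IH(2) that by auto
  \<comment> \<open>The new block occupies the phases below \<open>d\<close>; the data of the
    remaining blocks are shifted by \<open>d\<close>.\<close>
  define \<mu>' where "\<mu>' k = (if k < d then \<nu> else \<mu> (k - d))" for k
  define link' where "link' k = (if k < d then Suc k < d else link (k - d))" for k
  have E: "erlang_block d \<nu> \<in> carrier_mat d d" by (simp add: erlang_block_def)
  have S': "diag_block_mat (map (\<lambda>(d, \<nu>). erlang_block d \<nu>) (blk # blocks))
      = four_block_mat (erlang_block d \<nu>) (0\<^sub>m d K) (0\<^sub>m K d) S" (is "?S = _")
    using S E by (simp add: blk S_def[symmetric] Let_def)
  have K': "sum_list (map fst (blk # blocks)) = d + K"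
    by (simp add: blk K_def)
  have 1: "?S \<in> carrier_mat (d + K) (d + K)"
    unfolding S' using E S by auto
  have 2: "0 < \<mu>' k \<and> (link' k \<longrightarrow> Suc k < d + K \<and> \<mu>' (Suc k) = \<mu>' k)" if "k < d + K" for k
  proof (cases "k < d")
    case True
    then show ?thesis using d by (auto simp: \<mu>'_def link'_def)
  next
    case False
    then have "k - d < K" "Suc k - d = Suc (k - d)" using that by auto
    with \<mu>[of "k - d"] False show ?thesis by (auto simp: \<mu>'_def link'_def)
  qed
  have 3: "?S $$ (i, j) = (if j = i then - \<mu>' i else if j = Suc i \<and> link' i then \<mu>' i else 0)"
    if "i < d + K" "j < d + K" for i j
  proof -
    have "?S $$ (i, j) = (if i < d then if j < d then erlang_block d \<nu> $$ (i, j) else 0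
        else if j < d then 0 else S $$ (i - d, j - d))"
      unfolding S' using that E S by (subst index_mat_four_block) auto
    also have "\<dots> = (if j = i then - \<mu>' i else if j = Suc i \<and> link' i then \<mu>' i else 0)"
      using that S_eq[of "i - d" "j - d"] by (auto simp: erlang_block_def \<mu>'_def link'_def)
    finally show ?thesis .
  qed
  have 4: "\<exists>b<length (blk # blocks). k = sum_list (map fst (take b (blk # blocks)))"
    if "k < d + K" "k = 0 \<or> \<not> link' (k - 1)" for k
  proof (cases "k < d")
    case True
    with that have "k = 0" by (cases k) (auto simp: link'_def)
    then show ?thesis by (intro exI[of _ 0]) auto
  next
    case False
    \<comment> \<open>At \<open>k = d\<close> the preceding phase is the last of the new block and
      is unlinked; beyond that the question is the same for the shifted phase.\<close>
    have "k - d = 0 \<or> \<not> link (k - d - 1)"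
      using False that d by (cases "k = d") (auto simp: link'_def diff_commute split: if_splits)
    moreover have "k - d < K" using False that by auto
    ultimately obtain b where "b < length blocks" "k - d = sum_list (map fst (take b blocks))"
      using start[of "k - d"] by auto
    then show ?thesis using False by (intro exI[of _ "Suc b"]) (auto simp: blk)
  qed
  show ?case
    unfolding Let_def K' using 1 2 3 4 by (intro exI[of _ \<mu>'] exI[of _ link']) blast
qed

text \<open>The later arguments see the shape of the generator only through this form: rates
  constant along links, and a positive initial probability wherever a chain of links starts.\<close>

lemma class_D_bidiagonal:
  assumes "class_D \<pi> S"
  obtains \<mu> link where "S \<in> carrier_mat (dim_row S) (dim_row S)" "dim_vec \<pi> = dim_row S"
    "\<And>k. k < dim_row S \<Longrightarrow> 0 < \<mu> k"
    "\<And>k. k < dim_row S \<Longrightarrow> link k \<Longrightarrow> Suc k < dim_row S \<and> \<mu> (Suc k) = \<mu> k"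
    "\<And>i j. i < dim_row S \<Longrightarrow> j < dim_row S \<Longrightarrow>
       S $$ (i, j) = (if j = i then - \<mu> i else if j = Suc i \<and> link i then \<mu> i else 0)"
    "\<And>k. k < dim_row S \<Longrightarrow> 0 \<le> \<pi> $ k"
    "\<And>k. k < dim_row S \<Longrightarrow> k = 0 \<or> \<not> link (k - 1) \<Longrightarrow> 0 < \<pi> $ k"
proof -
  from assms obtain blocks :: "(nat \<times> real) list" where
    blocks: "\<forall>(d, \<nu>) \<in> set blocks. 0 < d \<and> 0 < \<nu>"
      "S = diag_block_mat (map (\<lambda>(d, \<nu>). erlang_block d \<nu>) blocks)"
      "\<forall>b < length blocks. 0 < \<pi> $ sum_list (map fst (take b blocks))"
    and \<pi>: "dim_vec \<pi> = dim_row S" "\<forall>k < dim_vec \<pi>. 0 \<le> \<pi> $ k"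
    unfolding class_D_def by blast
  define K where "K = sum_list (map fst blocks)"
  obtain \<mu> link where *: "S \<in> carrier_mat K K"
    "\<forall>k<K. 0 < \<mu> k \<and> (link k \<longrightarrow> Suc k < K \<and> \<mu> (Suc k) = \<mu> k)"
    "\<forall>i<K. \<forall>j<K. S $$ (i, j) = (if j = i then - \<mu> i else if j = Suc i \<and> link i then \<mu> i else 0)"
    "\<forall>k<K. k = 0 \<or> \<not> link (k - 1) \<longrightarrow> (\<exists>b<length blocks. k = sum_list (map fst (take b blocks)))"
    using diag_erlang_blocks[OF blocks(1)] unfolding K_def blocks(2) Let_def by blast
  then have K: "dim_row S = K" by auto
  show thesis
  proof (rule that[of \<mu> link])
    show "0 < \<pi> $ k" if "k < dim_row S" "k = 0 \<or> \<not> link (k - 1)" for k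
      using *(4) blocks(3) that K by metis
  qed (use * \<pi> K in auto)
qed

locale bidiagonal =
  fixes K :: nat and S :: "nat \<Rightarrow> nat \<Rightarrow> real" and \<mu> :: "nat \<Rightarrow> real" and link :: "nat \<Rightarrow> bool"
  assumes \<mu>_pos: "k < K \<Longrightarrow> 0 < \<mu> k"
    and link: "k < K \<Longrightarrow> link k \<Longrightarrow> Suc k < K \<and> \<mu> (Suc k) = \<mu> k"
    and S_eq: "i < K \<Longrightarrow> j < K \<Longrightarrow> S i j = (if j = i then - \<mu> i else if j = Suc i \<and> link i then \<mu> i else 0)"
begin

lemma row_sum:
  assumes "k < K"
  shows "(\<Sum>j<K. S k j * f j) = - \<mu> k * f k + (if link k then \<mu> k * f (Suc k) else 0)"
proof -
  have "(\<Sum>j<K. S k j * f j) = (\<Sum>j<K. (if j = k then - \<mu> k * f k else 0) +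
      (if j = Suc k then if link k then \<mu> k * f (Suc k) else 0 else 0))"
    using assms by (intro sum.cong refl) (auto simp: S_eq)
  also have "\<dots> = - \<mu> k * f k + (if link k then \<mu> k * f (Suc k) else 0)"
    using assms link[of k] by (simp add: sum.distrib)
  finally show ?thesis .
qed

lemma column_sum:
  assumes "j < K"
  shows "(\<Sum>k<K. f k * S k j) = - \<mu> j * f j + (if j \<noteq> 0 \<and> link (j - 1) then \<mu> (j - 1) * f (j - 1) else 0)"
proof -
  have "(\<Sum>k<K. f k * S k j) = (\<Sum>k<K. (if k = j then - \<mu> j * f j else 0) +
      (if k = j - 1 then if j \<noteq> 0 \<and> link (j - 1) then \<mu> (j - 1) * f (j - 1) else 0 else 0))"
    using assms by (intro sum.cong refl) (auto simp: S_eq)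
  also have "\<dots> = - \<mu> j * f j + (if j \<noteq> 0 \<and> link (j - 1) then \<mu> (j - 1) * f (j - 1) else 0)"
    using assms by (cases j) (simp_all add: sum.distrib)
  finally show ?thesis .
qed

text \<open>Backward induction along the block: row \<open>k\<close> reads
  \<open>\<mu> k * m k = 1\<close>, plus \<open>\<mu> k * m (Suc k)\<close> when \<open>k\<close> is
  linked.\<close>

lemma mean_residual_pos:
  assumes m: "\<And>k. k < K \<Longrightarrow> (\<Sum>j<K. S k j * m j) = - 1" and "k < K"
  shows "0 < m k"
  using \<open>k < K\<close>
proof (induction "K - k" arbitrary: k rule: less_induct)
  case less
  have "\<mu> k * m k = 1 + (if link k then \<mu> k * m (Suc k) else 0)"
    using m[OF less.prems] row_sum[OF less.prems, of m] by simp
  moreover have "0 < m (Suc k)" if "link k"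
    using less.hyps[of "Suc k"] link[OF less.prems that] less.prems by auto
  ultimately have "0 < \<mu> k * m k"
    using \<mu>_pos[OF less.prems] by (auto intro: add_pos_nonneg)
  then show ?case using \<mu>_pos[OF less.prems] by (simp add: zero_less_mult_iff)
qed

text \<open>Completing a linked phase saves its mean duration: row \<open>k\<close> says
  \<open>\<mu> k * (m k - m (Suc k)) = 1\<close>.\<close>

lemma mean_residual_decreasing:
  assumes m: "\<And>k. k < K \<Longrightarrow> (\<Sum>j<K. S k j * m j) = - 1" and "k < K" "link k"
  shows "m (Suc k) < m k"
proof -
  have "\<mu> k * m (Suc k) < \<mu> k * m k"
    using m[OF \<open>k < K\<close>] row_sum[OF \<open>k < K\<close>, of m] \<open>link k\<close> by simp
  then show ?thesis using \<mu>_pos[OF \<open>k < K\<close>] by simp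
qed

text \<open>\<open>u\<close> is the expected time spent in each phase, that is \<open>\<pi>\<close>
  times the inverse of \<open>- S\<close>. Within a block the flow through the phases can only grow
  by the initial mass that enters later, while the rate is constant, so \<open>u\<close> is
  nondecreasing.\<close>

lemma occupation_exists:
  assumes \<pi>: "\<And>k. k < K \<Longrightarrow> 0 \<le> \<pi> k" "\<And>k. k < K \<Longrightarrow> k = 0 \<or> \<not> link (k - 1) \<Longrightarrow> 0 < \<pi> k"
  obtains u where "\<And>j. j < K \<Longrightarrow> (\<Sum>k<K. u k * S k j) = - \<pi> j" "\<And>k. k < K \<Longrightarrow> 0 < u k"
    "\<And>k. k < K \<Longrightarrow> link k \<Longrightarrow> u k \<le> u (Suc k)"
proof -
  \<comment> \<open>Forward substitution in the column equations, which involve only a phase and its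
    predecessor.\<close>
  define u where "u = rec_nat (\<pi> 0 / \<mu> 0) (\<lambda>k v. (\<pi> (Suc k) + (if link k then \<mu> k * v else 0)) / \<mu> (Suc k))"
  have u0: "u 0 = \<pi> 0 / \<mu> 0" and
    uS: "u (Suc k) = (\<pi> (Suc k) + (if link k then \<mu> k * u k else 0)) / \<mu> (Suc k)" for k
    by (simp_all add: u_def)
  have eq: "\<mu> j * u j = \<pi> j + (if j \<noteq> 0 \<and> link (j - 1) then \<mu> (j - 1) * u (j - 1) else 0)" if "j < K" for j
    using \<mu>_pos[OF that] by (cases j) (auto simp: u0 uS)
  have pos: "0 < u k" if "k < K" for k
    using that
  proof (induction k)
    case 0
    then show ?case using \<pi>(2)[of 0] \<mu>_pos[of 0] by (simp add: u0)
  next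
    case (Suc k)
    then have k: "k < K" "0 < u k" by auto
    have "0 < \<pi> (Suc k) + (if link k then \<mu> k * u k else 0)"
      using \<pi>(1)[OF Suc.prems] \<pi>(2)[OF Suc.prems] \<mu>_pos[OF k(1)] k(2)
      by (auto intro!: add_nonneg_pos)
    then show ?case using \<mu>_pos[OF Suc.prems] by (simp add: uS)
  qed
  show thesis
  proof (rule that)
    fix j assume "j < K"
    then show "(\<Sum>k<K. u k * S k j) = - \<pi> j"
      using eq[of j] by (simp add: column_sum)
  next
    fix k assume k: "k < K" "link k"
    then have "\<mu> (Suc k) * u (Suc k) = \<pi> (Suc k) + \<mu> (Suc k) * u k"
      using eq[of "Suc k"] link[OF k] by simp
    then show "u k \<le> u (Suc k)"
      using \<mu>_pos[of "Suc k"] \<pi>(1)[of "Suc k"] link[OF k]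
        mult_le_cancel_left_pos[of "\<mu> (Suc k)" "u k" "u (Suc k)"] by simp
  qed (rule pos)
qed

text \<open>Each cross term \<open>v k * v (Suc k)\<close> carries the smaller weight
  \<open>A (Suc k)\<close> and is split into half squares. The half square at \<open>Suc k\<close>
  is paid by half of that phase's diagonal term; at \<open>k\<close> the strict decrease of
  \<open>A\<close> leaves a positive remainder.\<close>

lemma quadratic_form_coercive:
  assumes A_pos: "\<And>k. k < K \<Longrightarrow> 0 < A k" and A_dec: "\<And>k. k < K \<Longrightarrow> link k \<Longrightarrow> A (Suc k) < A k"
  obtains c where "0 < c" "\<And>v. c * (\<Sum>k<K. (v k)\<^sup>2) \<le> - (\<Sum>k<K. \<Sum>j<K. v k * S k j * (A j * v j))"
proof -
  \<comment> \<open>The coefficient of the square of \<open>v k\<close> that survives the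
    splitting.\<close>
  define g where "g k = \<mu> k * (A k - (if link k then A (Suc k) else 0)) / 2" for k
  have g_pos: "0 < g k" if "k < K" for k
    using that \<mu>_pos[OF that] A_pos[OF that] A_dec[OF that] by (simp add: g_def)
  \<comment> \<open>The inserted \<open>1\<close> keeps the minimum defined when there are no
    phases.\<close>
  define c where "c = Min (insert 1 (g ` {..<K}))"
  have c: "0 < c" "\<And>k. k < K \<Longrightarrow> c \<le> g k"
    using g_pos by (auto simp: c_def)
  have "c * (\<Sum>k<K. (v k)\<^sup>2) \<le> - (\<Sum>k<K. \<Sum>j<K. v k * S k j * (A j * v j))" for v
  proof -
    define L where "L = {k. k < K \<and> link k}"
    have finL: "finite L" by (simp add: L_def)
    have "- (\<Sum>k<K. \<Sum>j<K. v k * S k j * (A j * v j))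
        = (\<Sum>k<K. - (v k * (\<Sum>j<K. S k j * (A j * v j))))"
      by (simp add: sum_negf sum_distrib_left mult.assoc)
    also have "\<dots> = (\<Sum>k<K. \<mu> k * A k * (v k)\<^sup>2 - (if link k then \<mu> k * A (Suc k) * (v k * v (Suc k)) else 0))"
      by (intro sum.cong refl, subst row_sum) (auto simp: algebra_simps power2_eq_square)
    also have "\<dots> = (\<Sum>k<K. \<mu> k * A k * (v k)\<^sup>2) - (\<Sum>k\<in>L. \<mu> k * A (Suc k) * (v k * v (Suc k)))"
      by (simp add: sum_subtractf L_def sum.inter_filter[symmetric])
    finally have form: "- (\<Sum>k<K. \<Sum>j<K. v k * S k j * (A j * v j)) =
        (\<Sum>k<K. \<mu> k * A k * (v k)\<^sup>2) - (\<Sum>k\<in>L. \<mu> k * A (Suc k) * (v k * v (Suc k)))" .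
    have "(\<Sum>k\<in>L. \<mu> k * A (Suc k) * (v k * v (Suc k)))
        \<le> (\<Sum>k\<in>L. \<mu> k * A (Suc k) * (v k)\<^sup>2 / 2 + \<mu> (Suc k) * A (Suc k) * (v (Suc k))\<^sup>2 / 2)"
    proof (rule sum_mono)
      fix k assume "k \<in> L"
      then have k: "k < K" "link k" by (auto simp: L_def)
      have "0 < \<mu> k * A (Suc k)"
        using link[OF k] A_pos[of "Suc k"] \<mu>_pos[OF k(1)] by simp
      moreover have "v k * v (Suc k) \<le> (v k)\<^sup>2 / 2 + (v (Suc k))\<^sup>2 / 2"
        using sum_squares_bound[of "v k" "v (Suc k)"] by simp
      ultimately have "\<mu> k * A (Suc k) * (v k * v (Suc k)) \<le> \<mu> k * A (Suc k) * ((v k)\<^sup>2 / 2 + (v (Suc k))\<^sup>2 / 2)"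
        by (intro mult_left_mono) auto
      then show "\<mu> k * A (Suc k) * (v k * v (Suc k))
          \<le> \<mu> k * A (Suc k) * (v k)\<^sup>2 / 2 + \<mu> (Suc k) * A (Suc k) * (v (Suc k))\<^sup>2 / 2"
        using link[OF k] by (simp add: algebra_simps)
    qed
    also have "\<dots> = (\<Sum>k<K. (if link k then \<mu> k * A (Suc k) * (v k)\<^sup>2 / 2 else 0))
        + (\<Sum>k\<in>Suc ` L. \<mu> k * A k * (v k)\<^sup>2 / 2)"
      by (simp add: sum.distrib sum.reindex L_def sum.inter_filter[symmetric])
    also have "(\<Sum>k\<in>Suc ` L. \<mu> k * A k * (v k)\<^sup>2 / 2) \<le> (\<Sum>k<K. \<mu> k * A k * (v k)\<^sup>2 / 2)"
    proof (rule sum_mono2)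
      show "Suc ` L \<subseteq> {..<K}" using link by (auto simp: L_def)
      show "0 \<le> \<mu> k * A k * (v k)\<^sup>2 / 2" if "k \<in> {..<K} - Suc ` L" for k
        using that \<mu>_pos[of k] A_pos[of k] by simp
    qed simp
    finally have "(\<Sum>k<K. \<mu> k * A k * (v k)\<^sup>2) - (\<Sum>k<K. (if link k then \<mu> k * A (Suc k) * (v k)\<^sup>2 / 2 else 0))
          - (\<Sum>k<K. \<mu> k * A k * (v k)\<^sup>2 / 2) \<le> - (\<Sum>k<K. \<Sum>j<K. v k * S k j * (A j * v j))"
      unfolding form by simp
    also have "(\<Sum>k<K. \<mu> k * A k * (v k)\<^sup>2) - (\<Sum>k<K. (if link k then \<mu> k * A (Suc k) * (v k)\<^sup>2 / 2 else 0))
          - (\<Sum>k<K. \<mu> k * A k * (v k)\<^sup>2 / 2) = (\<Sum>k<K. g k * (v k)\<^sup>2)"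
      unfolding sum_subtractf[symmetric] by (intro sum.cong refl) (simp add: g_def field_simps)
    finally have "(\<Sum>k<K. g k * (v k)\<^sup>2) \<le> - (\<Sum>k<K. \<Sum>j<K. v k * S k j * (A j * v j))" .
    moreover have "c * (\<Sum>k<K. (v k)\<^sup>2) \<le> (\<Sum>k<K. g k * (v k)\<^sup>2)"
      unfolding sum_distrib_left using c(2) by (intro sum_mono mult_right_mono) auto
    ultimately show ?thesis by simp
  qed
  with c(1) show thesis by (rule that)
qed

end

text \<open>The weights \<open>m j / u j\<close> make the generator dissipative because, within an Erlang block,
  the mean residual size \<open>m\<close> decreases while the occupation measure \<open>u\<close> increases.\<close>

lemma class_D_phases:
  assumes D: "class_D \<pi> S"
  obtains m u c where
    "\<And>k. k < dim_row S \<Longrightarrow> 0 < m k" "\<And>k. k < dim_row S \<Longrightarrow> 0 < u k" "0 < c"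
    "\<And>k. k < dim_row S \<Longrightarrow> (\<Sum>j<dim_row S. S $$ (k, j) * m j) = - 1"
    "\<And>j. j < dim_row S \<Longrightarrow> (\<Sum>k<dim_row S. u k * S $$ (k, j)) = - \<pi> $ j"
    "(\<Sum>k<dim_row S. u k) = mean_file_size \<pi> S"
    "\<And>v. c * (\<Sum>k<dim_row S. (v k)\<^sup>2)
       \<le> - (\<Sum>k<dim_row S. \<Sum>j<dim_row S. v k * S $$ (k, j) * (m j / u j * v j))"
    "\<And>k j. k < dim_row S \<Longrightarrow> j < dim_row S \<Longrightarrow> j \<noteq> k \<Longrightarrow> 0 \<le> S $$ (k, j)"
    "\<And>k. k < dim_row S \<Longrightarrow> (\<Sum>j<dim_row S. S $$ (k, j)) \<le> 0"
proof -
  define K where "K = dim_row S"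
  obtain \<mu> link where S: "S \<in> carrier_mat K K" "dim_vec \<pi> = K"
    and \<mu>: "\<And>k. k < K \<Longrightarrow> 0 < \<mu> k"
      "\<And>k. k < K \<Longrightarrow> link k \<Longrightarrow> Suc k < K \<and> \<mu> (Suc k) = \<mu> k"
      "\<And>i j. i < K \<Longrightarrow> j < K \<Longrightarrow>
        S $$ (i, j) = (if j = i then - \<mu> i else if j = Suc i \<and> link i then \<mu> i else 0)"
    and \<pi>: "\<And>k. k < K \<Longrightarrow> 0 \<le> \<pi> $ k"
      "\<And>k. k < K \<Longrightarrow> k = 0 \<or> \<not> link (k - 1) \<Longrightarrow> 0 < \<pi> $ k"
  proof (rule class_D_bidiagonal[OF D, folded K_def])
    fix \<mu> link
    assume "S \<in> carrier_mat K K" "dim_vec \<pi> = K" "\<And>k. k < K \<Longrightarrow> 0 < \<mu> k"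
      "\<And>k. k < K \<Longrightarrow> link k \<Longrightarrow> Suc k < K \<and> \<mu> (Suc k) = \<mu> k"
      "\<And>i j. i < K \<Longrightarrow> j < K \<Longrightarrow>
        S $$ (i, j) = (if j = i then - \<mu> i else if j = Suc i \<and> link i then \<mu> i else 0)"
      "\<And>k. k < K \<Longrightarrow> 0 \<le> \<pi> $ k"
      "\<And>k. k < K \<Longrightarrow> k = 0 \<or> \<not> link (k - 1) \<Longrightarrow> 0 < \<pi> $ k"
    then show thesis by (rule that)
  qed
  interpret bidiagonal K "\<lambda>i j. S $$ (i, j)" \<mu> link
    by unfold_locales (use \<mu> in auto)
  have nS: "- S \<in> carrier_mat K K" using S by simp
  have "det (- S) = prod_list (diag_mat (- S))"
    by (rule det_upper_triangular[OF _ nS]) (use S in \<open>auto simp: upper_triangular_def \<mu>(3)\<close>)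
  also have "diag_mat (- S) = map \<mu> [0..<K]"
    using S by (auto simp: diag_mat_def \<mu>(3))
  also have "prod_list (map \<mu> [0..<K]) \<noteq> 0"
    using \<mu>(1) by (force simp: prod_list_zero_iff)
  finally have "- S \<in> Units (ring_mat TYPE(real) K ())"
    by (rule det_non_zero_imp_unit[OF nS])
  then obtain T where T: "mat_inverse (- S) = Some T"
    using mat_inverse(1)[OF nS, where b="()"] by (cases "mat_inverse (- S)") auto
  then have T': "- S * T = 1\<^sub>m K" "T \<in> carrier_mat K K"
    using mat_inverse(2)[OF nS] by auto
  define one where "one = Matrix.vec K (\<lambda>_. 1 :: real)"
  define m where "m k = (T *\<^sub>v one) $ k" for k
  have one: "one \<in> carrier_vec K" by (simp add: one_def)
  have "- S *\<^sub>v (T *\<^sub>v one) = one"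
    using assoc_mult_mat_vec[OF nS T'(2) one] T'(1) one by simp
  then have Sm: "(\<Sum>j<K. S $$ (k, j) * m j) = - 1" if "k < K" for k
  proof -
    have "(- S *\<^sub>v (T *\<^sub>v one)) $ k = (\<Sum>j<K. - (S $$ (k, j) * m j))"
      using that S T'(2) by (simp add: scalar_prod_def[of "Matrix.row S k"] scalar_prod_def[of "Matrix.row (- S) k"]
        m_def atLeast0LessThan sum_negf)
    with \<open>- S *\<^sub>v (T *\<^sub>v one) = one\<close> that show ?thesis
      by (simp add: one_def sum_negf)
  qed
  obtain u where u: "\<And>j. j < K \<Longrightarrow> (\<Sum>k<K. u k * S $$ (k, j)) = - \<pi> $ j" "\<And>k. k < K \<Longrightarrow> 0 < u k"
    "\<And>k. k < K \<Longrightarrow> link k \<Longrightarrow> u k \<le> u (Suc k)"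
    using occupation_exists[of "\<lambda>k. \<pi> $ k", OF \<pi>] by blast
  have m_pos: "0 < m k" if "k < K" for k
    by (rule mean_residual_pos[OF Sm that])
  have "m (Suc k) / u (Suc k) < m k / u k" if "k < K" "link k" for k
  proof -
    have "m (Suc k) / u (Suc k) \<le> m (Suc k) / u k"
      using u(2,3) that link[OF that] m_pos[of "Suc k"]
      by (intro divide_left_mono mult_pos_pos) auto
    also have "\<dots> < m k / u k"
      using mean_residual_decreasing[of m, OF Sm that] u(2)[OF that(1)] by (simp add: divide_strict_right_mono)
    finally show ?thesis .
  qed
  then obtain c where c: "0 < c"
    "\<And>v. c * (\<Sum>k<K. (v k)\<^sup>2) \<le> - (\<Sum>k<K. \<Sum>j<K. v k * S $$ (k, j) * (m j / u j * v j))"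
    using quadratic_form_coercive[of "\<lambda>k. m k / u k"] m_pos u(2) divide_pos_pos by (auto simp del: times_divide_eq_left)
  \<comment> \<open>The bilinear expression \<open>- u S m\<close> is evaluated from both ends:
    \<open>u S = - \<pi>\<close> gives the mean size, \<open>S m = - 1\<close> gives the total
    occupation time.\<close>
  have "mean_file_size \<pi> S = (\<Sum>j<K. \<pi> $ j * m j)"
    using S T'(2) by (simp add: mean_file_size_def T one_def[symmetric] m_def scalar_prod_def[of \<pi>] atLeast0LessThan)
  also have "\<dots> = (\<Sum>j<K. (\<Sum>k<K. - (u k * S $$ (k, j))) * m j)"
    using u(1) by (intro sum.cong refl) (auto simp: sum_negf)
  also have "\<dots> = (\<Sum>j<K. \<Sum>k<K. - (u k * (S $$ (k, j) * m j)))"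
    by (simp add: sum_distrib_right mult.assoc)
  also have "\<dots> = (\<Sum>k<K. u k * - (\<Sum>j<K. S $$ (k, j) * m j))"
    by (subst sum.swap) (simp add: sum_distrib_left sum_negf)
  also have "\<dots> = (\<Sum>k<K. u k)"
    using Sm by (intro sum.cong refl) auto
  finally have sum_u: "(\<Sum>k<K. u k) = mean_file_size \<pi> S" by simp
  have offdiag: "0 \<le> S $$ (k, j)" if "k < K" "j < K" "j \<noteq> k" for k j
    using that \<mu>(1)[OF that(1)] by (simp add: S_eq)
  have row: "(\<Sum>j<K. S $$ (k, j)) \<le> 0" if "k < K" for k
    using row_sum[OF that, of "\<lambda>_. 1"] \<mu>(1)[OF that] by simp
  show thesis
    unfolding K_def[symmetric]
    by (rule that[of m u c, folded K_def]) (fact m_pos u(1,2) c Sm sum_u offdiag row)+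
qed

section \<open>Multipliers of the proportionally fair allocation\<close>

lemma utility_eq:
  assumes "\<And>r. 0 < N r \<Longrightarrow> 0 < y r"
  shows "utility \<kappa> N y = ereal (\<Sum>r\<in>UNIV. \<kappa> r * real (N r) * ln (y r))"
proof -
  have "ereal (\<kappa> r * real (N r)) * ext_log (y r) = ereal (\<kappa> r * real (N r) * ln (y r))" for r
    using assms[of r] by (cases "N r = 0") (auto simp: ext_log_def)
  then show ?thesis by (simp add: utility_def)
qed

text \<open>One active route with rate 0 contributes minus infinity. The other terms must be shown
  different from plus infinity, since otherwise the extended sum would not stay at minus
  infinity.\<close>

lemma utility_MInfty:
  assumes \<kappa>: "\<And>r. 0 < \<kappa> r" and s: "0 < N s" "y s \<le> 0"
  shows "utility \<kappa> N y = - \<infinity>"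
proof -
  have "ereal (\<kappa> r * real (N r)) * ext_log (y r) \<noteq> \<infinity>" for r
    using \<kappa>[of r] by (cases "N r = 0") (simp_all add: ext_log_def mult_less_0_iff)
  then have "(\<Sum>r\<in>UNIV - {s}. ereal (\<kappa> r * real (N r)) * ext_log (y r)) \<noteq> \<infinity>" (is "?rest \<noteq> _")
    by (simp add: sum_Pinfty)
  moreover have "ereal (\<kappa> s * real (N s)) * ext_log (y s) = - \<infinity>"
    using \<kappa>[of s] s by (simp add: ext_log_def)
  moreover have "utility \<kappa> N y = ereal (\<kappa> s * real (N s)) * ext_log (y s) + ?rest"
    unfolding utility_def by (rule sum.remove) auto
  ultimately show ?thesis by (cases ?rest) auto
qed

text \<open>Giving the same small rate to every flow is feasible and has finite utility, whereas
  starving an active route costs minus infinity.\<close>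

lemma prop_fair_pos:
  fixes route :: "'r::finite \<Rightarrow> 'l::finite set"
  assumes C: "\<And>l. 0 < C l" and \<kappa>: "\<And>r. 0 < \<kappa> r" and x: "prop_fair route C \<kappa> N x" and r: "0 < N r"
  shows "0 < x r"
proof (rule ccontr)
  assume "\<not> 0 < x r"
  then have "utility \<kappa> N x = - \<infinity>"
    using utility_MInfty[of \<kappa> N r x] \<kappa> r by simp
  \<comment> \<open>At least the total number of flows, with 1 added so that division is safe in the
    empty state.\<close>
  define M where "M = 1 + (\<Sum>r\<in>UNIV. real (N r))"
  define \<delta> where "\<delta> = Min (range C) / M"
  define y where "y r = (if 0 < N r then \<delta> else 0)" for r
  have M: "0 < M" unfolding M_def by (intro add_pos_nonneg sum_nonneg) auto
  have \<delta>: "0 < \<delta>" using C M by (auto simp: \<delta>_def)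
  have "link_load route (\<lambda>r. real (N r) * y r) l \<le> C l" for l
  proof -
    have "link_load route (\<lambda>r. real (N r) * y r) l \<le> (\<Sum>r\<in>UNIV. real (N r) * y r)"
      unfolding link_load_def by (rule sum_mono2) (use \<delta> in \<open>auto simp: y_def\<close>)
    also have "\<dots> \<le> (\<Sum>r\<in>UNIV. real (N r) * \<delta>)"
      by (rule sum_mono) (use \<delta> in \<open>auto simp: y_def\<close>)
    also have "\<dots> = (M - 1) * \<delta>" by (simp add: M_def sum_distrib_right)
    also have "\<dots> \<le> M * \<delta>" using \<delta> by (simp add: left_diff_distrib)
    also have "\<dots> = Min (range C)" using M by (simp add: \<delta>_def)
    also have "\<dots> \<le> C l" by simp
    finally show ?thesis .
  qed
  then have "feasible route C N y"
    using \<delta> by (auto simp: feasible_def y_def)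
  then have "utility \<kappa> N y \<le> utility \<kappa> N x"
    using x by (simp add: prop_fair_def)
  moreover have "utility \<kappa> N y = ereal (\<Sum>r\<in>UNIV. \<kappa> r * real (N r) * ln (y r))"
    by (rule utility_eq) (simp add: y_def \<delta>)
  ultimately show False
    using \<open>utility \<kappa> N x = - \<infinity>\<close> by simp
qed

text \<open>Farkas' lemma: a finitely generated cone is closed, so a point outside it is strictly
  separated, and scaling along the generators makes the separating functional homogeneous.\<close>

lemma finitely_generated_cone_cases:
  fixes a :: "'i \<Rightarrow> 'a::euclidean_space" and g :: 'a
  assumes T: "finite T"
  obtains (generated) p where "\<And>i. i \<in> T \<Longrightarrow> 0 \<le> p i" "g = (\<Sum>i\<in>T. p i *\<^sub>R a i)"
  | (separated) y where "\<And>i. i \<in> T \<Longrightarrow> inner y (a i) \<le> 0" "0 < inner y g"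
proof (cases "g \<in> convex_cone hull (a ` T)")
  case True
  let ?K = "{\<Sum>i\<in>T. p i *\<^sub>R a i |p. \<forall>i\<in>T. 0 \<le> p i}"
  have "convex_cone hull (a ` T) \<subseteq> ?K"
  proof (rule hull_minimal)
    show "a ` T \<subseteq> ?K"
    proof
      fix z assume "z \<in> a ` T"
      then obtain i where i: "i \<in> T" "z = a i" by auto
      with T have "z = (\<Sum>j\<in>T. (if j = i then 1 else 0) *\<^sub>R a j)"
        by (simp add: if_distrib[of "\<lambda>c. c *\<^sub>R _"] cong: if_cong)
      then show "z \<in> ?K" by fastforce
    qed
    show "convex_cone ?K"
      unfolding convex_cone_iff
    proof (intro conjI ballI allI impI)
      show "0 \<in> ?K" by (rule CollectI, rule exI[of _ "\<lambda>_. 0"]) simp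
      fix u assume "u \<in> ?K"
      then obtain p where p: "u = (\<Sum>i\<in>T. p i *\<^sub>R a i)" "\<forall>i\<in>T. 0 \<le> p i" by auto
      show "u + v \<in> ?K" if "v \<in> ?K" for v
      proof -
        from that obtain q where "v = (\<Sum>i\<in>T. q i *\<^sub>R a i)" "\<forall>i\<in>T. 0 \<le> q i" by auto
        with p show ?thesis
          by (intro CollectI exI[of _ "\<lambda>i. p i + q i"]) (simp add: scaleR_add_left sum.distrib)
      qed
      show "c *\<^sub>R u \<in> ?K" if "0 \<le> c" for c
        using that p by (intro CollectI exI[of _ "\<lambda>i. c * p i"]) (simp add: scaleR_sum_right)
    qed
  qed
  with True obtain p where "g = (\<Sum>i\<in>T. p i *\<^sub>R a i)" "\<forall>i\<in>T. 0 \<le> p i" by blast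
  then show thesis by (intro generated) auto
next
  case False
  let ?K = "convex_cone hull (a ` T)"
  obtain y b where y: "inner y g < b" "\<And>z. z \<in> ?K \<Longrightarrow> b < inner y z"
    using separating_hyperplane_closed_point[of ?K g] False T
      convex_convex_cone_hull closed_convex_cone_hull by blast
  have "b < 0" using y(2)[OF convex_cone_hull_contains_0] by simp
  have "0 \<le> inner y (a i)" if "i \<in> T" for i
  proof (rule ccontr)
    assume neg: "\<not> 0 \<le> inner y (a i)"
    \<comment> \<open>This positive multiple of the generator takes the value \<open>b\<close>
      exactly, contradicting strict separation.\<close>
    have "(b / inner y (a i)) *\<^sub>R a i \<in> ?K"
      using that \<open>b < 0\<close> neg by (intro convex_cone_hull_mul hull_inc) (auto simp: divide_nonpos_neg)
    from y(2)[OF this] neg show False by simp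
  qed
  with y(1) \<open>b < 0\<close> show thesis
    by (intro separated[of "- y"]) auto
qed

text \<open>First-order optimality. Along a direction that does not increase the load of saturated
  links, a small step stays feasible because the other links have slack and active rates are
  positive; a positive slope would then improve the utility.\<close>

lemma prop_fair_no_ascent:
  fixes route :: "'r::finite \<Rightarrow> 'l::finite set" and y :: "'r \<Rightarrow> real"
  assumes C: "\<And>l. 0 < C l" and \<kappa>: "\<And>r. 0 < \<kappa> r" and x: "prop_fair route C \<kappa> N x"
    and tight: "\<And>l. link_load route (\<lambda>r. real (N r) * x r) l = C l \<Longrightarrow>
      (\<Sum>r | l \<in> route r \<and> 0 < N r. y r) \<le> 0"
  shows "(\<Sum>r | 0 < N r. \<kappa> r / x r * y r) \<le> 0"
proof (rule ccontr)
  assume pos: "\<not> ?thesis"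
  have x_pos: "0 < x r" if "0 < N r" for r
    by (rule prop_fair_pos[OF C \<kappa> x that])
  have feas: "feasible route C N x" using x by (simp add: prop_fair_def)
  \<comment> \<open>The direction \<open>y\<close> lives on the aggregate rates of the routes, hence
    the division by the number of flows.\<close>
  define z where "z t r = (if 0 < N r then x r + t * (y r / real (N r)) else 0)" for t r
  define U where "U t = (\<Sum>r\<in>UNIV. \<kappa> r * real (N r) * ln (z t r))" for t
  have z0: "z 0 = x"
    using feas by (auto simp: z_def feasible_def fun_eq_iff)
  have "(U has_real_derivative (\<Sum>r\<in>UNIV. \<kappa> r * real (N r) * (if 0 < N r then y r / real (N r) / x r else 0))) (at 0)"
    unfolding U_def
  proof (intro DERIV_sum DERIV_cmult)
    fix r
    show "((\<lambda>t. ln (z t r)) has_real_derivative (if 0 < N r then y r / real (N r) / x r else 0)) (at 0)"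
      using x_pos[of r] by (auto simp: z_def intro!: derivative_eq_intros)
  qed
  moreover have "(\<Sum>r\<in>UNIV. \<kappa> r * real (N r) * (if 0 < N r then y r / real (N r) / x r else 0))
      = (\<Sum>r | 0 < N r. \<kappa> r / x r * y r)"
    by (intro sum.mono_neutral_cong_right) auto
  ultimately have "(U has_real_derivative (\<Sum>r | 0 < N r. \<kappa> r / x r * y r)) (at 0)" by simp
  from DERIV_pos_inc_right[OF this] pos obtain d where d: "0 < d" "\<And>h. 0 < h \<Longrightarrow> h < d \<Longrightarrow> U 0 < U h"
    by auto
  have ev1: "\<forall>\<^sub>F t in at_right 0. 0 < t \<and> t < d"
    using d(1) by (auto simp: eventually_at_right_field)
  have ev2: "\<forall>\<^sub>F t in at_right 0. \<forall>r. 0 < N r \<longrightarrow> 0 < z t r"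
  proof (rule eventually_all_finite)
    fix r
    show "\<forall>\<^sub>F t in at_right 0. 0 < N r \<longrightarrow> 0 < z t r"
    proof (cases "0 < N r")
      case True
      have "((\<lambda>t. x r + t * (y r / real (N r))) \<longlongrightarrow> x r + 0 * (y r / real (N r))) (at_right 0)"
        by (intro tendsto_intros)
      then show ?thesis
        using True x_pos[OF True] by (simp add: z_def order_tendstoD(1))
    qed simp
  qed
  define w where "w l = (\<Sum>r | l \<in> route r \<and> 0 < N r. y r)" for l
  have load_z: "link_load route (\<lambda>r. real (N r) * z t r) l
      = link_load route (\<lambda>r. real (N r) * x r) l + t * w l" for t l
  proof -
    have "w l = (\<Sum>r | l \<in> route r. if 0 < N r then y r else 0)"
      unfolding w_def by (intro sum.mono_neutral_cong_left) auto
    then show ?thesis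
      unfolding link_load_def by (simp add: sum_distrib_left sum.distrib[symmetric])
        (intro sum.cong, auto simp: z_def field_simps)
  qed
  have ev3: "\<forall>\<^sub>F t in at_right 0. \<forall>l. link_load route (\<lambda>r. real (N r) * z t r) l \<le> C l"
  proof (rule eventually_all_finite)
    fix l
    show "\<forall>\<^sub>F t in at_right 0. link_load route (\<lambda>r. real (N r) * z t r) l \<le> C l"
    proof (cases "link_load route (\<lambda>r. real (N r) * x r) l = C l")
      case True
      then have "w l \<le> 0" using tight by (simp add: w_def)
      then show ?thesis
        using ev1 by (auto elim!: eventually_mono simp: load_z True mult_nonneg_nonpos)
    next
      case False
      then have less: "link_load route (\<lambda>r. real (N r) * x r) l < C l"
        using feas by (force simp: feasible_def less_le)
      have "((\<lambda>t. link_load route (\<lambda>r. real (N r) * x r) l + t * w l) \<longlongrightarrow>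
          link_load route (\<lambda>r. real (N r) * x r) l + 0 * w l) (at_right 0)"
        by (intro tendsto_intros)
      from order_tendstoD(2)[OF this, of "C l"] less show ?thesis
        by (auto elim!: eventually_mono simp: load_z)
    qed
  qed
  have "\<forall>\<^sub>F t in at_right (0::real). False"
    using ev1 ev2 ev3
  proof eventually_elim
    case (elim t)
    then have "feasible route C N (z t)"
      unfolding feasible_def by (auto simp: z_def less_imp_le)
    then have "utility \<kappa> N (z t) \<le> utility \<kappa> N x"
      using x by (simp add: prop_fair_def)
    moreover have "utility \<kappa> N (z t) = ereal (U t)"
      unfolding U_def by (rule utility_eq) (use elim in auto)
    moreover have "utility \<kappa> N x = ereal (U 0)"
      unfolding U_def z0 by (rule utility_eq) (rule x_pos)
    ultimately have "U t \<le> U 0" by simp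
    with d(2)[of t] elim show False by simp
  qed
  then show False by simp
qed

text \<open>The Karush-Kuhn-Tucker conditions. Farkas is applied to the utility gradient
  \<open>g\<close> in the aggregate rates and the incidence vectors \<open>a l\<close> of the
  saturated links on active routes; a separating vector would be an ascent direction excluded by
  \<open>prop_fair_no_ascent\<close>.\<close>

lemma prop_fair_multipliers:
  fixes route :: "'r::finite \<Rightarrow> 'l::finite set"
  assumes C: "\<And>l. 0 < C l" and \<kappa>: "\<And>r. 0 < \<kappa> r" and x: "prop_fair route C \<kappa> N x"
  obtains p where "\<And>l. 0 \<le> p l"
    "\<And>r. real (N r) * x r * (\<Sum>l\<in>route r. p l) = \<kappa> r * real (N r)"
    "\<And>l. p l * (C l - link_load route (\<lambda>r. real (N r) * x r) l) = 0"
proof -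
  have x_pos: "0 < x r" if "0 < N r" for r
    by (rule prop_fair_pos[OF C \<kappa> x that])
  define T where "T = {l. link_load route (\<lambda>r. real (N r) * x r) l = C l}"
  define a :: "'l \<Rightarrow> real^'r" where "a l = vec_lambda (\<lambda>r. if l \<in> route r \<and> 0 < N r then 1 else 0)" for l
  define g :: "real^'r" where "g = vec_lambda (\<lambda>r. if 0 < N r then \<kappa> r / x r else 0)"
  have "finite T" by simp
  then show thesis
  proof (cases rule: finitely_generated_cone_cases[where a=a and g=g])
    case (generated p)
    \<comment> \<open>Setting the multipliers of unsaturated links to 0 yields complementary
      slackness.\<close>
    define p' where "p' l = (if l \<in> T then p l else 0)" for l
    have "(\<Sum>l\<in>route r. p' l) = \<kappa> r / x r" if "0 < N r" for r
    proof -
      have "\<kappa> r / x r = vec_nth g r" using that by (simp add: g_def)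
      also have "\<dots> = (\<Sum>l\<in>T. p l * (if l \<in> route r then 1 else 0))"
        using that unfolding generated(2) by (simp add: a_def)
      also have "\<dots> = (\<Sum>l\<in>route r. p' l)"
        by (intro sum.mono_neutral_cong) (auto simp: p'_def)
      finally show ?thesis by simp
    qed
    then have "real (N r) * x r * (\<Sum>l\<in>route r. p' l) = \<kappa> r * real (N r)" for r
      using x_pos[of r] by (cases "N r = 0") auto
    then show ?thesis
      using generated(1) by (intro that[of p']) (auto simp: p'_def T_def)
  next
    case (separated y)
    have "(\<Sum>r | 0 < N r. \<kappa> r / x r * vec_nth y r) \<le> 0"
    proof (rule prop_fair_no_ascent[OF C \<kappa> x])
      fix l assume "link_load route (\<lambda>r. real (N r) * x r) l = C l"
      then have "inner y (a l) \<le> 0" using separated(1) by (simp add: T_def)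
      also have "inner y (a l) = (\<Sum>r | l \<in> route r \<and> 0 < N r. vec_nth y r)"
        unfolding inner_vec_def by (intro sum.mono_neutral_cong_right) (auto simp: a_def)
      finally show "(\<Sum>r | l \<in> route r \<and> 0 < N r. vec_nth y r) \<le> 0" .
    qed
    moreover have "inner y g = (\<Sum>r | 0 < N r. \<kappa> r / x r * vec_nth y r)"
      unfolding inner_vec_def by (intro sum.mono_neutral_cong_right) (auto simp: g_def)
    ultimately show ?thesis using separated(2) by simp
  qed
qed

section \<open>The drift of the flow count process\<close>

text \<open>Here \<open>lam\<close> is the critical arrival rate, \<open>a\<close> the initial phase
  law, \<open>m\<close> the mean residual size and \<open>\<rho>\<close> the critical load per
  phase. The parameter \<open>\<epsilon>\<close> is no locale parameter: it enters only through the
  jump rates, so constants obtained before \<open>\<epsilon>\<close> is introduced are uniform in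
  it.\<close>

locale bandwidth_network =
  fixes route :: "'r::finite \<Rightarrow> 'l::finite set" and C :: "'l \<Rightarrow> real" and \<kappa> lam :: "'r \<Rightarrow> real"
    and K :: "'r \<Rightarrow> nat" and s :: "'r \<Rightarrow> nat \<Rightarrow> nat \<Rightarrow> real" and a m \<rho> :: "'r \<Rightarrow> nat \<Rightarrow> real"
    and c\<^sub>0 :: real and Ls :: "'l set" and x :: "'r state \<Rightarrow> 'r \<Rightarrow> real" and p :: "'r state \<Rightarrow> 'l \<Rightarrow> real"
    and X :: "'r state set"
  assumes C_pos: "0 < C l" and route_ne: "route r \<noteq> {}" and \<kappa>_pos: "0 < \<kappa> r" and lam_pos: "0 < lam r"
    and K_pos: "0 < K r"
    and route_sum_inj: "(\<And>r. (\<Sum>l\<in>route r. z l) = 0) \<Longrightarrow> z l = (0::real)"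
    and a_nonneg: "k < K r \<Longrightarrow> 0 \<le> a r k"
    and m_pos: "k < K r \<Longrightarrow> 0 < m r k" and \<rho>_pos: "k < K r \<Longrightarrow> 0 < \<rho> r k" and c0_pos: "0 < c\<^sub>0"
    and s_m: "k < K r \<Longrightarrow> (\<Sum>j<K r. s r k j * m r j) = - 1"
    and \<rho>_s: "j < K r \<Longrightarrow> (\<Sum>k<K r. \<rho> r k * s r k j) = - (lam r * a r j)"
    and coercive: "c\<^sub>0 * (\<Sum>k<K r. (v k)\<^sup>2)
      \<le> - (\<Sum>k<K r. \<Sum>j<K r. v k * s r k j * (\<kappa> r * m r j / \<rho> r j * v j))"
    and s_offdiag: "k < K r \<Longrightarrow> j < K r \<Longrightarrow> j \<noteq> k \<Longrightarrow> 0 \<le> s r k j"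
    and s_row: "k < K r \<Longrightarrow> (\<Sum>j<K r. s r k j) \<le> 0"
    and X_eq: "X = {n. \<forall>r k. K r \<le> k \<longrightarrow> n r k = 0}"
    and x_nonneg: "n \<in> X \<Longrightarrow> 0 \<le> x n r"
    and x_load: "n \<in> X \<Longrightarrow> link_load route (\<lambda>r. (\<Sum>k<K r. real (n r k)) * x n r) l \<le> C l"
    and p_nonneg: "n \<in> X \<Longrightarrow> 0 \<le> p n l"
    and p_route: "n \<in> X \<Longrightarrow>
      (\<Sum>k<K r. real (n r k)) * x n r * (\<Sum>l\<in>route r. p n l) = \<kappa> r * (\<Sum>k<K r. real (n r k))"
    and p_slack: "n \<in> X \<Longrightarrow>
      p n l * (C l - link_load route (\<lambda>r. (\<Sum>k<K r. real (n r k)) * x n r) l) = 0"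
    and critical: "l \<in> Ls \<Longrightarrow> link_load route (\<lambda>r. \<Sum>k<K r. \<rho> r k) l = C l"
    and noncritical: "l \<notin> Ls \<Longrightarrow> link_load route (\<lambda>r. \<Sum>k<K r. \<rho> r k) l < C l"
begin

definition re :: "'r state \<Rightarrow> 'r \<Rightarrow> nat \<Rightarrow> real" where "re n r k = real (n r k)"
definition cnt :: "'r state \<Rightarrow> 'r \<Rightarrow> real" where "cnt n r = (\<Sum>k<K r. real (n r k))"
definition \<phi> :: "'r state \<Rightarrow> 'r \<Rightarrow> nat \<Rightarrow> real" where "\<phi> n r k = real (n r k) * x n r"
definition \<Phi> :: "'r state \<Rightarrow> 'r \<Rightarrow> real" where "\<Phi> n r = (\<Sum>k<K r. \<phi> n r k)"
definition R :: "'r \<Rightarrow> real" where "R r = (\<Sum>k<K r. \<rho> r k)"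
text \<open>The transpose of the routing matrix applied to a vector indexed by links.\<close>

definition rs :: "('l \<Rightarrow> real) \<Rightarrow> 'r \<Rightarrow> real" where "rs z r = (\<Sum>l\<in>route r. z l)"
definition lin :: "('r \<Rightarrow> nat \<Rightarrow> real) \<Rightarrow> ('r \<Rightarrow> nat \<Rightarrow> real) \<Rightarrow> real" where
  "lin c v = (\<Sum>r\<in>UNIV. \<Sum>k<K r. c r k * v r k)"

abbreviation load :: "('r \<Rightarrow> real) \<Rightarrow> 'l \<Rightarrow> real" where "load \<equiv> link_load route"

lemma \<Phi>_eq: "\<Phi> n r = cnt n r * x n r"
  by (simp add: \<Phi>_def \<phi>_def cnt_def sum_distrib_right)

lemma cnt_nonneg: "0 \<le> cnt n r"
  by (simp add: cnt_def sum_nonneg)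

lemma \<phi>_nonneg: "n \<in> X \<Longrightarrow> 0 \<le> \<phi> n r k"
  by (simp add: \<phi>_def x_nonneg)

lemma \<Phi>_nonneg: "n \<in> X \<Longrightarrow> 0 \<le> \<Phi> n r"
  by (simp add: \<Phi>_def \<phi>_nonneg sum_nonneg)

lemma load_\<Phi>_le: "n \<in> X \<Longrightarrow> load (\<Phi> n) l \<le> C l"
  using x_load[of n l] by (simp add: \<Phi>_eq[abs_def] cnt_def)

lemma multiplier_slack: "n \<in> X \<Longrightarrow> p n l * (C l - load (\<Phi> n) l) = 0"
  using p_slack[of n l] by (simp add: \<Phi>_eq[abs_def] cnt_def)

lemma multiplier_route: "n \<in> X \<Longrightarrow> \<Phi> n r * rs (p n) r = \<kappa> r * cnt n r"
  using p_route[of n r] by (simp add: \<Phi>_eq cnt_def rs_def)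

text \<open>All flows of a route receive the same rate, so the identity for the route total passes
  to each phase; an empty route makes both sides 0.\<close>

lemma multiplier_phase:
  assumes "n \<in> X" "k < K r"
  shows "\<phi> n r k * rs (p n) r = \<kappa> r * real (n r k)"
proof (cases "cnt n r = 0")
  case True
  then have "real (n r k) = 0"
    using assms(2) unfolding cnt_def by (subst (asm) sum_nonneg_eq_0_iff) auto
  then show ?thesis by (simp add: \<phi>_def)
next
  case False
  then have "x n r * rs (p n) r = \<kappa> r"
    using multiplier_route[OF assms(1), of r] by (simp add: \<Phi>_eq)
  then show ?thesis by (simp add: \<phi>_def mult.assoc)
qed

lemma rs_nonneg: "n \<in> X \<Longrightarrow> 0 \<le> rs (p n) r"
  by (simp add: rs_def p_nonneg sum_nonneg)

lemma \<phi>_le_\<Phi>: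
  assumes "n \<in> X" "k < K r" shows "\<phi> n r k \<le> \<Phi> n r"
  unfolding \<Phi>_def using assms by (intro member_le_sum) (auto simp: \<phi>_nonneg)

lemma \<Phi>_le_load:
  assumes "n \<in> X" "l \<in> route r" shows "\<Phi> n r \<le> load (\<Phi> n) l"
  unfolding link_load_def using assms by (intro member_le_sum) (auto simp: \<Phi>_nonneg)

definition C\<^sub>s :: real where "C\<^sub>s = (\<Sum>l\<in>UNIV. C l)"

lemma C_le_Cs: "C l \<le> C\<^sub>s"
  unfolding C\<^sub>s_def using C_pos by (intro member_le_sum) (auto simp: less_imp_le)

lemma Cs_pos: "0 < C\<^sub>s"
  using C_pos C_le_Cs by (meson less_le_trans)

lemma \<Phi>_le: "n \<in> X \<Longrightarrow> \<Phi> n r \<le> C\<^sub>s"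
  using route_ne[of r] \<Phi>_le_load load_\<Phi>_le C_le_Cs by (meson all_not_in_conv order_trans)

lemma \<phi>_le: "n \<in> X \<Longrightarrow> k < K r \<Longrightarrow> \<phi> n r k \<le> C\<^sub>s"
  using \<phi>_le_\<Phi> \<Phi>_le by (meson order_trans)

lemma R_pos: "0 < R r"
  unfolding R_def using K_pos[of r] \<rho>_pos by (intro sum_pos) auto

lemma load_R: "l \<in> Ls \<Longrightarrow> load R l = C l" "l \<notin> Ls \<Longrightarrow> load R l < C l"
  using critical noncritical by (simp_all add: R_def[abs_def])

lemma load_R_le: "load R l \<le> C l"
  using load_R by (cases "l \<in> Ls") (auto simp: less_imp_le)

lemma R_le: "R r \<le> C\<^sub>s"
proof -
  obtain l where l: "l \<in> route r" using route_ne by auto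
  then have "R r \<le> load R l"
    unfolding link_load_def by (intro member_le_sum) (auto simp: less_imp_le[OF R_pos])
  with load_R_le[of l] C_le_Cs[of l] show ?thesis by simp
qed

text \<open>Duality of routes and links: \<open>rs\<close> and \<open>load\<close> are adjoint. This
  is how route-wise drift terms become expressions in link capacities.\<close>

lemma sum_rs: "(\<Sum>r\<in>UNIV. rs z r * f r) = (\<Sum>l\<in>UNIV. z l * load f l)"
proof -
  have "(\<Sum>r\<in>UNIV. rs z r * f r) = (\<Sum>r\<in>UNIV. \<Sum>l\<in>UNIV. if l \<in> route r then z l * f r else 0)"
    unfolding rs_def sum_distrib_right
    by (intro sum.cong refl sum.mono_neutral_cong_left) auto
  also have "\<dots> = (\<Sum>l\<in>UNIV. \<Sum>r\<in>UNIV. if l \<in> route r then z l * f r else 0)"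
    by (rule sum.swap)
  also have "\<dots> = (\<Sum>l\<in>UNIV. z l * load f l)"
    unfolding link_load_def sum_distrib_left
    by (intro sum.cong refl sum.mono_neutral_cong_right) auto
  finally show ?thesis .
qed

lemma load_diff: "load (\<lambda>r. f r - g r) l = load f l - load g l"
  by (simp add: link_load_def sum_subtractf)

lemma load_scale: "load (\<lambda>r. t * f r) l = t * load f l"
  by (simp add: link_load_def sum_distrib_left)

lemma lin_add: "lin c (\<lambda>r k. v r k + w r k) = lin c v + lin c w"
  by (simp add: lin_def sum.distrib distrib_left)

lemma lin_diff: "lin c (\<lambda>r k. v r k - w r k) = lin c v - lin c w"
  by (simp add: lin_def sum_subtractf right_diff_distrib)

lemma lin_commute: "lin c v = lin v c"
  by (simp add: lin_def mult.commute)

lemma lin_scale: "lin c (\<lambda>r k. t * v r k) = t * lin c v"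
  by (simp add: lin_def sum_distrib_left mult.left_commute)

definition unit :: "'r \<Rightarrow> nat \<Rightarrow> 'r \<Rightarrow> nat \<Rightarrow> real" where
  "unit r k r' k' = (if r' = r \<and> k' = k then 1 else 0)"

lemma lin_unit:
  assumes "k < K r" shows "lin c (unit r k) = c r k"
proof -
  have "lin c (unit r k) = (\<Sum>r'\<in>UNIV. if r' = r then \<Sum>k'<K r. if k' = k then c r k else 0 else 0)"
    unfolding lin_def unit_def using assms
    by (intro sum.cong refl) (auto simp: if_distrib cong: if_cong)
  then show ?thesis using assms by simp
qed

lemma re_inc: "re (inc r k n) = (\<lambda>r' k'. re n r' k' + unit r k r' k')"
  by (auto simp: fun_eq_iff re_def inc_def unit_def)

lemma re_dec: "0 < n r k \<Longrightarrow> re (dec r k n) = (\<lambda>r' k'. re n r' k' - unit r k r' k')"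
  by (auto simp: fun_eq_iff re_def dec_def unit_def)

lemma lin_inc: "k < K r \<Longrightarrow> lin c (re (inc r k n)) = lin c (re n) + c r k"
  by (simp add: re_inc lin_add lin_unit)

lemma lin_dec: "k < K r \<Longrightarrow> 0 < n r k \<Longrightarrow> lin c (re (dec r k n)) = lin c (re n) - c r k"
  by (simp add: re_dec lin_diff lin_unit)

section \<open>Jumps, jump rates and the generator on linear and quadratic functions\<close>

definition J :: "('r \<times> nat + ('r \<times> nat \<times> nat) + 'r \<times> nat) set" where
  "J = (SIGMA r:UNIV. {..<K r}) <+> ((SIGMA r:UNIV. SIGMA k:{..<K r}. {..<K r} - {k}) <+> (SIGMA r:UNIV. {..<K r}))"

definition \<tau> :: "'r \<times> nat + ('r \<times> nat \<times> nat) + 'r \<times> nat \<Rightarrow> 'r state \<Rightarrow> 'r state" where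
  "\<tau> = case_sum (\<lambda>(r, k). inc r k) (case_sum (\<lambda>(r, k, j) n. inc r j (dec r k n)) (\<lambda>(r, k). dec r k))"

definition rate :: "real \<Rightarrow> 'r \<times> nat + ('r \<times> nat \<times> nat) + 'r \<times> nat \<Rightarrow> 'r state \<Rightarrow> real" where
  "rate \<epsilon> = case_sum (\<lambda>(r, k) n. (1 - \<epsilon>) * lam r * a r k)
     (case_sum (\<lambda>(r, k, j) n. \<phi> n r k * s r k j) (\<lambda>(r, k) n. \<phi> n r k * (\<Sum>j<K r. - s r k j)))"

abbreviation G :: "real \<Rightarrow> ('r state \<Rightarrow> real) \<Rightarrow> 'r state \<Rightarrow> real" where
  "G \<epsilon> \<equiv> generator J \<tau> (rate \<epsilon>)"

lemma finite_J: "finite J"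
  unfolding J_def by (intro finite_Plus finite_SigmaI) auto

lemma sum_J:
  "sum f J = (\<Sum>r\<in>UNIV. \<Sum>k<K r. f (Inl (r, k))) +
    (\<Sum>r\<in>UNIV. \<Sum>k<K r. \<Sum>j\<in>{..<K r} - {k}. f (Inr (Inl (r, k, j)))) +
    (\<Sum>r\<in>UNIV. \<Sum>k<K r. f (Inr (Inr (r, k))))"
proof -
  have "sum f J = (\<Sum>y\<in>(SIGMA r:UNIV. {..<K r}). f (Inl y)) +
      ((\<Sum>y\<in>(SIGMA r:UNIV. SIGMA k:{..<K r}. {..<K r} - {k}). f (Inr (Inl y))) +
       (\<Sum>y\<in>(SIGMA r:UNIV. {..<K r}). f (Inr (Inr y))))"
    unfolding J_def by (simp add: sum.Plus finite_SigmaI)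
  also have "(\<Sum>y\<in>(SIGMA r:UNIV. {..<K r}). f (Inl y)) = (\<Sum>r\<in>UNIV. \<Sum>k<K r. f (Inl (r, k)))"
    by (subst sum.Sigma) (auto intro!: sum.cong)
  also have "(\<Sum>y\<in>(SIGMA r:UNIV. {..<K r}). f (Inr (Inr y))) = (\<Sum>r\<in>UNIV. \<Sum>k<K r. f (Inr (Inr (r, k))))"
    by (subst sum.Sigma) (auto intro!: sum.cong)
  also have "(\<Sum>y\<in>(SIGMA r:UNIV. SIGMA k:{..<K r}. {..<K r} - {k}). f (Inr (Inl y)))
      = (\<Sum>r\<in>UNIV. \<Sum>z\<in>(SIGMA k:{..<K r}. {..<K r} - {k}). f (Inr (Inl (r, z))))"
    by (subst sum.Sigma) (auto intro!: sum.cong)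
  also have "\<dots> = (\<Sum>r\<in>UNIV. \<Sum>k<K r. \<Sum>j\<in>{..<K r} - {k}. f (Inr (Inl (r, k, j))))"
    by (intro sum.cong refl, subst sum.Sigma) (auto intro!: sum.cong)
  finally show ?thesis by (simp add: add.assoc)
qed

lemma J_cases:
  assumes "j \<in> J"
  obtains (arrival) r k where "j = Inl (r, k)" "k < K r"
    | (move) r k i where "j = Inr (Inl (r, k, i))" "k < K r" "i < K r" "i \<noteq> k"
    | (departure) r k where "j = Inr (Inr (r, k))" "k < K r"
  using assms unfolding J_def by (elim PlusE SigmaE DiffE) auto

lemma rate_nonneg:
  assumes "\<epsilon> \<le> 1" "n \<in> X" "j \<in> J"
  shows "0 \<le> rate \<epsilon> j n"
  using assms(3)
proof (cases rule: J_cases)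
  case (arrival r k)
  with assms show ?thesis
    by (auto simp: rate_def a_nonneg less_imp_le[OF lam_pos] intro!: mult_nonneg_nonneg)
next
  case (move r k i)
  with assms show ?thesis
    by (auto simp: rate_def \<phi>_nonneg s_offdiag)
next
  case (departure r k)
  then show ?thesis
    using assms(2) s_row[of k r] by (auto simp: rate_def \<phi>_nonneg sum_negf intro!: mult_nonneg_nonpos)
qed

text \<open>A nonzero rate forces the phase being left to be occupied, so \<open>dec\<close> does
  not truncate and every coordinate changes by at most 1.\<close>

lemma step:
  assumes n: "n \<in> X" and j: "j \<in> J" "rate \<epsilon> j n \<noteq> 0"
  shows "\<tau> j n \<in> X" "\<tau> j n \<noteq> n" "\<bar>re (\<tau> j n) r' k' - re n r' k'\<bar> \<le> 1"
proof -
  have "\<tau> j n \<in> X \<and> \<tau> j n \<noteq> n \<and> (\<forall>r' k'. \<bar>re (\<tau> j n) r' k' - re n r' k'\<bar> \<le> 1)"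
    using j(1)
  proof (cases rule: J_cases)
    case (arrival r k)
    have "inc r k n r k \<noteq> n r k" by (simp add: inc_def)
    then have "inc r k n \<noteq> n" by metis
    moreover have "inc r k n \<in> X" using n arrival by (auto simp: X_eq inc_def)
    moreover have "\<bar>re (inc r k n) r' k' - re n r' k'\<bar> \<le> 1" for r' k'
      by (simp add: re_def inc_def)
    ultimately show ?thesis using arrival by (simp add: \<tau>_def)
  next
    case (move r k i)
    then have pos: "0 < n r k" using j(2) by (auto simp: rate_def \<phi>_def)
    have "inc r i (dec r k n) r i \<noteq> n r i" using move by (simp add: inc_def dec_def)
    then have "inc r i (dec r k n) \<noteq> n" by metis
    moreover have "inc r i (dec r k n) \<in> X" using n move by (auto simp: X_eq inc_def dec_def)
    moreover have "\<bar>re (inc r i (dec r k n)) r' k' - re n r' k'\<bar> \<le> 1" for r' k'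
      using move pos by (simp add: re_def inc_def dec_def)
    ultimately show ?thesis using move by (simp add: \<tau>_def)
  next
    case (departure r k)
    then have pos: "0 < n r k" using j(2) by (auto simp: rate_def \<phi>_def)
    then have "dec r k n r k \<noteq> n r k" by (simp add: dec_def)
    then have "dec r k n \<noteq> n" by metis
    moreover have "dec r k n \<in> X" using n by (auto simp: X_eq dec_def)
    moreover have "\<bar>re (dec r k n) r' k' - re n r' k'\<bar> \<le> 1" for r' k'
      using pos by (simp add: re_def dec_def)
    ultimately show ?thesis using departure by (simp add: \<tau>_def)
  qed
  then show "\<tau> j n \<in> X" "\<tau> j n \<noteq> n" "\<bar>re (\<tau> j n) r' k' - re n r' k'\<bar> \<le> 1" by auto
qed

text \<open>The number of flows is unbounded, but the service given to a phase is at most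
  \<open>C\<^sub>s\<close>, and \<open>- s r k k\<close> is the total rate of leaving phase
  \<open>k\<close> per unit of service. Hence the total jump rate is bounded.\<close>

definition Q :: real where
  "Q = (\<Sum>r\<in>UNIV. \<Sum>k<K r. lam r * a r k) + (\<Sum>r\<in>UNIV. \<Sum>k<K r. C\<^sub>s * - s r k k)"

text \<open>The departure rate is minus a row sum, so it can be spread over the columns: column
  \<open>j\<close> carries a move to \<open>j\<close> minus a departure, with the convention that a
  move to \<open>k\<close> itself changes nothing.\<close>

lemma exit_rate:
  assumes "k < K r"
  shows "(\<Sum>j\<in>{..<K r} - {k}. s r k j * v j) + (\<Sum>j<K r. - s r k j) * w
    = (\<Sum>j<K r. s r k j * ((if j = k then 0 else v j) - w))"
proof -
  have "(\<Sum>j\<in>{..<K r} - {k}. s r k j * v j) = (\<Sum>j<K r. s r k j * (if j = k then 0 else v j))"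
    by (intro sum.mono_neutral_cong_left) auto
  then show ?thesis
    by (simp add: right_diff_distrib sum_subtractf sum_distrib_right sum_negf)
qed

lemma rate_sum_le:
  assumes "0 \<le> \<epsilon>" "\<epsilon> \<le> 1" "n \<in> X"
  shows "(\<Sum>j\<in>J. rate \<epsilon> j n) \<le> Q"
proof -
  have 1: "(1 - \<epsilon>) * lam r * a r k \<le> lam r * a r k" if "k < K r" for r k
  proof -
    have "(1 - \<epsilon>) * (lam r * a r k) \<le> 1 * (lam r * a r k)"
      using assms a_nonneg[OF that] lam_pos[of r] by (intro mult_right_mono) (auto simp: less_imp_le)
    then show ?thesis by (simp add: mult.assoc)
  qed
  have 2: "(\<Sum>j\<in>{..<K r} - {k}. \<phi> n r k * s r k j) + \<phi> n r k * (\<Sum>j<K r. - s r k j) \<le> C\<^sub>s * - s r k k"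
    if k: "k < K r" for r k
  proof -
    have eq: "(\<Sum>j\<in>{..<K r} - {k}. s r k j) = (\<Sum>j<K r. s r k j) - s r k k"
      using k by (simp add: sum_diff1)
    have "0 \<le> (\<Sum>j\<in>{..<K r} - {k}. s r k j)"
      using s_offdiag[OF k] by (intro sum_nonneg) auto
    then have neg: "0 \<le> - s r k k" using eq s_row[OF k] by simp
    have "(\<Sum>j\<in>{..<K r} - {k}. \<phi> n r k * s r k j) + \<phi> n r k * (\<Sum>j<K r. - s r k j)
        = \<phi> n r k * ((\<Sum>j\<in>{..<K r} - {k}. s r k j) - (\<Sum>j<K r. s r k j))"
      by (simp add: sum_distrib_left sum_negf right_diff_distrib)
    also have "\<dots> = \<phi> n r k * - s r k k" by (simp add: eq)
    also have "\<dots> \<le> C\<^sub>s * - s r k k"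
      using neg \<phi>_le[OF assms(3) k] by (intro mult_right_mono) auto
    finally show ?thesis .
  qed
  have "(\<Sum>j\<in>J. rate \<epsilon> j n) = (\<Sum>r\<in>UNIV. \<Sum>k<K r. (1 - \<epsilon>) * lam r * a r k) +
      (\<Sum>r\<in>UNIV. \<Sum>k<K r. (\<Sum>j\<in>{..<K r} - {k}. \<phi> n r k * s r k j) + \<phi> n r k * (\<Sum>j<K r. - s r k j))"
    unfolding sum_J by (simp add: rate_def sum.distrib)
  also have "\<dots> \<le> Q"
    unfolding Q_def by (intro add_mono sum_mono 1 2) auto
  finally show ?thesis .
qed

definition drift :: "real \<Rightarrow> 'r state \<Rightarrow> ('r \<Rightarrow> nat \<Rightarrow> real) \<Rightarrow> real" where
  "drift \<epsilon> n c = (\<Sum>r\<in>UNIV. \<Sum>k<K r. \<Sum>j<K r. (\<phi> n r k - (1 - \<epsilon>) * \<rho> r k) * s r k j * c r j)"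

text \<open>The balance \<open>\<rho> s = - lam a\<close> expresses arrivals through the phase
  generator. This is what centres \<open>\<phi>\<close> at \<open>(1 - \<epsilon>) * \<rho>\<close>
  in \<open>drift\<close>.\<close>

lemma arrival_sum:
  "(\<Sum>k<K r. (1 - \<epsilon>) * lam r * a r k * c k) = - (\<Sum>k<K r. \<Sum>j<K r. (1 - \<epsilon>) * \<rho> r k * s r k j * c j)"
proof -
  have "(\<Sum>k<K r. \<Sum>j<K r. (1 - \<epsilon>) * \<rho> r k * s r k j * c j)
      = (\<Sum>j<K r. (1 - \<epsilon>) * (\<Sum>k<K r. \<rho> r k * s r k j) * c j)"
    by (subst sum.swap) (simp add: sum_distrib_left sum_distrib_right mult.assoc)
  also have "\<dots> = (\<Sum>j<K r. - ((1 - \<epsilon>) * lam r * a r j * c j))"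
    by (intro sum.cong refl) (auto simp: \<rho>_s algebra_simps)
  finally show ?thesis by (simp add: sum_negf)
qed

text \<open>The increments only have to be supplied for jumps that can occur; the convention
  \<open>v r k k = 0\<close> allows full sums over \<open>j\<close>.\<close>

lemma G_eq:
  assumes u: "\<And>r k. k < K r \<Longrightarrow> f (inc r k n) - f n = u r k"
    and v: "\<And>r k j. k < K r \<Longrightarrow> j < K r \<Longrightarrow> j \<noteq> k \<Longrightarrow> 0 < n r k \<Longrightarrow> f (inc r j (dec r k n)) - f n = v r k j"
    and v0: "\<And>r k. v r k k = 0"
    and w: "\<And>r k. k < K r \<Longrightarrow> 0 < n r k \<Longrightarrow> f (dec r k n) - f n = w r k"
  shows "G \<epsilon> f n = (\<Sum>r\<in>UNIV. (\<Sum>k<K r. (1 - \<epsilon>) * lam r * a r k * u r k) +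
     (\<Sum>k<K r. \<Sum>j<K r. \<phi> n r k * s r k j * (v r k j - w r k)))"
proof -
  have dep: "(\<Sum>j\<in>{..<K r} - {k}. \<phi> n r k * s r k j * (f (inc r j (dec r k n)) - f n)) +
      \<phi> n r k * (\<Sum>j<K r. - s r k j) * (f (dec r k n) - f n)
      = (\<Sum>j<K r. \<phi> n r k * s r k j * (v r k j - w r k))" if k: "k < K r" for r k
  proof (cases "n r k = 0")
    case True
    then show ?thesis by (simp add: \<phi>_def)
  next
    case False
    then have pos: "0 < n r k" by simp
    have "(\<Sum>j\<in>{..<K r} - {k}. \<phi> n r k * s r k j * (f (inc r j (dec r k n)) - f n)) +
        \<phi> n r k * (\<Sum>j<K r. - s r k j) * (f (dec r k n) - f n)
      = \<phi> n r k * ((\<Sum>j\<in>{..<K r} - {k}. s r k j * v r k j) + (\<Sum>j<K r. - s r k j) * w r k)"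
      using v[OF k _ _ pos] w[OF k pos] by (simp add: distrib_left sum_distrib_left mult.assoc)
    also have "\<dots> = (\<Sum>j<K r. \<phi> n r k * s r k j * (v r k j - w r k))"
      unfolding exit_rate[OF k] sum_distrib_left by (intro sum.cong refl) (auto simp: v0)
    finally show ?thesis .
  qed
  have "G \<epsilon> f n = (\<Sum>r\<in>UNIV. \<Sum>k<K r. (1 - \<epsilon>) * lam r * a r k * (f (inc r k n) - f n)) +
     (\<Sum>r\<in>UNIV. \<Sum>k<K r. (\<Sum>j\<in>{..<K r} - {k}. \<phi> n r k * s r k j * (f (inc r j (dec r k n)) - f n)) +
      \<phi> n r k * (\<Sum>j<K r. - s r k j) * (f (dec r k n) - f n))"
    unfolding generator_def sum_J by (simp add: rate_def \<tau>_def sum.distrib)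
  also have "\<dots> = (\<Sum>r\<in>UNIV. \<Sum>k<K r. (1 - \<epsilon>) * lam r * a r k * u r k) +
     (\<Sum>r\<in>UNIV. \<Sum>k<K r. \<Sum>j<K r. \<phi> n r k * s r k j * (v r k j - w r k))"
    using u dep by simp
  finally show ?thesis by (simp add: sum.distrib)
qed

lemma drift_eq: "drift \<epsilon> n c = (\<Sum>r\<in>UNIV. (\<Sum>k<K r. (1 - \<epsilon>) * lam r * a r k * c r k) +
    (\<Sum>k<K r. \<Sum>j<K r. \<phi> n r k * s r k j * c r j))"
  unfolding arrival_sum drift_def
  by (intro sum.cong refl) (simp add: left_diff_distrib sum_subtractf)

lemma G_lin: "G \<epsilon> (\<lambda>n. lin c (re n)) n = drift \<epsilon> n c"
proof -
  have "G \<epsilon> (\<lambda>n. lin c (re n)) n = (\<Sum>r\<in>UNIV. (\<Sum>k<K r. (1 - \<epsilon>) * lam r * a r k * c r k) +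
     (\<Sum>k<K r. \<Sum>j<K r. \<phi> n r k * s r k j * ((c r j - c r k) - - c r k)))"
    by (rule G_eq) (auto simp: lin_inc lin_dec)
  also have "\<dots> = drift \<epsilon> n c"
    by (simp add: drift_eq)
  finally show ?thesis .
qed

text \<open>The product rule with its carre du champ term. In the last sum a move contributes the
  product of the differences \<open>c r j - c r k\<close> and \<open>d r j - d r k\<close>, and a
  departure removes \<open>c r k * d r k\<close>.\<close>

lemma G_prod:
  "G \<epsilon> (\<lambda>n. lin c (re n) * lin d (re n)) n = lin c (re n) * drift \<epsilon> n d + lin d (re n) * drift \<epsilon> n c +
    (\<Sum>r\<in>UNIV. (\<Sum>k<K r. (1 - \<epsilon>) * lam r * a r k * (c r k * d r k)) +
      (\<Sum>k<K r. \<Sum>j<K r. \<phi> n r k * s r k j * (c r j * d r j - c r k * d r j - c r j * d r k)))"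
proof -
  let ?c = "lin c (re n)" and ?d = "lin d (re n)"
  have "G \<epsilon> (\<lambda>n. lin c (re n) * lin d (re n)) n
    = (\<Sum>r\<in>UNIV. (\<Sum>k<K r. (1 - \<epsilon>) * lam r * a r k * ((?c + c r k) * (?d + d r k) - ?c * ?d)) +
     (\<Sum>k<K r. \<Sum>j<K r. \<phi> n r k * s r k j * (((?c + (c r j - c r k)) * (?d + (d r j - d r k)) - ?c * ?d)
        - ((?c - c r k) * (?d - d r k) - ?c * ?d))))"
    by (rule G_eq) (auto simp: lin_inc lin_dec algebra_simps)
  also have "\<dots> = (\<Sum>r\<in>UNIV. ?c * ((\<Sum>k<K r. (1 - \<epsilon>) * lam r * a r k * d r k) + (\<Sum>k<K r. \<Sum>j<K r. \<phi> n r k * s r k j * d r j))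
      + ?d * ((\<Sum>k<K r. (1 - \<epsilon>) * lam r * a r k * c r k) + (\<Sum>k<K r. \<Sum>j<K r. \<phi> n r k * s r k j * c r j))
      + ((\<Sum>k<K r. (1 - \<epsilon>) * lam r * a r k * (c r k * d r k)) +
      (\<Sum>k<K r. \<Sum>j<K r. \<phi> n r k * s r k j * (c r j * d r j - c r k * d r j - c r j * d r k))))"
    unfolding sum_distrib_left distrib_left sum.distrib[symmetric]
    by (intro sum.cong refl) (simp add: sum_distrib_left sum.distrib[symmetric] algebra_simps)
  also have "\<dots> = ?c * drift \<epsilon> n d + ?d * drift \<epsilon> n c +
    (\<Sum>r\<in>UNIV. (\<Sum>k<K r. (1 - \<epsilon>) * lam r * a r k * (c r k * d r k)) +
      (\<Sum>k<K r. \<Sum>j<K r. \<phi> n r k * s r k j * (c r j * d r j - c r k * d r j - c r j * d r k)))"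
    unfolding drift_eq by (simp add: sum.distrib sum_distrib_left distrib_left)
  finally show ?thesis .
qed

text \<open>A one-sided first-order expansion with bounded remainder is enough. This matters for the
  distance to the cone, which is controlled after a jump only from above.\<close>

lemma G_le:
  assumes \<epsilon>: "0 \<le> \<epsilon>" "\<epsilon> \<le> 1" and n: "n \<in> X" and B: "0 \<le> B"
    and le: "\<And>n'. n' \<in> X \<Longrightarrow> (\<And>r k. \<bar>re n' r k - re n r k\<bar> \<le> 1) \<Longrightarrow>
      f n' - f n \<le> lin c (\<lambda>r k. re n' r k - re n r k) + B"
  shows "G \<epsilon> f n \<le> drift \<epsilon> n c + Q * B"
proof -
  have "G \<epsilon> f n \<le> (\<Sum>j\<in>J. rate \<epsilon> j n * (lin c (re (\<tau> j n)) - lin c (re n)) + rate \<epsilon> j n * B)"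
    unfolding generator_def
  proof (rule sum_mono)
    fix j assume j: "j \<in> J"
    show "rate \<epsilon> j n * (f (\<tau> j n) - f n) \<le> rate \<epsilon> j n * (lin c (re (\<tau> j n)) - lin c (re n)) + rate \<epsilon> j n * B"
    proof (cases "rate \<epsilon> j n = 0")
      case False
      have "f (\<tau> j n) - f n \<le> lin c (re (\<tau> j n)) - lin c (re n) + B"
        using le[of "\<tau> j n"] step[OF n j False] by (simp add: lin_diff)
      from mult_left_mono[OF this rate_nonneg[OF \<epsilon>(2) n j]] show ?thesis
        by (simp add: distrib_left)
    qed simp
  qed
  also have "\<dots> = drift \<epsilon> n c + (\<Sum>j\<in>J. rate \<epsilon> j n) * B"
    by (simp add: sum.distrib G_lin[symmetric] generator_def sum_distrib_right)
  also have "\<dots> \<le> drift \<epsilon> n c + Q * B"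
    using rate_sum_le[OF \<epsilon> n] B by (simp add: mult_right_mono)
  finally show ?thesis .
qed

end

section \<open>Moments of the stationary distribution\<close>

text \<open>If \<open>a\<close> exceeds \<open>b * y\<close> then \<open>y\<close> is below
  \<open>a / b\<close> and the constant suffices; otherwise the cubic term does.\<close>

lemma square_le_cube:
  fixes a b y :: real
  assumes "0 \<le> a" "0 < b" "0 \<le> y"
  shows "a * y\<^sup>2 \<le> b * y ^ 3 + a ^ 3 / b\<^sup>2"
proof (cases "a \<le> b * y")
  case True
  then have "a * y\<^sup>2 \<le> (b * y) * y\<^sup>2" by (rule mult_right_mono) simp
  moreover have "0 \<le> a ^ 3 / b\<^sup>2" using assms by simp
  ultimately show ?thesis by (simp add: power2_eq_square power3_eq_cube)
next
  case False
  then have "y \<le> a / b" using assms by (simp add: field_simps)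
  then have "a * y\<^sup>2 \<le> a * (a / b)\<^sup>2" using assms by (intro mult_left_mono power_mono) auto
  moreover have "0 \<le> b * y ^ 3" using assms by simp
  ultimately show ?thesis by (simp add: power2_eq_square power3_eq_cube)
qed

context bandwidth_network
begin

definition A :: "'r \<Rightarrow> nat \<Rightarrow> real" where "A r k = \<kappa> r * m r k / \<rho> r k"
definition ip :: "('r \<Rightarrow> nat \<Rightarrow> real) \<Rightarrow> ('r \<Rightarrow> nat \<Rightarrow> real) \<Rightarrow> real" where
  "ip v w = lin (\<lambda>r k. A r k * v r k) w"
definition wc :: "('r \<Rightarrow> nat \<Rightarrow> real) \<Rightarrow> real" where "wc v = lin (\<lambda>r k. \<kappa> r) v"
text \<open>The added 1 makes division by the size of the state harmless.\<close>

definition N1 :: "'r state \<Rightarrow> real" where "N1 n = 1 + wc (re n)"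
definition A1 :: real where "A1 = (\<Sum>r\<in>UNIV. \<Sum>k<K r. A r k)"

lemma A_pos: "k < K r \<Longrightarrow> 0 < A r k"
  by (simp add: A_def \<kappa>_pos m_pos \<rho>_pos)

lemma A1_nonneg: "0 \<le> A1"
  unfolding A1_def using A_pos by (intro sum_nonneg) (auto simp: less_imp_le)

lemma ip_eq: "ip v w = (\<Sum>r\<in>UNIV. \<Sum>k<K r. A r k * v r k * w r k)"
  by (simp add: ip_def lin_def)

lemma ip_commute: "ip v w = ip w v"
  by (simp add: ip_eq mult.commute mult.left_commute)

lemma ip_add: "ip v (\<lambda>r k. w r k + w' r k) = ip v w + ip v w'"
  by (simp add: ip_def lin_add)

lemma ip_self_add: "ip (\<lambda>r k. v r k + w r k) (\<lambda>r k. v r k + w r k) = ip v v + 2 * ip v w + ip w w"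
  using ip_commute[of "\<lambda>r k. v r k + w r k"] ip_commute[of v w] by (simp add: ip_add)

lemma ip_self_nonneg: "0 \<le> ip v v"
  unfolding ip_eq using A_pos by (auto intro!: sum_nonneg simp: mult.assoc less_imp_le)

lemma ip_cauchy_schwarz: "(ip v w)\<^sup>2 \<le> ip v v * ip w w"
proof -
  let ?I = "SIGMA r:(UNIV::'r set). {..<K r}"
  let ?v = "\<lambda>(r, k). sqrt (A r k) * v r k" and ?w = "\<lambda>(r, k). sqrt (A r k) * w r k"
  have eq: "ip u u' = (\<Sum>i\<in>?I. (\<lambda>(r, k). sqrt (A r k) * u r k) i * (\<lambda>(r, k). sqrt (A r k) * u' r k) i)" for u u'
    unfolding ip_eq by (subst sum.Sigma) (auto simp: A_pos less_imp_le intro!: sum.cong)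
  have "(\<Sum>i\<in>?I. ?v i * ?w i)\<^sup>2 \<le> (\<Sum>i\<in>?I. (?v i)\<^sup>2) * (\<Sum>i\<in>?I. (?w i)\<^sup>2)"
    by (rule Cauchy_Schwarz_ineq_sum)
  then show ?thesis by (simp add: eq power2_eq_square)
qed

lemma ip_step_le:
  assumes "\<And>r k. \<bar>\<Delta> r k\<bar> \<le> 1"
  shows "ip \<Delta> \<Delta> \<le> A1"
  unfolding ip_eq A1_def
proof (intro sum_mono)
  fix r k assume "k \<in> {..<K r}"
  then have "A r k * (\<Delta> r k)\<^sup>2 \<le> A r k * 1"
    using assms[of r k] A_pos[of k r] by (intro mult_left_mono) (auto simp: abs_square_le_1)
  then show "A r k * \<Delta> r k * \<Delta> r k \<le> A r k" by (simp add: power2_eq_square mult.assoc)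
qed

text \<open>The functional is represented by the vector \<open>d / A\<close> in the weighted inner
  product; 1 is added to its squared norm to make the constant positive.\<close>

lemma lin_cauchy_schwarz:
  obtains c where "0 < c" "\<And>v. (lin d v)\<^sup>2 \<le> c * ip v v"
proof -
  let ?u = "\<lambda>r k. d r k / A r k"
  have "lin d v = ip ?u v" for v
    unfolding ip_eq lin_def using A_pos by (intro sum.cong refl) (auto simp: less_imp_neq[OF A_pos, symmetric])
  then have "(lin d v)\<^sup>2 \<le> ip ?u ?u * ip v v" for v
    using ip_cauchy_schwarz[of ?u v] by simp
  moreover have "ip ?u ?u * ip v v \<le> (ip ?u ?u + 1) * ip v v" for v
    using ip_self_nonneg[of v] by (intro mult_right_mono) auto
  ultimately show thesis
    using ip_self_nonneg[of ?u] by (intro that[of "ip ?u ?u + 1"]) (auto intro: order_trans add_nonneg_pos)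
qed

lemma wc_eq: "wc (re n) = (\<Sum>r\<in>UNIV. \<kappa> r * cnt n r)"
  by (simp add: wc_def lin_def cnt_def re_def sum_distrib_left)

lemma wc_nonneg: "0 \<le> wc (re n)"
  unfolding wc_eq by (intro sum_nonneg mult_nonneg_nonneg) (auto simp: less_imp_le[OF \<kappa>_pos] cnt_nonneg)

lemma N1_ge: "1 \<le> N1 n"
  by (simp add: N1_def wc_nonneg)

lemma phase_le_wc:
  assumes "k < K r" shows "re n r k \<le> wc (re n) / \<kappa> r"
proof -
  have "re n r k \<le> cnt n r"
    unfolding cnt_def re_def using assms by (intro member_le_sum) auto
  moreover have "\<kappa> r * cnt n r \<le> wc (re n)"
    unfolding wc_eq by (rule member_le_sum) (auto simp: cnt_nonneg less_imp_le[OF \<kappa>_pos])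
  ultimately show ?thesis
    using \<kappa>_pos[of r] by (simp add: field_simps) (meson mult_left_mono less_imp_le order_trans)
qed

lemma ip_le_wc:
  obtains c where "0 < c" "\<And>n. ip (re n) (re n) \<le> c * (wc (re n))\<^sup>2"
proof -
  define c where "c = 1 + (\<Sum>r\<in>UNIV. \<Sum>k<K r. A r k / (\<kappa> r)\<^sup>2)"
  have "0 \<le> (\<Sum>r\<in>UNIV. \<Sum>k<K r. A r k / (\<kappa> r)\<^sup>2)"
    using A_pos by (intro sum_nonneg) (auto simp: less_imp_le)
  then have c: "0 < c" by (simp add: c_def)
  have "ip (re n) (re n) \<le> c * (wc (re n))\<^sup>2" for n
  proof -
    have "ip (re n) (re n) \<le> (\<Sum>r\<in>UNIV. \<Sum>k<K r. A r k / (\<kappa> r)\<^sup>2 * (wc (re n))\<^sup>2)"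
      unfolding ip_eq
    proof (intro sum_mono)
      fix r k assume k: "k \<in> {..<K r}"
      have "(re n r k)\<^sup>2 \<le> (wc (re n) / \<kappa> r)\<^sup>2"
        using phase_le_wc[of k r n] k by (intro power_mono) (auto simp: re_def)
      then have "A r k * (re n r k)\<^sup>2 \<le> A r k * (wc (re n) / \<kappa> r)\<^sup>2"
        using A_pos[of k r] k by (intro mult_left_mono) auto
      then show "A r k * re n r k * re n r k \<le> A r k / (\<kappa> r)\<^sup>2 * (wc (re n))\<^sup>2"
        by (simp add: power2_eq_square mult.assoc)
    qed
    also have "\<dots> \<le> c * (wc (re n))\<^sup>2"
      by (simp add: c_def sum_distrib_right distrib_right)
    finally show ?thesis .
  qed
  with c show thesis by (rule that)
qed

definition dev :: "real \<Rightarrow> 'r state \<Rightarrow> 'r \<Rightarrow> nat \<Rightarrow> real" where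
  "dev \<epsilon> n r k = \<phi> n r k - (1 - \<epsilon>) * \<rho> r k"

definition D2 :: "real \<Rightarrow> 'r state \<Rightarrow> real" where
  "D2 \<epsilon> n = (\<Sum>r\<in>UNIV. rs (p n) r * (\<Sum>k<K r. (dev \<epsilon> n r k)\<^sup>2))"

lemma sum_dev: "(\<Sum>k<K r. dev \<epsilon> n r k) = \<Phi> n r - (1 - \<epsilon>) * R r"
  by (simp add: dev_def \<Phi>_def R_def sum_subtractf sum_distrib_left)

lemma D2_nonneg: "n \<in> X \<Longrightarrow> 0 \<le> D2 \<epsilon> n"
  unfolding D2_def by (intro sum_nonneg mult_nonneg_nonneg rs_nonneg) auto

lemma multiplier_load: "n \<in> X \<Longrightarrow> p n l * load (\<Phi> n) l = p n l * C l"
  using multiplier_slack[of n l] by auto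

text \<open>Slackness replaces capacities by loads, and duality turns the priced loads into the flow
  counts of the routes. Thus the multipliers have exactly the size of the state.\<close>

lemma sum_multiplier_C:
  assumes "n \<in> X" shows "(\<Sum>l\<in>UNIV. p n l * C l) = wc (re n)"
proof -
  have "(\<Sum>l\<in>UNIV. p n l * C l) = (\<Sum>l\<in>UNIV. p n l * load (\<Phi> n) l)"
    by (simp add: multiplier_load[OF assms])
  also have "\<dots> = (\<Sum>r\<in>UNIV. rs (p n) r * \<Phi> n r)" by (rule sum_rs[symmetric])
  also have "\<dots> = wc (re n)"
    unfolding wc_eq by (intro sum.cong refl) (simp add: multiplier_route[OF assms, symmetric])
  finally show ?thesis .
qed

text \<open>By \<open>multiplier_phase\<close> the state is \<open>rs (p n) / \<kappa>\<close> times
  \<open>\<phi>\<close>, and \<open>\<phi>\<close> is \<open>dev\<close> plus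
  \<open>(1 - \<epsilon>) * \<rho>\<close>. The first part gives a quadratic form in
  \<open>dev\<close>. In the second, \<open>A * \<rho> = \<kappa> * m\<close> and
  \<open>s m = - 1\<close> leave only route totals, which duality and slackness convert into link
  slacks.\<close>

lemma drift_self:
  assumes n: "n \<in> X"
  shows "drift \<epsilon> n (\<lambda>r k. A r k * re n r k) =
    (\<Sum>r\<in>UNIV. rs (p n) r / \<kappa> r * (\<Sum>k<K r. \<Sum>j<K r. dev \<epsilon> n r k * s r k j * (A r j * dev \<epsilon> n r j)))
    - (1 - \<epsilon>) * (\<Sum>l\<in>UNIV. p n l * (C l - (1 - \<epsilon>) * load R l))"
proof -
  have route: "(\<Sum>k<K r. \<Sum>j<K r. dev \<epsilon> n r k * s r k j * (A r j * re n r j))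
      = rs (p n) r / \<kappa> r * (\<Sum>k<K r. \<Sum>j<K r. dev \<epsilon> n r k * s r k j * (A r j * dev \<epsilon> n r j))
        - (1 - \<epsilon>) * (rs (p n) r * (\<Phi> n r - (1 - \<epsilon>) * R r))" for r
  proof -
    have A_re: "A r j * re n r j = rs (p n) r / \<kappa> r * (A r j * dev \<epsilon> n r j) + (1 - \<epsilon>) * rs (p n) r * m r j"
      if j: "j < K r" for j
    proof -
      have "re n r j = rs (p n) r / \<kappa> r * (dev \<epsilon> n r j + (1 - \<epsilon>) * \<rho> r j)"
        using multiplier_phase[OF n j] \<kappa>_pos[of r] by (simp add: re_def dev_def field_simps)
      moreover have "A r j * \<rho> r j = \<kappa> r * m r j"
        using \<rho>_pos[OF j] by (simp add: A_def)
      moreover have "P * (d + (1 - \<epsilon>) * \<rho> r j) * A r j = P * (A r j * d) + (1 - \<epsilon>) * P * (A r j * \<rho> r j)" for P d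
        by (simp add: algebra_simps)
      ultimately have "A r j * re n r j = rs (p n) r / \<kappa> r * (A r j * dev \<epsilon> n r j) + (1 - \<epsilon>) * (rs (p n) r / \<kappa> r) * (\<kappa> r * m r j)"
        by (metis mult.commute)
      then show ?thesis
        using \<kappa>_pos[of r] by simp
    qed
    have "(\<Sum>k<K r. \<Sum>j<K r. dev \<epsilon> n r k * s r k j * (A r j * re n r j))
      = (\<Sum>k<K r. \<Sum>j<K r. rs (p n) r / \<kappa> r * (dev \<epsilon> n r k * s r k j * (A r j * dev \<epsilon> n r j))
          + (1 - \<epsilon>) * rs (p n) r * (dev \<epsilon> n r k * (s r k j * m r j)))"
      by (intro sum.cong refl, subst A_re) (simp_all add: algebra_simps)
    also have "\<dots> = rs (p n) r / \<kappa> r * (\<Sum>k<K r. \<Sum>j<K r. dev \<epsilon> n r k * s r k j * (A r j * dev \<epsilon> n r j))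
          + (1 - \<epsilon>) * rs (p n) r * (\<Sum>k<K r. dev \<epsilon> n r k * (\<Sum>j<K r. s r k j * m r j))"
      by (simp add: sum.distrib sum_distrib_left)
    also have "(\<Sum>k<K r. dev \<epsilon> n r k * (\<Sum>j<K r. s r k j * m r j)) = - (\<Phi> n r - (1 - \<epsilon>) * R r)"
      by (simp add: s_m sum_negf sum_dev)
    finally show ?thesis by (simp only: mult_minus_right mult.assoc add_uminus_conv_diff)
  qed
  have "(\<Sum>r\<in>UNIV. rs (p n) r * (\<Phi> n r - (1 - \<epsilon>) * R r)) = (\<Sum>l\<in>UNIV. p n l * (C l - (1 - \<epsilon>) * load R l))"
    unfolding sum_rs by (simp add: load_diff load_scale right_diff_distrib multiplier_load[OF n])
  then show ?thesis
    unfolding drift_def dev_def[symmetric] by (simp add: route sum_subtractf sum_distrib_left[symmetric])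
qed

text \<open>Coercivity bounds the quadratic form. Every link has slack at least
  \<open>\<epsilon> * C l\<close> under the reduced load, so the linear part is at least
  \<open>\<epsilon>\<close> times the priced capacity, which is the weighted flow count.\<close>

lemma drift_self_le:
  obtains c where "0 < c" "\<And>\<epsilon> n. n \<in> X \<Longrightarrow> 0 \<le> \<epsilon> \<Longrightarrow> \<epsilon> \<le> 1 \<Longrightarrow>
    drift \<epsilon> n (\<lambda>r k. A r k * re n r k) \<le> - c * D2 \<epsilon> n - (1 - \<epsilon>) * \<epsilon> * wc (re n)"
proof -
  define M where "M = (\<Sum>r\<in>UNIV. \<kappa> r)"
  have \<kappa>_le: "\<kappa> r \<le> M" for r
    unfolding M_def by (rule member_le_sum) (auto simp: less_imp_le[OF \<kappa>_pos])
  have M: "0 < M" using \<kappa>_le \<kappa>_pos by (meson less_le_trans)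
  have "drift \<epsilon> n (\<lambda>r k. A r k * re n r k) \<le> - (c\<^sub>0 / M) * D2 \<epsilon> n - (1 - \<epsilon>) * \<epsilon> * wc (re n)"
    if n: "n \<in> X" and \<epsilon>: "0 \<le> \<epsilon>" "\<epsilon> \<le> 1" for \<epsilon> n
  proof -
    have "rs (p n) r / \<kappa> r * (\<Sum>k<K r. \<Sum>j<K r. dev \<epsilon> n r k * s r k j * (A r j * dev \<epsilon> n r j))
        \<le> - (c\<^sub>0 / M) * (rs (p n) r * (\<Sum>k<K r. (dev \<epsilon> n r k)\<^sup>2))" for r
    proof -
      let ?S = "\<Sum>k<K r. (dev \<epsilon> n r k)\<^sup>2"
      have "rs (p n) r / \<kappa> r * (\<Sum>k<K r. \<Sum>j<K r. dev \<epsilon> n r k * s r k j * (A r j * dev \<epsilon> n r j))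
          \<le> rs (p n) r / \<kappa> r * - (c\<^sub>0 * ?S)"
        using coercive[where r=r and v="dev \<epsilon> n r"] rs_nonneg[OF n, of r] \<kappa>_pos[of r]
        by (intro mult_left_mono) (auto simp: A_def)
      also have "\<dots> = - (rs (p n) r * c\<^sub>0 * ?S / \<kappa> r)" by simp
      also have "\<dots> \<le> - (rs (p n) r * c\<^sub>0 * ?S / M)"
        using \<kappa>_le[of r] \<kappa>_pos[of r] M rs_nonneg[OF n, of r] c0_pos
        by (auto intro!: divide_left_mono mult_nonneg_nonneg sum_nonneg)
      finally show ?thesis by (simp add: mult.assoc mult.left_commute mult.commute)
    qed
    then have "(\<Sum>r\<in>UNIV. rs (p n) r / \<kappa> r * (\<Sum>k<K r. \<Sum>j<K r. dev \<epsilon> n r k * s r k j * (A r j * dev \<epsilon> n r j)))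
        \<le> - (c\<^sub>0 / M) * D2 \<epsilon> n"
      unfolding D2_def sum_distrib_left[of _ _ UNIV] by (rule sum_mono)
    moreover have "\<epsilon> * wc (re n) \<le> (\<Sum>l\<in>UNIV. p n l * (C l - (1 - \<epsilon>) * load R l))"
      unfolding sum_multiplier_C[OF n, symmetric] sum_distrib_left
    proof (rule sum_mono)
      fix l
      have "(1 - \<epsilon>) * load R l \<le> (1 - \<epsilon>) * C l"
        using \<epsilon> load_R_le by (intro mult_left_mono) auto
      then have "\<epsilon> * C l \<le> C l - (1 - \<epsilon>) * load R l" by (simp add: algebra_simps)
      from mult_left_mono[OF this p_nonneg[OF n]]
      show "\<epsilon> * (p n l * C l) \<le> p n l * (C l - (1 - \<epsilon>) * load R l)"
        by (simp add: mult.left_commute)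
    qed
    then have "(1 - \<epsilon>) * (\<epsilon> * wc (re n)) \<le> (1 - \<epsilon>) * (\<Sum>l\<in>UNIV. p n l * (C l - (1 - \<epsilon>) * load R l))"
      using \<epsilon> by (intro mult_left_mono) auto
    ultimately show ?thesis unfolding drift_self[OF n] by simp
  qed
  with M c0_pos show thesis by (intro that[of "c\<^sub>0 / M"]) auto
qed

abbreviation E :: "'r state pmf \<Rightarrow> ('r state \<Rightarrow> real) \<Rightarrow> real" where
  "E D \<equiv> measure_pmf.expectation D"

text \<open>The mean-zero and Foster properties are the interface to the chain: the moment estimates
  rely on them and not on the semigroup.\<close>

definition stationary :: "real \<Rightarrow> 'r state pmf \<Rightarrow> bool" where
  "stationary \<epsilon> D \<longleftrightarrow> set_pmf D \<subseteq> X \<and>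
     (\<forall>f. integrable (measure_pmf D) f \<longrightarrow> (\<forall>n\<in>X. 0 \<le> f n) \<longrightarrow>
        integrable (measure_pmf D) (G \<epsilon> f) \<and> E D (G \<epsilon> f) = 0) \<and>
     (\<forall>f g h. (\<forall>n\<in>X. 0 \<le> f n \<and> 0 \<le> g n \<and> 0 \<le> h n \<and> G \<epsilon> f n \<le> h n - g n) \<longrightarrow>
        integrable (measure_pmf D) h \<longrightarrow>
        integrable (measure_pmf D) g \<and> E D g \<le> E D h)"

lemma drift_scale: "drift \<epsilon> n (\<lambda>r k. t * c r k) = t * drift \<epsilon> n c"
  by (simp add: drift_def sum_distrib_left mult.left_commute)

lemma drift_diff: "drift \<epsilon> n (\<lambda>r k. c r k - d r k) = drift \<epsilon> n c - drift \<epsilon> n d"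
  by (simp add: drift_def sum_subtractf right_diff_distrib)

text \<open>The vector \<open>w\<close> is the deviation of the state from a reference point that may be kept fixed
  during a jump, so that \<open>f\<close> only has to be dominated after the jump.\<close>

lemma G_square_le:
  assumes \<epsilon>: "0 \<le> \<epsilon>" "\<epsilon> \<le> 1" and n: "n \<in> X"
    and f_n: "f n = (ip w w / 2)\<^sup>2"
    and f_le: "\<And>n'. n' \<in> X \<Longrightarrow>
      f n' \<le> (ip (\<lambda>r k. w r k + (re n' r k - re n r k)) (\<lambda>r k. w r k + (re n' r k - re n r k)) / 2)\<^sup>2"
  shows "G \<epsilon> f n \<le> ip w w * drift \<epsilon> n (\<lambda>r k. A r k * w r k) + Q * (3 * A1 * ip w w + A1\<^sup>2)"
proof -
  let ?V = "ip w w"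
  have "G \<epsilon> f n \<le> drift \<epsilon> n (\<lambda>r k. ?V * (A r k * w r k)) + Q * (3 * A1 * ?V + A1\<^sup>2)"
  proof (rule G_le[OF \<epsilon> n])
    show "0 \<le> 3 * A1 * ?V + A1\<^sup>2"
      using A1_nonneg ip_self_nonneg[of w] by simp
    fix n' assume n': "n' \<in> X" and small: "\<And>r k. \<bar>re n' r k - re n r k\<bar> \<le> 1"
    let ?\<Delta> = "\<lambda>r k. re n' r k - re n r k"
    have \<Delta>: "0 \<le> ip ?\<Delta> ?\<Delta>" "ip ?\<Delta> ?\<Delta> \<le> A1"
      using ip_self_nonneg ip_step_le[of ?\<Delta>] small by auto
    have cs: "(ip w ?\<Delta>)\<^sup>2 \<le> ?V * A1"
      using ip_cauchy_schwarz[of w ?\<Delta>] mult_left_mono[OF \<Delta>(2) ip_self_nonneg[of w]] by linarith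
    have cs': "(ip w ?\<Delta> + ip ?\<Delta> ?\<Delta> / 2)\<^sup>2 \<le> 2 * (ip w ?\<Delta>)\<^sup>2 + (ip ?\<Delta> ?\<Delta>)\<^sup>2 / 2"
      using sum_squares_bound[of "ip w ?\<Delta>" "ip ?\<Delta> ?\<Delta> / 2"] by (simp add: power2_eq_square algebra_simps)
    have sq: "(ip ?\<Delta> ?\<Delta>)\<^sup>2 \<le> A1\<^sup>2" "?V * ip ?\<Delta> ?\<Delta> \<le> ?V * A1"
      using \<Delta> ip_self_nonneg[of w] by (auto intro: power_mono mult_left_mono)
    have "f n' - f n \<le> (?V / 2 + (ip w ?\<Delta> + ip ?\<Delta> ?\<Delta> / 2))\<^sup>2 - (?V / 2)\<^sup>2"
      using f_le[OF n'] f_n unfolding ip_self_add by (simp add: add_divide_distrib algebra_simps)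
    also have "\<dots> = ?V * ip w ?\<Delta> + ?V * ip ?\<Delta> ?\<Delta> / 2 + (ip w ?\<Delta> + ip ?\<Delta> ?\<Delta> / 2)\<^sup>2"
      by (simp add: power2_eq_square algebra_simps)
    also have "\<dots> \<le> ?V * ip w ?\<Delta> + (3 * A1 * ?V + A1\<^sup>2)"
    proof -
      have "(ip w ?\<Delta> + ip ?\<Delta> ?\<Delta> / 2)\<^sup>2 \<le> 2 * (?V * A1) + A1\<^sup>2 / 2"
        using cs cs' sq(1) by linarith
      moreover have "3 * A1 * ?V = 3 * (?V * A1)" "0 \<le> ?V * A1" "0 \<le> A1\<^sup>2"
        using mult_nonneg_nonneg[OF ip_self_nonneg[of w] A1_nonneg] by auto
      ultimately show ?thesis using sq(2) by linarith
    qed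
    also have "?V * ip w ?\<Delta> = lin (\<lambda>r k. ?V * (A r k * w r k)) ?\<Delta>"
      by (simp add: ip_def lin_commute[of _ ?\<Delta>] lin_scale)
    finally show "f n' - f n \<le> lin (\<lambda>r k. ?V * (A r k * w r k)) ?\<Delta> + (3 * A1 * ?V + A1\<^sup>2)" .
  qed
  then show ?thesis by (simp add: drift_scale)
qed

text \<open>Squaring the quadratic Lyapunov function multiplies its drift, of order
  \<open>- \<epsilon> * w\<close>, by another square of \<open>w\<close>. The resulting cubic term
  absorbs the quadratic jump remainder at the price of a constant over the square of
  \<open>\<epsilon>\<close>; dividing by the coefficient \<open>\<epsilon>\<close> gives the third
  power.\<close>

lemma third_moment:
  obtains c where "0 < c" "\<And>\<epsilon> D. stationary \<epsilon> D \<Longrightarrow> 0 < \<epsilon> \<Longrightarrow> \<epsilon> \<le> 1 / 2 \<Longrightarrow>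
    integrable (measure_pmf D) (\<lambda>n. N1 n ^ 3) \<and> E D (\<lambda>n. N1 n ^ 3) \<le> c / \<epsilon> ^ 3"
proof -
  obtain c\<^sub>1 where c1: "0 < c\<^sub>1" "\<And>v. (wc v)\<^sup>2 \<le> c\<^sub>1 * ip v v"
    using lin_cauchy_schwarz unfolding wc_def by blast
  obtain c\<^sub>2 where c2: "0 < c\<^sub>2" "\<And>n. ip (re n) (re n) \<le> c\<^sub>2 * (wc (re n))\<^sup>2"
    using ip_le_wc by blast
  obtain c\<^sub>3 where c3: "0 < c\<^sub>3" "\<And>\<epsilon> n. n \<in> X \<Longrightarrow> 0 \<le> \<epsilon> \<Longrightarrow> \<epsilon> \<le> 1 \<Longrightarrow>
    drift \<epsilon> n (\<lambda>r k. A r k * re n r k) \<le> - c\<^sub>3 * D2 \<epsilon> n - (1 - \<epsilon>) * \<epsilon> * wc (re n)"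
    using drift_self_le by blast
  define Q' where "Q' = \<bar>Q\<bar>"
  \<comment> \<open>Since \<open>?V\<close> is at least \<open>?w\<^sup>2 / c\<^sub>1\<close>, the
    negative term is \<open>4 * \<epsilon> * \<beta>\<close> times the cube of \<open>?w\<close>;
    the factor 4 pays for passing from \<open>?w\<close> to \<open>N1\<close>.\<close>
  define \<beta> where "\<beta> = 1 / (8 * c\<^sub>1)"
  define a\<^sub>1 where "a\<^sub>1 = 3 * Q' * A1 * c\<^sub>2"
  define a\<^sub>2 where "a\<^sub>2 = Q' * A1\<^sup>2"
  define h where "h = 4 * \<beta> + a\<^sub>2 + a\<^sub>1 ^ 3 / (\<beta> / 2)\<^sup>2"
  have pos: "0 < \<beta>" "0 \<le> a\<^sub>1" "0 \<le> a\<^sub>2" "0 < h" "0 \<le> Q'"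
    using c1(1) c2(1) A1_nonneg by (auto simp: \<beta>_def a\<^sub>1_def a\<^sub>2_def h_def Q'_def intro!: add_pos_nonneg)
  have main: "G \<epsilon> (\<lambda>n. (ip (re n) (re n) / 2)\<^sup>2) n \<le> h / \<epsilon>\<^sup>2 - (\<epsilon> * \<beta> / 2) * N1 n ^ 3"
    if n: "n \<in> X" and \<epsilon>: "0 < \<epsilon>" "\<epsilon> \<le> 1 / 2" for \<epsilon> n
  proof -
    let ?w = "wc (re n)" and ?V = "ip (re n) (re n)"
    have V: "0 \<le> ?V" "?w\<^sup>2 \<le> c\<^sub>1 * ?V" "?V \<le> c\<^sub>2 * ?w\<^sup>2" and w: "0 \<le> ?w"
      using ip_self_nonneg c1(2) c2(2) wc_nonneg by auto
    have "drift \<epsilon> n (\<lambda>r k. A r k * re n r k) \<le> - ((1 - \<epsilon>) * \<epsilon> * ?w)"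
      using c3(2)[OF n, of \<epsilon>] mult_nonneg_nonneg[OF less_imp_le[OF c3(1)] D2_nonneg[OF n, of \<epsilon>]] \<epsilon> by simp
    moreover have "1 / 2 * (\<epsilon> * ?w) \<le> (1 - \<epsilon>) * (\<epsilon> * ?w)"
      using \<epsilon> w by (intro mult_right_mono) auto
    ultimately have d: "drift \<epsilon> n (\<lambda>r k. A r k * re n r k) \<le> - (\<epsilon> * ?w / 2)" by simp
    have "G \<epsilon> (\<lambda>n. (ip (re n) (re n) / 2)\<^sup>2) n
        \<le> ?V * drift \<epsilon> n (\<lambda>r k. A r k * re n r k) + Q * (3 * A1 * ?V + A1\<^sup>2)"
      by (rule G_square_le) (use \<epsilon> n in auto)
    also have "\<dots> \<le> ?V * - (\<epsilon> * ?w / 2) + Q' * (3 * A1 * ?V + A1\<^sup>2)"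
      using d V A1_nonneg by (intro add_mono mult_left_mono mult_right_mono) (auto simp: Q'_def)
    also have "\<dots> \<le> - (4 * \<epsilon> * \<beta> * ?w ^ 3) + (a\<^sub>1 * ?w\<^sup>2 + a\<^sub>2)"
    proof (rule add_mono)
      have "?w ^ 3 / c\<^sub>1 \<le> ?V * ?w"
        using mult_right_mono[OF V(2) w] c1(1) by (simp add: field_simps power2_eq_square power3_eq_cube)
      from mult_left_mono[OF this, of "\<epsilon> / 2"] \<epsilon> show "?V * - (\<epsilon> * ?w / 2) \<le> - (4 * \<epsilon> * \<beta> * ?w ^ 3)"
        by (simp add: \<beta>_def field_simps)
      have "Q' * (3 * A1 * ?V + A1\<^sup>2) \<le> Q' * (3 * A1 * (c\<^sub>2 * ?w\<^sup>2) + A1\<^sup>2)"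
        using pos V A1_nonneg by (intro mult_left_mono add_mono) auto
      then show "Q' * (3 * A1 * ?V + A1\<^sup>2) \<le> a\<^sub>1 * ?w\<^sup>2 + a\<^sub>2"
        by (simp add: a\<^sub>1_def a\<^sub>2_def algebra_simps)
    qed
    also have "\<dots> \<le> - (\<epsilon> * \<beta> * N1 n ^ 3) + 4 * \<epsilon> * \<beta> + (a\<^sub>1 * (N1 n)\<^sup>2 + a\<^sub>2)"
    proof -
      have "N1 n ^ 3 \<le> 4 * (1 + ?w ^ 3)"
      proof -
        \<comment> \<open>This is the difference between \<open>4 * (1 + ?w ^ 3)\<close> and the
          cube of \<open>1 + ?w\<close>, factorised.\<close>
        have "0 \<le> 3 * (1 + ?w) * (1 - ?w)\<^sup>2" using w by simp
        then show ?thesis by (simp add: N1_def power2_eq_square power3_eq_cube algebra_simps)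
      qed
      from mult_left_mono[OF this, of "\<epsilon> * \<beta>"] \<epsilon> pos
      have "\<epsilon> * \<beta> * N1 n ^ 3 \<le> 4 * \<epsilon> * \<beta> + 4 * \<epsilon> * \<beta> * ?w ^ 3" by (simp add: algebra_simps)
      moreover have "a\<^sub>1 * ?w\<^sup>2 \<le> a\<^sub>1 * (N1 n)\<^sup>2"
        using pos w by (intro mult_left_mono power_mono) (auto simp: N1_def)
      ultimately show ?thesis by simp
    qed
    also have "a\<^sub>1 * (N1 n)\<^sup>2 \<le> \<epsilon> * \<beta> / 2 * N1 n ^ 3 + a\<^sub>1 ^ 3 / (\<epsilon> * \<beta> / 2)\<^sup>2"
      by (rule square_le_cube) (use pos \<epsilon> N1_ge[of n] in auto)
    finally have "G \<epsilon> (\<lambda>n. (ip (re n) (re n) / 2)\<^sup>2) n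
        \<le> 4 * \<epsilon> * \<beta> + a\<^sub>2 + a\<^sub>1 ^ 3 / (\<epsilon> * \<beta> / 2)\<^sup>2 - \<epsilon> * \<beta> / 2 * N1 n ^ 3"
      by (simp add: algebra_simps)
    moreover have "4 * \<epsilon> * \<beta> + a\<^sub>2 + a\<^sub>1 ^ 3 / (\<epsilon> * \<beta> / 2)\<^sup>2 \<le> h / \<epsilon>\<^sup>2"
    proof -
      have e2: "\<epsilon>\<^sup>2 \<le> 1" "\<epsilon> ^ 3 \<le> 1" using \<epsilon> by (auto intro!: power_le_one)
      have "(4 * \<epsilon> * \<beta> + a\<^sub>2) * \<epsilon>\<^sup>2 = 4 * \<beta> * \<epsilon> ^ 3 + a\<^sub>2 * \<epsilon>\<^sup>2" by (simp add: algebra_simps power2_eq_square power3_eq_cube)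
      also have "\<dots> \<le> 4 * \<beta> * 1 + a\<^sub>2 * 1"
        using e2 pos by (intro add_mono mult_left_mono) auto
      finally have "4 * \<epsilon> * \<beta> + a\<^sub>2 \<le> (4 * \<beta> + a\<^sub>2) / \<epsilon>\<^sup>2"
        using \<epsilon> by (simp add: pos_le_divide_eq)
      moreover have "a\<^sub>1 ^ 3 / (\<epsilon> * \<beta> / 2)\<^sup>2 = a\<^sub>1 ^ 3 / (\<beta> / 2)\<^sup>2 / \<epsilon>\<^sup>2"
        by (simp add: power_mult_distrib power_divide mult.commute)
      ultimately show ?thesis unfolding h_def add_divide_distrib by linarith
    qed
    ultimately show ?thesis by simp
  qed
  have "integrable (measure_pmf D) (\<lambda>n. N1 n ^ 3) \<and> E D (\<lambda>n. N1 n ^ 3) \<le> (2 * h / \<beta>) / \<epsilon> ^ 3"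
    if D: "stationary \<epsilon> D" and \<epsilon>: "0 < \<epsilon>" "\<epsilon> \<le> 1 / 2" for \<epsilon> D
  proof -
    have foster: "\<And>f g h. (\<forall>n\<in>X. 0 \<le> f n \<and> 0 \<le> g n \<and> 0 \<le> h n \<and> G \<epsilon> f n \<le> h n - g n) \<Longrightarrow>
        integrable (measure_pmf D) h \<Longrightarrow>
        integrable (measure_pmf D) g \<and> E D g \<le> E D h"
      using D unfolding stationary_def by blast
    define t where "t = \<epsilon> * \<beta> / 2"
    have t: "0 < t" using \<epsilon> pos by (simp add: t_def)
    have main': "G \<epsilon> (\<lambda>n. (ip (re n) (re n) / 2)\<^sup>2) n \<le> h / \<epsilon>\<^sup>2 - t * N1 n ^ 3" if "n \<in> X" for n
      using main[OF that \<epsilon>] by (simp add: t_def)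
    have "integrable (measure_pmf D) (\<lambda>n. t * N1 n ^ 3) \<and>
        E D (\<lambda>n. t * N1 n ^ 3) \<le> E D (\<lambda>_. h / \<epsilon>\<^sup>2)"
      by (rule foster[where f="\<lambda>n. (ip (re n) (re n) / 2)\<^sup>2"])
         (use main' t pos N1_ge in \<open>auto intro!: mult_nonneg_nonneg zero_le_power intro: order_trans[of 0 1]\<close>)
    then have *: "integrable (measure_pmf D) (\<lambda>n. N1 n ^ 3)"
      "\<epsilon> * \<beta> / 2 * E D (\<lambda>n. N1 n ^ 3) \<le> h / \<epsilon>\<^sup>2"
      using t by (auto simp flip: t_def)
    from *(2) have "E D (\<lambda>n. N1 n ^ 3) \<le> h / \<epsilon>\<^sup>2 / (\<epsilon> * \<beta> / 2)"
      using \<epsilon> pos by (simp add: pos_le_divide_eq mult_ac)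
    also have "\<dots> = (2 * h / \<beta>) / \<epsilon> ^ 3" using \<epsilon> pos by (simp add: field_simps power2_eq_square power3_eq_cube)
    finally show ?thesis using * by blast
  qed
  moreover have "0 < 2 * h / \<beta>" using pos by simp
  ultimately show thesis using that by blast
qed

section \<open>State space collapse\<close>

lemma
  assumes "stationary \<epsilon> D"
  shows stationary_AE: "AE n in measure_pmf D. n \<in> X"
    and stationary_gen: "integrable (measure_pmf D) f \<Longrightarrow> (\<And>n. n \<in> X \<Longrightarrow> 0 \<le> f n) \<Longrightarrow>
        integrable (measure_pmf D) (G \<epsilon> f) \<and> E D (G \<epsilon> f) = 0"
    and stationary_foster: "(\<And>n. n \<in> X \<Longrightarrow> 0 \<le> f n \<and> 0 \<le> g n \<and> 0 \<le> h n \<and> G \<epsilon> f n \<le> h n - g n) \<Longrightarrow>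
        integrable (measure_pmf D) h \<Longrightarrow>
        integrable (measure_pmf D) g \<and> E D g \<le> E D h"
  using assms unfolding stationary_def by (simp add: AE_measure_pmf_iff subset_eq, blast, blast)

lemma N1_power_le: "i \<le> j \<Longrightarrow> N1 n ^ i \<le> N1 n ^ j"
  using N1_ge by (intro power_increasing) auto

lemma integrable_N1_bound:
  assumes D: "integrable (measure_pmf D) (\<lambda>n. N1 n ^ 3)" "AE n in measure_pmf D. n \<in> X"
    and f: "\<And>n. n \<in> X \<Longrightarrow> \<bar>f n\<bar> \<le> c * N1 n ^ 3"
  shows "integrable (measure_pmf D) f"
proof (rule Bochner_Integration.integrable_bound)
  show "integrable (measure_pmf D) (\<lambda>n. c * N1 n ^ 3)" using D(1) by simp
  show "AE n in measure_pmf D. norm (f n) \<le> norm (c * N1 n ^ 3)"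
    using D(2)
  proof eventually_elim
    case (elim n)
    with f[of n] show ?case by simp
  qed
qed simp

text \<open>The first moment follows from the third by cutting at the level
  \<open>1 / \<epsilon>\<close>: above it \<open>N1\<close> is at most the square of
  \<open>\<epsilon>\<close> times its cube.\<close>

lemma moments:
  obtains c where "0 < c" "\<And>\<epsilon> D. stationary \<epsilon> D \<Longrightarrow> 0 < \<epsilon> \<Longrightarrow> \<epsilon> \<le> 1 / 2 \<Longrightarrow>
    integrable (measure_pmf D) (\<lambda>n. N1 n ^ 3) \<and> E D (\<lambda>n. N1 n ^ 3) \<le> c / \<epsilon> ^ 3 \<and>
    integrable (measure_pmf D) N1 \<and> E D N1 \<le> c / \<epsilon>"
proof -
  obtain c where c: "0 < c" "\<And>\<epsilon> D. stationary \<epsilon> D \<Longrightarrow> 0 < \<epsilon> \<Longrightarrow> \<epsilon> \<le> 1 / 2 \<Longrightarrow>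
    integrable (measure_pmf D) (\<lambda>n. N1 n ^ 3) \<and> E D (\<lambda>n. N1 n ^ 3) \<le> c / \<epsilon> ^ 3"
    using third_moment by blast
  show thesis
  proof (rule that[of "1 + c"])
    fix \<epsilon> D assume D: "stationary \<epsilon> D" and \<epsilon>: "0 < \<epsilon>" "\<epsilon> \<le> 1 / 2"
    note m3 = c(2)[OF D \<epsilon>]
    have int: "integrable (measure_pmf D) N1"
    proof (rule integrable_N1_bound[where c=1])
      show "\<bar>N1 n\<bar> \<le> 1 * N1 n ^ 3" for n
        using N1_power_le[of 1 3 n] N1_ge[of n] by simp
    qed (use m3 stationary_AE[OF D] in auto)
    have "N1 n \<le> 1 / \<epsilon> + \<epsilon>\<^sup>2 * N1 n ^ 3" for n
    proof (cases "\<epsilon> * N1 n \<le> 1")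
      case True
      then have "N1 n \<le> 1 / \<epsilon>" using \<epsilon> by (simp add: field_simps)
      moreover have "0 \<le> \<epsilon>\<^sup>2 * N1 n ^ 3" using N1_ge[of n] by simp
      ultimately show ?thesis by simp
    next
      case False
      then have "1 \<le> (\<epsilon> * N1 n)\<^sup>2" by simp
      then have "N1 n * 1 \<le> N1 n * (\<epsilon> * N1 n)\<^sup>2"
        using N1_ge[of n] by (intro mult_left_mono) auto
      then have "N1 n \<le> \<epsilon>\<^sup>2 * N1 n ^ 3"
        by (simp add: power2_eq_square power3_eq_cube algebra_simps)
      moreover have "0 \<le> 1 / \<epsilon>" using \<epsilon> by simp
      ultimately show ?thesis by linarith
    qed
    then have "E D N1 \<le> E D (\<lambda>n. 1 / \<epsilon> + \<epsilon>\<^sup>2 * N1 n ^ 3)"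
      using int m3 by (intro integral_mono) auto
    also have "\<dots> = 1 / \<epsilon> + \<epsilon>\<^sup>2 * E D (\<lambda>n. N1 n ^ 3)"
      using m3 by simp
    also have "\<dots> \<le> 1 / \<epsilon> + \<epsilon>\<^sup>2 * (c / \<epsilon> ^ 3)"
      using m3 by (intro add_left_mono mult_left_mono) auto
    also have "\<dots> = (1 + c) / \<epsilon>"
      using \<epsilon> by (simp add: field_simps power2_eq_square power3_eq_cube)
    finally have "E D N1 \<le> (1 + c) / \<epsilon>" .
    moreover have "c / \<epsilon> ^ 3 \<le> (1 + c) / \<epsilon> ^ 3" using \<epsilon> by (intro divide_right_mono) auto
    ultimately show "integrable (measure_pmf D) (\<lambda>n. N1 n ^ 3) \<and>
      E D (\<lambda>n. N1 n ^ 3) \<le> (1 + c) / \<epsilon> ^ 3 \<and>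
      integrable (measure_pmf D) N1 \<and> E D N1 \<le> (1 + c) / \<epsilon>"
      using m3 int by auto
  qed (use c in simp)
qed

text \<open>The state to which multipliers \<open>q\<close> would give exactly the critical service:
  solve \<open>multiplier_phase\<close> for the flow counts with \<open>\<rho>\<close> in place of
  \<open>\<phi>\<close>.\<close>

definition comb :: "('l \<Rightarrow> real) \<Rightarrow> 'r \<Rightarrow> nat \<Rightarrow> real" where
  "comb q r k = \<rho> r k / \<kappa> r * rs q r"

text \<open>The expected residual work that each phase brings to link \<open>l\<close>. By
  \<open>A_comb\<close> it is also \<open>A\<close> times the cone generator belonging to
  \<open>l\<close>, so workloads are inner products with the generators.\<close>

definition wl :: "'l \<Rightarrow> 'r \<Rightarrow> nat \<Rightarrow> real" where
  "wl l r k = (if l \<in> route r then m r k else 0)"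

definition cone :: "('l \<Rightarrow> real) \<Rightarrow> bool" where
  "cone q \<longleftrightarrow> (\<forall>l. 0 \<le> q l \<and> (l \<notin> Ls \<longrightarrow> q l = 0))"

lemma lin_wl: "lin (wl l) v = load (\<lambda>r. \<Sum>k<K r. m r k * v r k) l"
  unfolding lin_def link_load_def wl_def by (intro sum.mono_neutral_cong_right) auto

lemma A_comb: "k < K r \<Longrightarrow> A r k * comb q r k = m r k * rs q r"
  using \<kappa>_pos[of r] \<rho>_pos[of k r] by (simp add: A_def comb_def)

lemma wc_comb: "wc (comb q) = (\<Sum>l\<in>UNIV. q l * load R l)"
proof -
  have "wc (comb q) = (\<Sum>r\<in>UNIV. rs q r * R r)"
    unfolding wc_def lin_def comb_def R_def using \<kappa>_pos
    by (simp add: sum_distrib_left mult_ac less_imp_neq[OF \<kappa>_pos, symmetric])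
  then show ?thesis by (simp add: sum_rs)
qed

lemma wc_comb_cone: "cone q \<Longrightarrow> wc (comb q) = (\<Sum>l\<in>UNIV. q l * C l)"
  unfolding wc_comb
proof (intro sum.cong refl)
  fix l assume "cone q"
  then show "q l * load R l = q l * C l"
    by (cases "l \<in> Ls") (simp_all add: cone_def load_R)
qed

lemma wc_diff: "wc (\<lambda>r k. v r k - w r k) = wc v - wc w"
  by (simp add: wc_def lin_diff)

text \<open>In direction \<open>comb q\<close> the weights cancel to \<open>m * rs q\<close>, and
  \<open>s m = - 1\<close> removes all phase information; only link loads remain.\<close>

lemma drift_comb:
  "drift \<epsilon> n (\<lambda>r k. A r k * comb q r k) = (\<Sum>l\<in>UNIV. q l * ((1 - \<epsilon>) * load R l - load (\<Phi> n) l))"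
proof -
  have "drift \<epsilon> n (\<lambda>r k. A r k * comb q r k)
      = (\<Sum>r\<in>UNIV. rs q r * (\<Sum>k<K r. dev \<epsilon> n r k * (\<Sum>j<K r. s r k j * m r j)))"
    unfolding drift_def dev_def[symmetric] sum_distrib_left
    by (intro sum.cong refl) (simp add: A_comb mult_ac)
  also have "\<dots> = (\<Sum>r\<in>UNIV. rs q r * ((1 - \<epsilon>) * R r - \<Phi> n r))"
    by (intro sum.cong refl) (simp add: s_m sum_negf sum_dev)
  also have "\<dots> = (\<Sum>l\<in>UNIV. q l * ((1 - \<epsilon>) * load R l - load (\<Phi> n) l))"
    by (simp add: sum_rs load_diff load_scale)
  finally show ?thesis .
qed

text \<open>Coefficients that do at least as well as 0 are bounded, because the weighted count of
  \<open>comb q\<close> is the priced capacity and is within a multiple of the distance of that of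
  \<open>v\<close>. The minimum is therefore attained on a compact box.\<close>

lemma cone_projection_exists:
  "\<exists>q. cone q \<and> (\<forall>q'. cone q' \<longrightarrow>
     ip (\<lambda>r k. v r k - comb q r k) (\<lambda>r k. v r k - comb q r k)
      \<le> ip (\<lambda>r k. v r k - comb q' r k) (\<lambda>r k. v r k - comb q' r k))"
proof -
  define F where "F q = ip (\<lambda>r k. v r k - comb q r k) (\<lambda>r k. v r k - comb q r k)" for q
  obtain c where c: "0 < c" "\<And>v. (wc v)\<^sup>2 \<le> c * ip v v"
    using lin_cauchy_schwarz unfolding wc_def by blast
  define M where "M = wc v + sqrt (c * F (\<lambda>_. 0))"
  have bound: "q l \<le> M / C l" if q: "cone q" "F q \<le> F (\<lambda>_. 0)" for q l
  proof -
    have "\<bar>wc (\<lambda>r k. v r k - comb q r k)\<bar> \<le> sqrt (c * F q)"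
      using c(2)[of "\<lambda>r k. v r k - comb q r k"] by (simp add: F_def real_le_rsqrt)
    also have "\<dots> \<le> sqrt (c * F (\<lambda>_. 0))"
      using q c(1) by simp
    finally have "wc (comb q) \<le> M" by (simp add: wc_diff M_def)
    moreover have "q l * C l \<le> (\<Sum>l\<in>UNIV. q l * C l)"
      using q(1) C_pos by (intro member_le_sum) (auto simp: cone_def less_imp_le)
    ultimately have "q l * C l \<le> M" by (simp add: wc_comb_cone[OF q(1)])
    then show ?thesis using C_pos[of l] by (simp add: field_simps)
  qed
  have cone0: "cone (\<lambda>_. 0)" by (simp add: cone_def)
  \<comment> \<open>The box degenerates to 0 in the noncritical coordinates, so all its points lie
    in the cone.\<close>
  define u :: "real^'l" where "u = vec_lambda (\<lambda>l. if l \<in> Ls then M / C l else 0)"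
  have u0: "0 \<in> cbox 0 u"
    using bound[OF cone0 order_refl] by (auto simp: mem_box_cart u_def)
  have "continuous_on (cbox 0 u) (\<lambda>z. F (vec_nth z))"
    unfolding F_def ip_eq comb_def rs_def by (intro continuous_intros)
  from continuous_attains_inf[OF compact_cbox _ this] u0
  obtain z where z: "z \<in> cbox 0 u" "\<And>y. y \<in> cbox 0 u \<Longrightarrow> F (vec_nth z) \<le> F (vec_nth y)"
    by blast
  have "cone (vec_nth z)"
    using z(1) by (auto simp: cone_def mem_box_cart u_def) (metis order_antisym_conv)
  moreover have "F (vec_nth z) \<le> F q" if q: "cone q" for q
  proof (cases "F q \<le> F (\<lambda>_. 0)")
    case True
    have "vec_lambda q \<in> cbox 0 u"
      using bound[OF q True] q by (auto simp: mem_box_cart u_def cone_def)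
    moreover have "vec_nth (vec_lambda q :: real^'l) = q" by (simp add: fun_eq_iff)
    ultimately show ?thesis using z(2)[of "vec_lambda q"] by simp
  next
    case False
    have "F (vec_nth z) \<le> F (\<lambda>_. 0)"
    proof -
      have "vec_nth (0 :: real^'l) = (\<lambda>_. 0)" by (simp add: fun_eq_iff)
      with z(2)[OF u0] show ?thesis by simp
    qed
    with False show ?thesis by simp
  qed
  ultimately show ?thesis unfolding F_def by blast
qed

definition proj :: "'r state \<Rightarrow> 'l \<Rightarrow> real" where
  "proj n = (SOME q. cone q \<and> (\<forall>q'. cone q' \<longrightarrow>
     ip (\<lambda>r k. re n r k - comb q r k) (\<lambda>r k. re n r k - comb q r k)
      \<le> ip (\<lambda>r k. re n r k - comb q' r k) (\<lambda>r k. re n r k - comb q' r k)))"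

definition err :: "'r state \<Rightarrow> 'r \<Rightarrow> nat \<Rightarrow> real" where
  "err n r k = re n r k - comb (proj n) r k"

definition dd :: "'r state \<Rightarrow> real" where "dd n = ip (err n) (err n)"

lemma cone_proj: "cone (proj n)"
  and dd_le: "cone q \<Longrightarrow> dd n \<le> ip (\<lambda>r k. re n r k - comb q r k) (\<lambda>r k. re n r k - comb q r k)"
  using someI_ex[OF cone_projection_exists[of "re n"]]
  unfolding dd_def err_def[abs_def] proj_def by blast+

lemma dd_nonneg: "0 \<le> dd n"
  by (simp add: dd_def ip_self_nonneg)

text \<open>The distance to the cone is compared with that to the point given by the critical part
  of the multipliers. The discrepancy consists of service deviations and multipliers of noncritical
  links, and both are controlled by \<open>e\<close>, the deviations weighted by
  \<open>rs (p n)\<close>; Cauchy-Schwarz then relates \<open>e\<close> to \<open>D2\<close> and the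
  size of the state.\<close>

lemma dd_le_D2:
  obtains c where "0 < c" "\<And>\<epsilon> n. n \<in> X \<Longrightarrow> 0 \<le> \<epsilon> \<Longrightarrow> \<epsilon> \<le> 1 \<Longrightarrow> dd n \<le> c * N1 n * D2 \<epsilon> n"
proof -
  define Cm where "Cm = Min (range C)"
  have Cm: "0 < Cm" "\<And>l. Cm \<le> C l" using C_pos by (auto simp: Cm_def)
  \<comment> \<open>The smallest slack of a noncritical link; the inserted \<open>1\<close> covers
    the case that all links are critical.\<close>
  define \<sigma> where "\<sigma> = Min (insert 1 ((\<lambda>l. C l - load R l) ` (- Ls)))"
  have \<sigma>: "0 < \<sigma>" "\<And>l. l \<notin> Ls \<Longrightarrow> \<sigma> \<le> C l - load R l"
    using load_R(2) by (auto simp: \<sigma>_def)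
  define c\<^sub>1 where "c\<^sub>1 = real CARD('l) / \<sigma> * C\<^sub>s + 1"
  define c\<^sub>2 where "c\<^sub>2 = (\<Sum>r\<in>UNIV. \<Sum>k<K r. A r k * (c\<^sub>1 / \<kappa> r)\<^sup>2)"
  define c\<^sub>3 where "c\<^sub>3 = (\<Sum>r\<in>(UNIV :: 'r set). real (K r))"
  have c1: "0 < c\<^sub>1" unfolding c\<^sub>1_def using \<sigma>(1) Cs_pos by (intro add_nonneg_pos) auto
  have c2: "0 \<le> c\<^sub>2" unfolding c\<^sub>2_def using A_pos by (intro sum_nonneg) (auto simp: less_imp_le)
  have c3: "0 \<le> c\<^sub>3" unfolding c\<^sub>3_def by (intro sum_nonneg) auto
  have \<rho>_le: "\<rho> r k \<le> C\<^sub>s" if "k < K r" for r k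
  proof -
    have "\<rho> r k \<le> R r"
      unfolding R_def using that \<rho>_pos by (intro member_le_sum) (auto simp: less_imp_le)
    then show ?thesis using R_le[of r] by simp
  qed
  have "dd n \<le> (c\<^sub>2 * c\<^sub>3 / Cm + 1) * N1 n * D2 \<epsilon> n"
    if n: "n \<in> X" and \<epsilon>: "0 \<le> \<epsilon>" "\<epsilon> \<le> 1" for \<epsilon> n
  proof -
    define e where "e = (\<Sum>r\<in>UNIV. \<Sum>k<K r. rs (p n) r * \<bar>dev \<epsilon> n r k\<bar>)"
    define M where "M = (\<Sum>l\<in>UNIV. p n l)"
    have M: "rs (p n) r \<le> M" for r
      unfolding rs_def M_def by (rule sum_mono2) (auto simp: p_nonneg n)
    have "Cm * M \<le> (\<Sum>l\<in>UNIV. p n l * C l)"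
      unfolding M_def sum_distrib_left
    proof (rule sum_mono)
      fix l show "Cm * p n l \<le> p n l * C l"
        using mult_left_mono[OF Cm(2) p_nonneg[OF n], of l l] by (simp add: mult.commute)
    qed
    also have "\<dots> \<le> N1 n" by (simp add: sum_multiplier_C[OF n] N1_def)
    finally have M_le: "M \<le> N1 n / Cm" using Cm(1) by (simp add: field_simps)
    have e_nonneg: "0 \<le> e"
      unfolding e_def by (intro sum_nonneg mult_nonneg_nonneg rs_nonneg n) auto
    have e_route: "rs (p n) r * \<bar>dev \<epsilon> n r k\<bar> \<le> e" if "k < K r" for r k
    proof -
      have "rs (p n) r * \<bar>dev \<epsilon> n r k\<bar> \<le> (\<Sum>k<K r. rs (p n) r * \<bar>dev \<epsilon> n r k\<bar>)"
        using that rs_nonneg[OF n] by (intro member_le_sum) auto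
      also have "\<dots> \<le> e"
        unfolding e_def
        by (rule member_le_sum[where f="\<lambda>r. \<Sum>k<K r. rs (p n) r * \<bar>dev \<epsilon> n r k\<bar>"])
           (auto intro!: sum_nonneg mult_nonneg_nonneg rs_nonneg[OF n])
      finally show ?thesis .
    qed
    \<comment> \<open>A positive multiplier means a saturated link, and a saturated noncritical link
      serves at least \<open>\<sigma>\<close> above its offered load. This excess is a service
      deviation.\<close>
    have nc: "p n l * \<sigma> \<le> e" if l: "l \<notin> Ls" for l
    proof -
      have "\<sigma> \<le> C l - (1 - \<epsilon>) * load R l"
      proof -
        have "0 \<le> load R l" unfolding link_load_def by (intro sum_nonneg) (simp add: R_pos less_imp_le)
        then have "(1 - \<epsilon>) * load R l \<le> 1 * load R l" using \<epsilon> by (intro mult_right_mono) auto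
        then show ?thesis using \<sigma>(2)[OF l] by simp
      qed
      then have "p n l * \<sigma> \<le> p n l * (C l - (1 - \<epsilon>) * load R l)"
        using p_nonneg[OF n] by (intro mult_left_mono) auto
      also have "\<dots> = p n l * load (\<lambda>r. \<Phi> n r - (1 - \<epsilon>) * R r) l"
        by (simp add: load_diff load_scale right_diff_distrib multiplier_load[OF n])
      also have "\<dots> \<le> (\<Sum>r | l \<in> route r. \<Sum>k<K r. rs (p n) r * \<bar>dev \<epsilon> n r k\<bar>)"
        unfolding link_load_def sum_distrib_left
      proof (rule sum_mono)
        fix r assume "r \<in> {r. l \<in> route r}"
        then have pl: "p n l \<le> rs (p n) r"
          unfolding rs_def using p_nonneg[OF n] by (intro member_le_sum) auto
        have "\<Phi> n r - (1 - \<epsilon>) * R r \<le> (\<Sum>k<K r. \<bar>dev \<epsilon> n r k\<bar>)"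
          unfolding sum_dev[symmetric] by (rule sum_mono) simp
        then have "p n l * (\<Phi> n r - (1 - \<epsilon>) * R r) \<le> p n l * (\<Sum>k<K r. \<bar>dev \<epsilon> n r k\<bar>)"
          using p_nonneg[OF n] by (intro mult_left_mono) auto
        also have "\<dots> \<le> rs (p n) r * (\<Sum>k<K r. \<bar>dev \<epsilon> n r k\<bar>)"
          using pl by (intro mult_right_mono sum_nonneg) auto
        finally show "p n l * (\<Phi> n r - (1 - \<epsilon>) * R r) \<le> (\<Sum>k<K r. rs (p n) r * \<bar>dev \<epsilon> n r k\<bar>)"
          by (simp add: sum_distrib_left)
      qed
      also have "\<dots> \<le> e"
        unfolding e_def by (rule sum_mono2) (auto intro!: sum_nonneg mult_nonneg_nonneg rs_nonneg[OF n])
      finally show ?thesis .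
    qed
    \<comment> \<open>The factor \<open>1 - \<epsilon>\<close> matches the centring of
      \<open>dev\<close>, so that the \<open>\<rho>\<close> terms of the critical links
      cancel.\<close>
    define q where "q l = (if l \<in> Ls then (1 - \<epsilon>) * p n l else 0)" for l
    have q: "cone q" using \<epsilon> p_nonneg[OF n] by (auto simp: cone_def q_def)
    have comp: "\<bar>re n r k - comb q r k\<bar> \<le> c\<^sub>1 / \<kappa> r * e" if k: "k < K r" for r k
    proof -
      define y where "y = (\<Sum>l\<in>route r. if l \<in> Ls then 0 else p n l)"
      have "(1 - \<epsilon>) * rs (p n) r = rs q r + (1 - \<epsilon>) * y"
        unfolding rs_def y_def q_def sum_distrib_left sum.distrib[symmetric] by (intro sum.cong refl) auto
      moreover have "\<kappa> r * re n r k = rs (p n) r * dev \<epsilon> n r k + \<rho> r k * ((1 - \<epsilon>) * rs (p n) r)"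
        using multiplier_phase[OF n k] by (simp add: re_def dev_def algebra_simps)
      ultimately have "\<kappa> r * re n r k = rs (p n) r * dev \<epsilon> n r k + \<rho> r k * (rs q r + (1 - \<epsilon>) * y)"
        by (simp only:)
      then have eq: "\<kappa> r * (re n r k - comb q r k) = rs (p n) r * dev \<epsilon> n r k + \<rho> r k * ((1 - \<epsilon>) * y)"
        using \<kappa>_pos[of r] by (simp add: comb_def algebra_simps)
      have y_nonneg: "0 \<le> y" unfolding y_def by (intro sum_nonneg) (simp add: p_nonneg n)
      have "y \<le> (\<Sum>l\<in>route r. e / \<sigma>)"
        unfolding y_def using nc \<sigma>(1) e_nonneg by (intro sum_mono) (auto simp: pos_le_divide_eq)
      also have "\<dots> \<le> real CARD('l) * (e / \<sigma>)"
        using e_nonneg \<sigma>(1) by (simp del: times_divide_eq_right) (intro mult_right_mono, auto intro: card_mono)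
      finally have y_le: "y \<le> real CARD('l) * (e / \<sigma>)" .
      have "\<rho> r k * ((1 - \<epsilon>) * y) \<le> C\<^sub>s * (1 * (real CARD('l) * (e / \<sigma>)))"
        using \<rho>_le[OF k] y_le y_nonneg \<epsilon> less_imp_le[OF \<rho>_pos[OF k]] less_imp_le[OF Cs_pos]
        by (intro mult_mono) auto
      moreover have "0 \<le> \<rho> r k * ((1 - \<epsilon>) * y)"
        using y_nonneg \<epsilon> less_imp_le[OF \<rho>_pos[OF k]] by simp
      moreover have "\<bar>rs (p n) r * dev \<epsilon> n r k\<bar> \<le> e"
        using e_route[OF k] rs_nonneg[OF n] by (simp add: abs_mult)
      ultimately have "\<bar>\<kappa> r * (re n r k - comb q r k)\<bar> \<le> C\<^sub>s * (real CARD('l) * (e / \<sigma>)) + e"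
        unfolding eq by (simp add: abs_le_iff)
      also have "\<dots> = c\<^sub>1 * e" by (simp add: c\<^sub>1_def algebra_simps)
      finally have "\<kappa> r * \<bar>re n r k - comb q r k\<bar> \<le> c\<^sub>1 * e"
        using \<kappa>_pos[of r] by (simp only: abs_mult abs_of_pos)
      then show ?thesis using \<kappa>_pos[of r] by (simp add: pos_le_divide_eq mult.commute)
    qed
    have "dd n \<le> ip (\<lambda>r k. re n r k - comb q r k) (\<lambda>r k. re n r k - comb q r k)"
      by (rule dd_le[OF q])
    also have "\<dots> \<le> (\<Sum>r\<in>UNIV. \<Sum>k<K r. A r k * (c\<^sub>1 / \<kappa> r)\<^sup>2 * e\<^sup>2)"
      unfolding ip_eq
    proof (intro sum_mono)
      fix r k assume k: "k \<in> {..<K r}"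
      have "(re n r k - comb q r k)\<^sup>2 \<le> (c\<^sub>1 / \<kappa> r * e)\<^sup>2"
        using power_mono[OF comp[of k r], of 2] k by simp
      then have "A r k * (re n r k - comb q r k)\<^sup>2 \<le> A r k * (c\<^sub>1 / \<kappa> r * e)\<^sup>2"
        using A_pos[of k r] k by (intro mult_left_mono) auto
      then show "A r k * (re n r k - comb q r k) * (re n r k - comb q r k) \<le> A r k * (c\<^sub>1 / \<kappa> r)\<^sup>2 * e\<^sup>2"
        by (simp only: power_mult_distrib power2_eq_square mult_ac)
    qed
    also have "\<dots> = c\<^sub>2 * e\<^sup>2" by (simp add: c\<^sub>2_def sum_distrib_right)
    finally have dd_e: "dd n \<le> c\<^sub>2 * e\<^sup>2" .
    \<comment> \<open>Cauchy-Schwarz with one square root of \<open>rs (p n)\<close> in each factor: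
      one sum is bounded by the total multiplier, the other is \<open>D2\<close>.\<close>
    have "e\<^sup>2 \<le> c\<^sub>3 * M * D2 \<epsilon> n"
    proof -
      let ?I = "SIGMA r:(UNIV::'r set). {..<K r}"
      let ?u = "\<lambda>(r, k::nat). sqrt (rs (p n) r)" and ?v = "\<lambda>(r, k). sqrt (rs (p n) r) * \<bar>dev \<epsilon> n r k\<bar>"
      have "(\<Sum>i\<in>?I. ?u i * ?v i)\<^sup>2 \<le> (\<Sum>i\<in>?I. (?u i)\<^sup>2) * (\<Sum>i\<in>?I. (?v i)\<^sup>2)"
        by (rule Cauchy_Schwarz_ineq_sum)
      also have "(\<Sum>i\<in>?I. ?u i * ?v i) = e"
        unfolding e_def by (subst sum.Sigma) (auto simp: rs_nonneg[OF n] mult.assoc[symmetric] intro!: sum.cong)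
      also have "(\<Sum>i\<in>?I. (?v i)\<^sup>2) = D2 \<epsilon> n"
        unfolding D2_def sum_distrib_left
        by (subst sum.Sigma) (auto simp: rs_nonneg[OF n] power_mult_distrib intro!: sum.cong)
      also have "(\<Sum>i\<in>?I. (?u i)\<^sup>2) = (\<Sum>r\<in>UNIV. real (K r) * rs (p n) r)"
      proof -
        have "(\<Sum>i\<in>?I. (?u i)\<^sup>2) = (\<Sum>r\<in>UNIV. \<Sum>k<K r. rs (p n) r)"
          by (subst sum.Sigma) (auto simp: rs_nonneg[OF n] intro!: sum.cong)
        then show ?thesis by simp
      qed
      also have "\<dots> * D2 \<epsilon> n \<le> c\<^sub>3 * M * D2 \<epsilon> n"
        using M unfolding c\<^sub>3_def sum_distrib_right
        by (intro mult_right_mono D2_nonneg n sum_mono mult_left_mono) auto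
      finally show ?thesis .
    qed
    also have "\<dots> \<le> c\<^sub>3 * (N1 n / Cm) * D2 \<epsilon> n"
      using M_le c3 D2_nonneg[OF n] by (intro mult_right_mono mult_left_mono) auto
    finally have "c\<^sub>2 * e\<^sup>2 \<le> c\<^sub>2 * (c\<^sub>3 * (N1 n / Cm) * D2 \<epsilon> n)"
      using c2 by (intro mult_left_mono) auto
    also have "\<dots> = c\<^sub>2 * c\<^sub>3 / Cm * (N1 n * D2 \<epsilon> n)" by simp
    also have "\<dots> \<le> (c\<^sub>2 * c\<^sub>3 / Cm + 1) * (N1 n * D2 \<epsilon> n)"
      using N1_ge[of n] D2_nonneg[OF n, of \<epsilon>] by (intro mult_right_mono) auto
    finally show ?thesis using dd_e by (simp add: mult.assoc)
  qed
  moreover have "0 < c\<^sub>2 * c\<^sub>3 / Cm + 1" using c2 c3 Cm by (intro add_nonneg_pos) auto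
  ultimately show thesis using that by blast
qed

text \<open>The state drifts inwards by about \<open>\<epsilon>\<close> times its weighted count,
  and subtracting the projected part gives back \<open>\<epsilon>\<close> times the count of the
  projection. These terms cancel up to a second-order term in \<open>\<epsilon>\<close> and
  \<open>\<epsilon> * wc (err n)\<close>, and the latter is absorbed by half of the gain from
  \<open>dd_le_D2\<close>.\<close>

lemma drift_err_le:
  obtains c\<^sub>1 c\<^sub>2 where "0 < c\<^sub>1" "0 < c\<^sub>2" "\<And>\<epsilon> n. n \<in> X \<Longrightarrow> 0 \<le> \<epsilon> \<Longrightarrow> \<epsilon> \<le> 1 \<Longrightarrow>
    drift \<epsilon> n (\<lambda>r k. A r k * err n r k) \<le> - c\<^sub>1 * (dd n / N1 n) + c\<^sub>2 * \<epsilon>\<^sup>2 * N1 n"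
proof -
  obtain a where a: "0 < a" "\<And>v. (wc v)\<^sup>2 \<le> a * ip v v"
    using lin_cauchy_schwarz unfolding wc_def by blast
  obtain b where b: "0 < b" "\<And>\<epsilon> n. n \<in> X \<Longrightarrow> 0 \<le> \<epsilon> \<Longrightarrow> \<epsilon> \<le> 1 \<Longrightarrow>
    drift \<epsilon> n (\<lambda>r k. A r k * re n r k) \<le> - b * D2 \<epsilon> n - (1 - \<epsilon>) * \<epsilon> * wc (re n)"
    using drift_self_le by blast
  obtain c where c: "0 < c" "\<And>\<epsilon> n. n \<in> X \<Longrightarrow> 0 \<le> \<epsilon> \<Longrightarrow> \<epsilon> \<le> 1 \<Longrightarrow> dd n \<le> c * N1 n * D2 \<epsilon> n"
    using dd_le_D2 by blast
  define g where "g = b / c"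
  have g: "0 < g" using b c by (simp add: g_def)
  have "drift \<epsilon> n (\<lambda>r k. A r k * err n r k) \<le> - (g / 2) * (dd n / N1 n) + (1 + a / (2 * g)) * \<epsilon>\<^sup>2 * N1 n"
    if n: "n \<in> X" and \<epsilon>: "0 \<le> \<epsilon>" "\<epsilon> \<le> 1" for \<epsilon> n
  proof -
    have N: "0 < N1 n" using N1_ge[of n] by simp
    have "drift \<epsilon> n (\<lambda>r k. A r k * err n r k)
        = drift \<epsilon> n (\<lambda>r k. A r k * re n r k) - drift \<epsilon> n (\<lambda>r k. A r k * comb (proj n) r k)"
      by (simp add: err_def right_diff_distrib drift_diff)
    moreover have "- drift \<epsilon> n (\<lambda>r k. A r k * comb (proj n) r k) \<le> \<epsilon> * wc (comb (proj n))"
      unfolding drift_comb wc_comb_cone[OF cone_proj] sum_negf[symmetric] sum_distrib_left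
    proof (rule sum_mono)
      fix l
      show "- (proj n l * ((1 - \<epsilon>) * load R l - load (\<Phi> n) l)) \<le> \<epsilon> * (proj n l * C l)"
      proof (cases "l \<in> Ls")
        case True
        then show ?thesis
          using mult_left_mono[OF load_\<Phi>_le[OF n], of "proj n l" l] cone_proj[of n]
          by (simp add: load_R cone_def algebra_simps)
      next
        case False
        then show ?thesis using cone_proj[of n] by (simp add: cone_def)
      qed
    qed
    moreover have "\<epsilon> * wc (comb (proj n)) = \<epsilon> * wc (re n) + - \<epsilon> * wc (err n)"
      by (simp add: err_def[abs_def] wc_diff algebra_simps)
    moreover have "g * (dd n / N1 n) \<le> b * D2 \<epsilon> n"
    proof -
      have "dd n / N1 n \<le> c * D2 \<epsilon> n" using c(2)[OF n \<epsilon>] N by (simp add: field_simps)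
      from mult_left_mono[OF this, of g] g show ?thesis using c(1) by (simp add: g_def)
    qed
    moreover have "- \<epsilon> * wc (err n) \<le> g / 2 * (dd n / N1 n) + a / (2 * g) * \<epsilon>\<^sup>2 * N1 n"
    proof -
      let ?P = "g / 2 * (dd n / N1 n)" and ?R = "a / (2 * g) * \<epsilon>\<^sup>2 * N1 n"
      have PR: "0 \<le> ?P" "0 \<le> ?R" using g N dd_nonneg[of n] a(1) by auto
      have "(- \<epsilon> * wc (err n))\<^sup>2 \<le> \<epsilon>\<^sup>2 * (a * dd n)"
        using mult_left_mono[OF a(2)[of "err n"], of "\<epsilon>\<^sup>2"] by (simp add: power_mult_distrib dd_def)
      also have "\<dots> = 4 * (?P * ?R)" using g N by simp
      also have "\<dots> \<le> (?P + ?R)\<^sup>2"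
        using sum_squares_ge_zero[of "?P - ?R" 0] by (simp add: power2_eq_square algebra_simps)
      finally show ?thesis using PR by (meson add_nonneg_nonneg power2_le_imp_le)
    qed
    moreover have "(1 - \<epsilon>) * \<epsilon> * wc (re n) = \<epsilon> * wc (re n) - \<epsilon>\<^sup>2 * wc (re n)"
      by (simp add: power2_eq_square algebra_simps)
    moreover have "\<epsilon>\<^sup>2 * wc (re n) \<le> \<epsilon>\<^sup>2 * N1 n" by (simp add: N1_def mult_left_mono)
    moreover have "(1 + a / (2 * g)) * \<epsilon>\<^sup>2 * N1 n = \<epsilon>\<^sup>2 * N1 n + a / (2 * g) * \<epsilon>\<^sup>2 * N1 n"
      by (simp add: algebra_simps)
    moreover have "- (g / 2) * (dd n / N1 n) = g / 2 * (dd n / N1 n) - g * (dd n / N1 n)" by simp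
    ultimately show ?thesis using b(2)[OF n \<epsilon>] by linarith
  qed
  moreover have "0 < 1 + a / (2 * g)" using a g by (intro add_pos_nonneg) auto
  ultimately show thesis using g by (intro that[of "g / 2" "1 + a / (2 * g)"]) auto
qed

text \<open>Foster's bound for the squared half distance: its drift has the negative term
  \<open>dd\<^sup>2 / N1\<close>. Two completed squares absorb the positive terms linear in
  \<open>dd\<close>, leaving \<open>\<epsilon> ^ 4 * N1 ^ 3\<close> and \<open>N1\<close>, both of
  mean at most of order \<open>1 / \<epsilon>\<close>.\<close>

lemma collapse:
  obtains c where "0 < c" "\<And>\<epsilon> D. stationary \<epsilon> D \<Longrightarrow> 0 < \<epsilon> \<Longrightarrow> \<epsilon> \<le> 1 / 2 \<Longrightarrow>
    integrable (measure_pmf D) (\<lambda>n. (dd n)\<^sup>2 / N1 n) \<and>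
    E D (\<lambda>n. (dd n)\<^sup>2 / N1 n) \<le> c / \<epsilon>"
proof -
  obtain c\<^sub>1 c\<^sub>2 where c1: "0 < c\<^sub>1" and c2: "0 < c\<^sub>2" and drift: "\<And>\<epsilon> n. n \<in> X \<Longrightarrow> 0 \<le> \<epsilon> \<Longrightarrow> \<epsilon> \<le> 1 \<Longrightarrow>
    drift \<epsilon> n (\<lambda>r k. A r k * err n r k) \<le> - c\<^sub>1 * (dd n / N1 n) + c\<^sub>2 * \<epsilon>\<^sup>2 * N1 n"
    using drift_err_le by blast
  obtain c\<^sub>3 where c3: "0 < c\<^sub>3" and mom: "\<And>\<epsilon> D. stationary \<epsilon> D \<Longrightarrow> 0 < \<epsilon> \<Longrightarrow> \<epsilon> \<le> 1 / 2 \<Longrightarrow>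
    integrable (measure_pmf D) (\<lambda>n. N1 n ^ 3) \<and> E D (\<lambda>n. N1 n ^ 3) \<le> c\<^sub>3 / \<epsilon> ^ 3 \<and>
    integrable (measure_pmf D) N1 \<and> E D N1 \<le> c\<^sub>3 / \<epsilon>"
    using moments by blast
  define b where "b = \<bar>Q\<bar> * (3 * A1)"
  define b' where "b' = \<bar>Q\<bar> * A1\<^sup>2"
  have b: "0 \<le> b" "0 \<le> b'" using A1_nonneg by (auto simp: b_def b'_def)
  define u where "u = c\<^sub>2\<^sup>2 / c\<^sub>1"
  define v where "v = b\<^sup>2 / c\<^sub>1 + b'"
  have uv: "0 \<le> u" "0 \<le> v" using c1 b by (auto simp: u_def v_def)
  have main: "G \<epsilon> (\<lambda>n. (dd n / 2)\<^sup>2) n \<le> (2 * u * \<epsilon> ^ 4 * N1 n ^ 3 + 2 * v * N1 n) - c\<^sub>1 / 2 * ((dd n)\<^sup>2 / N1 n)"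
    if n: "n \<in> X" and \<epsilon>: "0 < \<epsilon>" "\<epsilon> \<le> 1 / 2" for \<epsilon> n
  proof -
    have N: "0 < N1 n" "1 \<le> N1 n" using N1_ge[of n] by auto
    let ?d = "dd n" and ?N = "N1 n"
    have "G \<epsilon> (\<lambda>n. (dd n / 2)\<^sup>2) n
        \<le> ip (err n) (err n) * drift \<epsilon> n (\<lambda>r k. A r k * err n r k) + Q * (3 * A1 * ip (err n) (err n) + A1\<^sup>2)"
    proof (rule G_square_le)
      fix n'
      have "dd n' \<le> ip (\<lambda>r k. re n' r k - comb (proj n) r k) (\<lambda>r k. re n' r k - comb (proj n) r k)"
        by (rule dd_le[OF cone_proj])
      moreover have "(\<lambda>r k. re n' r k - comb (proj n) r k) = (\<lambda>r k. err n r k + (re n' r k - re n r k))"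
        by (simp add: err_def)
      ultimately show "(dd n' / 2)\<^sup>2 \<le> (ip (\<lambda>r k. err n r k + (re n' r k - re n r k))
          (\<lambda>r k. err n r k + (re n' r k - re n r k)) / 2)\<^sup>2"
        using dd_nonneg[of n'] by (intro power_mono) auto
    qed (use n \<epsilon> in \<open>auto simp: dd_def\<close>)
    also have "\<dots> \<le> ?d * (- c\<^sub>1 * (?d / ?N) + c\<^sub>2 * \<epsilon>\<^sup>2 * ?N) + \<bar>Q\<bar> * (3 * A1 * ?d + A1\<^sup>2)"
      unfolding dd_def[symmetric] using drift[OF n, of \<epsilon>] \<epsilon> dd_nonneg[of n] A1_nonneg
      by (intro add_mono mult_left_mono mult_right_mono) auto
    also have "\<dots> = - c\<^sub>1 * (?d\<^sup>2 / ?N) + ?d * (c\<^sub>2 * \<epsilon>\<^sup>2 * ?N) + ?d * b + b'"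
      by (simp add: b_def b'_def power2_eq_square algebra_simps)
    also have "?d * (c\<^sub>2 * \<epsilon>\<^sup>2 * ?N) \<le> c\<^sub>1 / 4 * (?d\<^sup>2 / ?N) + u * \<epsilon> ^ 4 * ?N ^ 3"
    proof -
      \<comment> \<open>Completing the square spends a quarter of the negative term; the next
        estimate spends another quarter in the same way.\<close>
      have "0 \<le> (c\<^sub>1 / 2 * ?d - c\<^sub>2 * \<epsilon>\<^sup>2 * ?N\<^sup>2)\<^sup>2 / (c\<^sub>1 * ?N)" using c1 N by simp
      also have "\<dots> = c\<^sub>1 / 4 * (?d\<^sup>2 / ?N) + u * \<epsilon> ^ 4 * ?N ^ 3 - ?d * (c\<^sub>2 * \<epsilon>\<^sup>2 * ?N)"
        using c1 N by (simp add: u_def field_simps power2_eq_square power3_eq_cube power4_eq_xxxx)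
      finally show ?thesis by simp
    qed
    also have "?d * b \<le> c\<^sub>1 / 4 * (?d\<^sup>2 / ?N) + b\<^sup>2 / c\<^sub>1 * ?N"
    proof -
      have "0 \<le> (c\<^sub>1 / 2 * ?d - b * ?N)\<^sup>2 / (c\<^sub>1 * ?N)" using c1 N by simp
      also have "\<dots> = c\<^sub>1 / 4 * (?d\<^sup>2 / ?N) + b\<^sup>2 / c\<^sub>1 * ?N - ?d * b"
        using c1 N by (simp add: field_simps power2_eq_square)
      finally show ?thesis by simp
    qed
    also have "b' \<le> b' * ?N" using b N mult_left_mono[of 1 ?N b'] by simp
    finally have "G \<epsilon> (\<lambda>n. (dd n / 2)\<^sup>2) n \<le> u * \<epsilon> ^ 4 * ?N ^ 3 + v * ?N - c\<^sub>1 / 2 * (?d\<^sup>2 / ?N)"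
      by (simp add: v_def distrib_right)
    moreover have "0 \<le> u * \<epsilon> ^ 4 * ?N ^ 3" "0 \<le> v * ?N" using uv N by auto
    ultimately show ?thesis by simp
  qed
  define h where "h \<epsilon> n = 2 * u * \<epsilon> ^ 4 * N1 n ^ 3 + 2 * v * N1 n" for \<epsilon> n
  have "integrable (measure_pmf D) (\<lambda>n. (dd n)\<^sup>2 / N1 n) \<and>
    E D (\<lambda>n. (dd n)\<^sup>2 / N1 n) \<le> (2 / c\<^sub>1 * (2 * u * c\<^sub>3 + 2 * v * c\<^sub>3) + 1) / \<epsilon>"
    if D: "stationary \<epsilon> D" and \<epsilon>: "0 < \<epsilon>" "\<epsilon> \<le> 1 / 2" for \<epsilon> D
  proof -
    note mo = mom[OF D \<epsilon>]
    define t where "t = c\<^sub>1 / 2"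
    have t: "0 < t" using c1 by (simp add: t_def)
    have h_int: "integrable (measure_pmf D) (h \<epsilon>)" using mo by (simp add: h_def[abs_def])
    have "integrable (measure_pmf D) (\<lambda>n. t * ((dd n)\<^sup>2 / N1 n)) \<and>
        E D (\<lambda>n. t * ((dd n)\<^sup>2 / N1 n)) \<le> E D (h \<epsilon>)"
    proof (rule stationary_foster[OF D _ h_int, where f="\<lambda>n. (dd n / 2)\<^sup>2"])
      fix n assume n: "n \<in> X"
      have N: "0 < N1 n" using N1_ge[of n] by simp
      show "0 \<le> (dd n / 2)\<^sup>2 \<and> 0 \<le> t * ((dd n)\<^sup>2 / N1 n) \<and> 0 \<le> h \<epsilon> n \<and>
          G \<epsilon> (\<lambda>n. (dd n / 2)\<^sup>2) n \<le> h \<epsilon> n - t * ((dd n)\<^sup>2 / N1 n)"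
        using main[OF n \<epsilon>] N t uv by (simp add: h_def t_def)
    qed
    then have int: "integrable (measure_pmf D) (\<lambda>n. (dd n)\<^sup>2 / N1 n)"
      and le: "t * E D (\<lambda>n. (dd n)\<^sup>2 / N1 n) \<le> E D (h \<epsilon>)"
      using t by (auto simp del: times_divide_eq_right)
    have "E D (h \<epsilon>) = 2 * u * \<epsilon> ^ 4 * E D (\<lambda>n. N1 n ^ 3)
        + 2 * v * E D N1"
      unfolding h_def using mo by simp
    also have "\<dots> \<le> 2 * u * \<epsilon> ^ 4 * (c\<^sub>3 / \<epsilon> ^ 3) + 2 * v * (c\<^sub>3 / \<epsilon>)"
      using mo uv by (intro add_mono mult_left_mono) auto
    also have "2 * u * \<epsilon> ^ 4 * (c\<^sub>3 / \<epsilon> ^ 3) \<le> 2 * u * (c\<^sub>3 / \<epsilon>)"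
    proof -
      have "\<epsilon> ^ 4 * (c\<^sub>3 / \<epsilon> ^ 3) = \<epsilon>\<^sup>2 * (c\<^sub>3 / \<epsilon>)"
        using \<epsilon> by (simp add: field_simps power2_eq_square power3_eq_cube power4_eq_xxxx)
      also have "\<dots> \<le> 1 * (c\<^sub>3 / \<epsilon>)"
        using \<epsilon> c3 by (intro mult_right_mono) (auto intro: power_le_one)
      finally show ?thesis using uv by (simp only: mult.assoc) (intro mult_left_mono, auto)
    qed
    finally have "t * E D (\<lambda>n. (dd n)\<^sup>2 / N1 n) \<le> (2 * u * c\<^sub>3 + 2 * v * c\<^sub>3) / \<epsilon>"
      using le by (simp add: add_divide_distrib)
    then have "E D (\<lambda>n. (dd n)\<^sup>2 / N1 n) \<le> (2 * u * c\<^sub>3 + 2 * v * c\<^sub>3) / \<epsilon> / t"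
      using t by (simp only: pos_le_divide_eq mult.commute)
    also have "\<dots> = (2 / c\<^sub>1 * (2 * u * c\<^sub>3 + 2 * v * c\<^sub>3)) / \<epsilon>" by (simp add: t_def)
    also have "\<dots> \<le> (2 / c\<^sub>1 * (2 * u * c\<^sub>3 + 2 * v * c\<^sub>3) + 1) / \<epsilon>"
      using \<epsilon> by (intro divide_right_mono) auto
    finally show ?thesis using int by blast
  qed
  moreover have "0 < 2 / c\<^sub>1 * (2 * u * c\<^sub>3 + 2 * v * c\<^sub>3) + 1"
    using c1 c3 uv by (intro add_nonneg_pos mult_nonneg_nonneg add_nonneg_nonneg) auto
  ultimately show thesis using that by blast
qed

section \<open>Exact identities in equilibrium\<close>

definition Ul :: "'r state \<Rightarrow> 'l \<Rightarrow> real" where "Ul n l = C l - load (\<Phi> n) l"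
definition Wl :: "'r state \<Rightarrow> 'l \<Rightarrow> real" where "Wl n l = lin (wl l) (re n)"
text \<open>Half the arrival rate times the second moment of the file size, since
  \<open>\<rho>\<close> and \<open>m\<close> each carry one inverse of \<open>- S\<close>.\<close>

definition w :: "'r \<Rightarrow> real" where "w r = (\<Sum>k<K r. \<rho> r k * m r k)"

lemma Ul_bounds: "n \<in> X \<Longrightarrow> 0 \<le> Ul n l" "n \<in> X \<Longrightarrow> Ul n l \<le> C\<^sub>s"
proof -
  assume n: "n \<in> X"
  show "0 \<le> Ul n l" using load_\<Phi>_le[OF n] by (simp add: Ul_def)
  have "0 \<le> load (\<Phi> n) l" unfolding link_load_def by (intro sum_nonneg \<Phi>_nonneg n)
  then show "Ul n l \<le> C\<^sub>s" using C_le_Cs[of l] by (simp add: Ul_def)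
qed

lemma Wl_nonneg: "0 \<le> Wl n l"
  unfolding Wl_def lin_def wl_def re_def using m_pos
  by (intro sum_nonneg mult_nonneg_nonneg) (auto simp: less_imp_le)

lemma w_pos: "0 < w r"
  unfolding w_def using K_pos[of r] m_pos \<rho>_pos by (intro sum_pos) auto

lemma lin_le_N1:
  obtains c where "0 < c" "\<And>n. \<bar>lin d (re n)\<bar> \<le> c * N1 n"
proof -
  obtain a where a: "0 < a" "\<And>v. (lin d v)\<^sup>2 \<le> a * ip v v"
    using lin_cauchy_schwarz by blast
  obtain b where b: "0 < b" "\<And>n. ip (re n) (re n) \<le> b * (wc (re n))\<^sup>2"
    using ip_le_wc by blast
  have "\<bar>lin d (re n)\<bar> \<le> sqrt (a * b) * N1 n" for n
  proof -
    have "(lin d (re n))\<^sup>2 \<le> a * (b * (wc (re n))\<^sup>2)"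
      by (rule order_trans[OF a(2) mult_left_mono[OF b(2) less_imp_le[OF a(1)]]])
    also have "\<dots> \<le> a * (b * (N1 n)\<^sup>2)"
      using a(1) b(1) wc_nonneg[of n] by (intro mult_left_mono power_mono) (auto simp: N1_def)
    also have "\<dots> = (sqrt (a * b) * N1 n)\<^sup>2"
      using a(1) b(1) by (simp add: power_mult_distrib)
    finally show ?thesis
      using a(1) b(1) N1_ge[of n] by (simp add: abs_le_square_iff[symmetric])
  qed
  with a b show thesis by (intro that[of "sqrt (a * b)"]) auto
qed

lemma Wl_le_N1:
  obtains c where "0 < c" "\<And>n l. Wl n l \<le> c * N1 n"
proof -
  have "\<forall>l. \<exists>c>0. \<forall>n. \<bar>Wl n l\<bar> \<le> c * N1 n"
    unfolding Wl_def by (meson lin_le_N1)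
  then obtain c where c: "\<And>l. 0 < c l" "\<And>l n. \<bar>Wl n l\<bar> \<le> c l * N1 n" by metis
  have "Wl n l \<le> (\<Sum>l\<in>UNIV. c l) * N1 n" for n l
  proof -
    have "c l \<le> (\<Sum>l\<in>UNIV. c l)" using c(1) by (intro member_le_sum) (auto simp: less_imp_le)
    then have "c l * N1 n \<le> (\<Sum>l\<in>UNIV. c l) * N1 n" using N1_ge[of n] by (intro mult_right_mono) auto
    with c(2)[of n l] show ?thesis by simp
  qed
  moreover have "0 < (\<Sum>l\<in>UNIV. c l)" using c(1) by (intro sum_pos) auto
  ultimately show thesis using that by blast
qed

lemma s_wl: "k < K r \<Longrightarrow> (\<Sum>j<K r. s r k j * wl l r j) = (if l \<in> route r then - 1 else 0)"
  by (simp add: wl_def s_m)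

lemma drift_wl: "drift \<epsilon> n (wl l) = (1 - \<epsilon>) * load R l - load (\<Phi> n) l"
proof -
  have "drift \<epsilon> n (wl l) = (\<Sum>r\<in>UNIV. if l \<in> route r then \<Sum>k<K r. dev \<epsilon> n r k * (\<Sum>j<K r. s r k j * m r j) else 0)"
    unfolding drift_def dev_def[symmetric] wl_def sum_distrib_left
    by (intro sum.cong refl) (simp add: mult.assoc)
  also have "\<dots> = (\<Sum>r\<in>UNIV. if l \<in> route r then (1 - \<epsilon>) * R r - \<Phi> n r else 0)"
    by (intro sum.cong refl) (simp add: s_m sum_negf sum_dev)
  also have "\<dots> = load (\<lambda>r. (1 - \<epsilon>) * R r - \<Phi> n r) l"
    unfolding link_load_def by (simp add: sum.inter_filter[symmetric])
  finally show ?thesis by (simp add: load_diff load_scale)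
qed

lemma drift_wl_critical: "l \<in> Ls \<Longrightarrow> drift \<epsilon> n (wl l) = Ul n l - \<epsilon> * C l"
  by (simp add: drift_wl load_R Ul_def algebra_simps)

lemma integrable_bounded:
  fixes f :: "'r state \<Rightarrow> real"
  assumes "stationary \<epsilon> D" "\<And>n. n \<in> X \<Longrightarrow> \<bar>f n\<bar> \<le> B"
  shows "integrable (measure_pmf D) f"
proof (rule measure_pmf.integrable_const_bound[where B=B])
  show "AE n in measure_pmf D. norm (f n) \<le> B"
    using stationary_AE[OF assms(1)] by eventually_elim (simp add: assms(2))
qed simp

lemma integrable_\<phi>:
  assumes "stationary \<epsilon> D" shows "integrable (measure_pmf D) (\<lambda>n. \<phi> n r k)"
proof (rule integrable_bounded[OF assms])
  fix n assume n: "n \<in> X"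
  show "\<bar>\<phi> n r k\<bar> \<le> C\<^sub>s"
  proof (cases "k < K r")
    case True
    then show ?thesis using n by (simp add: \<phi>_le \<phi>_nonneg)
  next
    case False
    then show ?thesis using n Cs_pos by (simp add: X_eq \<phi>_def)
  qed
qed

lemma integrable_Ul: "stationary \<epsilon> D \<Longrightarrow> integrable (measure_pmf D) (\<lambda>n. Ul n l)"
  by (rule integrable_bounded[where B="C\<^sub>s"]) (auto simp: Ul_bounds)

text \<open>For nonnegative coefficients this is the mean-zero generator on a nonnegative linear
  function. Both sides are linear in \<open>c\<close>, so the general case follows from positive and
  negative parts.\<close>

lemma expectation_drift:
  assumes D: "stationary \<epsilon> D" and N: "integrable (measure_pmf D) N1"
  shows "(\<Sum>r\<in>UNIV. \<Sum>k<K r. \<Sum>j<K r. (E D (\<lambda>n. \<phi> n r k) - (1 - \<epsilon>) * \<rho> r k) * s r k j * c r j) = 0"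
proof -
  define H where "H c = (\<Sum>r\<in>UNIV. \<Sum>k<K r. \<Sum>j<K r. (E D (\<lambda>n. \<phi> n r k) - (1 - \<epsilon>) * \<rho> r k) * s r k j * c r j)" for c
  have E_drift: "E D (\<lambda>n. drift \<epsilon> n c) = H c" for c
    unfolding drift_def H_def
    by (simp add: Bochner_Integration.integral_sum integrable_\<phi>[OF D])
  have H0: "H c = 0" if c: "\<And>r k. 0 \<le> c r k" for c
  proof -
    obtain b where b: "\<And>n. \<bar>lin c (re n)\<bar> \<le> b * N1 n" using lin_le_N1 by blast
    have "integrable (measure_pmf D) (\<lambda>n. lin c (re n))"
    proof (rule Bochner_Integration.integrable_bound)
      show "integrable (measure_pmf D) (\<lambda>n. b * N1 n)" using N by simp
      show "AE n in measure_pmf D. norm (lin c (re n)) \<le> norm (b * N1 n)"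
        using b by (intro AE_I2) (metis abs_ge_self order_trans real_norm_def)
    qed simp
    moreover have "0 \<le> lin c (re n)" for n
      unfolding lin_def re_def using c by (intro sum_nonneg) auto
    ultimately have "E D (G \<epsilon> (\<lambda>n. lin c (re n))) = 0"
      using stationary_gen[OF D] by blast
    moreover have "G \<epsilon> (\<lambda>n. lin c (re n)) = (\<lambda>n. drift \<epsilon> n c)"
      by (rule ext) (rule G_lin)
    ultimately show ?thesis by (simp add: E_drift)
  qed
  have "H c = H (\<lambda>r k. max 0 (c r k)) - H (\<lambda>r k. max 0 (- c r k))"
    unfolding H_def sum_subtractf[symmetric] right_diff_distrib[symmetric]
    by (intro sum.cong refl arg_cong2[where f="(*)"]) (auto simp: max_def)
  then show ?thesis using H0 by (simp add: H_def)
qed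

text \<open>The mean deviations \<open>v\<close> are annihilated by every test vector
  \<open>c\<close>. Choosing \<open>c = A v\<close> produces the coercive quadratic form, which
  forces \<open>v = 0\<close>.\<close>

lemma expectation_\<phi>:
  assumes D: "stationary \<epsilon> D" and N: "integrable (measure_pmf D) N1" and k: "k < K r"
  shows "E D (\<lambda>n. \<phi> n r k) = (1 - \<epsilon>) * \<rho> r k"
proof -
  define v where "v r k = E D (\<lambda>n. \<phi> n r k) - (1 - \<epsilon>) * \<rho> r k" for r k
  have "0 = (\<Sum>r\<in>UNIV. - (\<Sum>k<K r. \<Sum>j<K r. v r k * s r k j * (\<kappa> r * m r j / \<rho> r j * v r j)))"
    using expectation_drift[OF D N, of "\<lambda>r j. \<kappa> r * m r j / \<rho> r j * v r j"]
    by (simp add: v_def sum_negf)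
  moreover have "(\<Sum>r\<in>UNIV. c\<^sub>0 * (\<Sum>k<K r. (v r k)\<^sup>2))
      \<le> (\<Sum>r\<in>UNIV. - (\<Sum>k<K r. \<Sum>j<K r. v r k * s r k j * (\<kappa> r * m r j / \<rho> r j * v r j)))"
    by (rule sum_mono) (rule coercive)
  ultimately have "c\<^sub>0 * (\<Sum>r\<in>UNIV. \<Sum>k<K r. (v r k)\<^sup>2) \<le> 0"
    by (simp add: sum_distrib_left)
  then have "(\<Sum>r\<in>UNIV. \<Sum>k<K r. (v r k)\<^sup>2) \<le> 0"
    using c0_pos by (simp add: mult_le_0_iff)
  then have z: "(\<Sum>r\<in>UNIV. \<Sum>k<K r. (v r k)\<^sup>2) = 0"
    by (intro antisym sum_nonneg) auto
  have "\<forall>r\<in>UNIV. (\<Sum>k<K r. (v r k)\<^sup>2) = 0"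
    using z by (subst (asm) sum_nonneg_eq_0_iff) (auto intro: sum_nonneg)
  then have "(\<Sum>k<K r. (v r k)\<^sup>2) = 0" by simp
  then have "\<forall>k\<in>{..<K r}. (v r k)\<^sup>2 = 0"
    by (subst (asm) sum_nonneg_eq_0_iff) auto
  with k have "v r k = 0" by simp
  then show ?thesis by (simp add: v_def)
qed

text \<open>Rate conservation: mean service is \<open>1 - \<epsilon>\<close> times the critical
  load, and on a critical link that load equals the capacity.\<close>

lemma expectation_Ul:
  assumes D: "stationary \<epsilon> D" and N: "integrable (measure_pmf D) N1" and l: "l \<in> Ls"
  shows "E D (\<lambda>n. Ul n l) = \<epsilon> * C l"
proof -
  have "E D (\<lambda>n. Ul n l) = C l - (\<Sum>r | l \<in> route r. \<Sum>k<K r. E D (\<lambda>n. \<phi> n r k))"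
    unfolding Ul_def link_load_def \<Phi>_def
    by (simp add: Bochner_Integration.integral_sum integrable_\<phi>[OF D])
  also have "\<dots> = C l - (1 - \<epsilon>) * load R l"
    by (simp add: expectation_\<phi>[OF D N] link_load_def R_def sum_distrib_left)
  finally show ?thesis using l by (simp add: load_R algebra_simps)
qed

text \<open>The covariance of the workload increments enters only through its mean, which is explicit
  because it is linear in \<open>\<phi>\<close>.\<close>

lemma expectation_workload_product:
  assumes D: "stationary \<epsilon> D" and N3: "integrable (measure_pmf D) (\<lambda>n. N1 n ^ 3)"
    and N: "integrable (measure_pmf D) N1" and l: "l \<in> Ls" "l' \<in> Ls"
  shows "E D (\<lambda>n. Wl n l * (Ul n l' - \<epsilon> * C l') + Wl n l' * (Ul n l - \<epsilon> * C l))
    = - (2 * (1 - \<epsilon>) * (\<Sum>r | l \<in> route r \<and> l' \<in> route r. w r))"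
proof -
  let ?c = "wl l" and ?d = "wl l'"
  define \<Gamma> where "\<Gamma> n = (\<Sum>r\<in>UNIV. (\<Sum>k<K r. (1 - \<epsilon>) * lam r * a r k * (?c r k * ?d r k)) +
      (\<Sum>k<K r. \<Sum>j<K r. \<phi> n r k * s r k j * (?c r j * ?d r j - ?c r k * ?d r j - ?c r j * ?d r k)))" for n
  have \<Gamma>_int: "integrable (measure_pmf D) \<Gamma>"
    unfolding \<Gamma>_def by (simp add: integrable_\<phi>[OF D])
  obtain b where b: "0 < b" "\<And>n l. Wl n l \<le> b * N1 n" using Wl_le_N1 by blast
  \<comment> \<open>Second moments make the product of workloads integrable, as the mean-zero
    property requires.\<close>
  have "integrable (measure_pmf D) (\<lambda>n. Wl n l * Wl n l')"
  proof (rule integrable_N1_bound[OF N3 stationary_AE[OF D], where c="b\<^sup>2"])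
    fix n
    have "\<bar>Wl n l * Wl n l'\<bar> \<le> (b * N1 n) * (b * N1 n)"
      unfolding abs_mult using b Wl_nonneg N1_ge[of n] by (intro mult_mono) auto
    also have "\<dots> = b\<^sup>2 * N1 n ^ 2" by (simp add: power2_eq_square)
    also have "\<dots> \<le> b\<^sup>2 * N1 n ^ 3" using N1_power_le[of 2 3 n] by (intro mult_left_mono) auto
    finally show "\<bar>Wl n l * Wl n l'\<bar> \<le> b\<^sup>2 * N1 n ^ 3" .
  qed
  then have gen: "integrable (measure_pmf D) (G \<epsilon> (\<lambda>n. Wl n l * Wl n l'))" "E D (G \<epsilon> (\<lambda>n. Wl n l * Wl n l')) = 0"
    using stationary_gen[OF D, of "\<lambda>n. Wl n l * Wl n l'"] Wl_nonneg by auto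
  have G_eq': "G \<epsilon> (\<lambda>n. Wl n l * Wl n l') n
      = (Wl n l * (Ul n l' - \<epsilon> * C l') + Wl n l' * (Ul n l - \<epsilon> * C l)) + \<Gamma> n" for n
    unfolding Wl_def G_prod \<Gamma>_def by (simp add: drift_wl_critical l)
  have "E D (\<lambda>n. Wl n l * (Ul n l' - \<epsilon> * C l') + Wl n l' * (Ul n l - \<epsilon> * C l))
      = E D (\<lambda>n. G \<epsilon> (\<lambda>n. Wl n l * Wl n l') n - \<Gamma> n)"
    by (simp add: G_eq')
  also have "\<dots> = - E D \<Gamma>"
    using gen \<Gamma>_int by simp
  also have "E D \<Gamma> = (\<Sum>r\<in>UNIV. (\<Sum>k<K r. (1 - \<epsilon>) * lam r * a r k * (?c r k * ?d r k)) +
      (\<Sum>k<K r. \<Sum>j<K r. (1 - \<epsilon>) * \<rho> r k * s r k j * (?c r j * ?d r j - ?c r k * ?d r j - ?c r j * ?d r k)))"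
  proof -
    have "E D \<Gamma> = (\<Sum>r\<in>UNIV. (\<Sum>k<K r. (1 - \<epsilon>) * lam r * a r k * (?c r k * ?d r k)) +
      (\<Sum>k<K r. \<Sum>j<K r. E D (\<lambda>n. \<phi> n r k) * s r k j * (?c r j * ?d r j - ?c r k * ?d r j - ?c r j * ?d r k)))"
      unfolding \<Gamma>_def by (simp add: Bochner_Integration.integral_sum integrable_\<phi>[OF D])
    then show ?thesis by (simp add: expectation_\<phi>[OF D N])
  qed
  also have "\<dots> = (\<Sum>r\<in>UNIV. if l \<in> route r \<and> l' \<in> route r then 2 * (1 - \<epsilon>) * w r else 0)"
  proof (rule sum.cong[OF refl])
    fix r
    \<comment> \<open>\<open>arrival_sum\<close> makes the arrival term cancel the products with
      both indices \<open>j\<close>; the two mixed products remain, and \<open>s_wl\<close>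
      evaluates their inner sums.\<close>
    have "(\<Sum>k<K r. (1 - \<epsilon>) * lam r * a r k * (?c r k * ?d r k)) +
      (\<Sum>k<K r. \<Sum>j<K r. (1 - \<epsilon>) * \<rho> r k * s r k j * (?c r j * ?d r j - ?c r k * ?d r j - ?c r j * ?d r k))
      = - (\<Sum>k<K r. (1 - \<epsilon>) * \<rho> r k * (?c r k * (\<Sum>j<K r. s r k j * ?d r j) + ?d r k * (\<Sum>j<K r. s r k j * ?c r j)))"
      unfolding arrival_sum sum_distrib_left sum.distrib[symmetric] sum_negf[symmetric]
      by (intro sum.cong refl) (simp add: algebra_simps sum_distrib_left sum.distrib[symmetric] sum_subtractf[symmetric] sum_negf[symmetric])
    also have "\<dots> = (if l \<in> route r \<and> l' \<in> route r then 2 * (1 - \<epsilon>) * w r else 0)"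
    proof (cases "l \<in> route r \<and> l' \<in> route r")
      case True
      then have "- (\<Sum>k<K r. (1 - \<epsilon>) * \<rho> r k * (?c r k * (\<Sum>j<K r. s r k j * ?d r j) + ?d r k * (\<Sum>j<K r. s r k j * ?c r j)))
          = - (\<Sum>k<K r. - (2 * (1 - \<epsilon>) * (\<rho> r k * m r k)))"
        by (intro arg_cong[where f=uminus] sum.cong refl) (simp add: s_wl, simp add: wl_def)
      also have "\<dots> = 2 * (1 - \<epsilon>) * w r"
        by (simp add: sum_negf w_def sum_distrib_left)
      finally show ?thesis using True by simp
    next
      case False
      then have "- (\<Sum>k<K r. (1 - \<epsilon>) * \<rho> r k * (?c r k * (\<Sum>j<K r. s r k j * ?d r j) + ?d r k * (\<Sum>j<K r. s r k j * ?c r j))) = 0"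
        by (auto simp: s_wl wl_def)
      then show ?thesis by (simp only: if_not_P[OF False])
    qed
    finally show "(\<Sum>k<K r. (1 - \<epsilon>) * lam r * a r k * (?c r k * ?d r k)) +
      (\<Sum>k<K r. \<Sum>j<K r. (1 - \<epsilon>) * \<rho> r k * s r k j * (?c r j * ?d r j - ?c r k * ?d r j - ?c r j * ?d r k))
      = (if l \<in> route r \<and> l' \<in> route r then 2 * (1 - \<epsilon>) * w r else 0)" .
  qed
  also have "\<dots> = 2 * (1 - \<epsilon>) * (\<Sum>r | l \<in> route r \<and> l' \<in> route r. w r)"
    by (simp add: sum.inter_filter[symmetric] sum_distrib_left)
  finally show ?thesis by simp
qed

lemma integrable_workload_unused:
  assumes D: "stationary \<epsilon> D" and N: "integrable (measure_pmf D) N1" and \<epsilon>: "0 < \<epsilon>" "\<epsilon> \<le> 1"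
  shows "integrable (measure_pmf D) (\<lambda>n. Wl n l * (Ul n l' - \<epsilon> * C l'))"
proof -
  obtain b where b: "0 < b" "\<And>n l. Wl n l \<le> b * N1 n" using Wl_le_N1 by blast
  show ?thesis
  proof (rule Bochner_Integration.integrable_bound)
    show "integrable (measure_pmf D) (\<lambda>n. b * C\<^sub>s * N1 n)" using N by simp
    show "AE n in measure_pmf D. norm (Wl n l * (Ul n l' - \<epsilon> * C l')) \<le> norm (b * C\<^sub>s * N1 n)"
      using stationary_AE[OF D]
    proof eventually_elim
      case (elim n)
      have "\<epsilon> * C l' \<le> 1 * C\<^sub>s"
        using \<epsilon> C_le_Cs[of l'] C_pos[of l'] by (intro mult_mono) auto
      moreover have "0 \<le> \<epsilon> * C l'" using \<epsilon> C_pos[of l'] by simp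
      ultimately have "\<bar>Ul n l' - \<epsilon> * C l'\<bar> \<le> C\<^sub>s"
        using Ul_bounds[OF elim, of l'] by (simp add: abs_le_iff)
      then have "Wl n l * \<bar>Ul n l' - \<epsilon> * C l'\<bar> \<le> (b * N1 n) * C\<^sub>s"
        using b Wl_nonneg[of n l] N1_ge[of n] by (intro mult_mono) auto
      then show ?case
        using b Cs_pos N1_ge[of n] Wl_nonneg[of n l] by (simp add: abs_mult mult_ac)
    qed
  qed simp
qed

lemma workload_unused:
  obtains c where "0 < c" "\<And>\<epsilon> D l. stationary \<epsilon> D \<Longrightarrow> 0 < \<epsilon> \<Longrightarrow> \<epsilon> \<le> 1 / 2 \<Longrightarrow>
    l \<in> Ls \<Longrightarrow> E D (\<lambda>n. Ul n l * (\<Sum>l\<in>Ls. Wl n l)) \<le> c"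
proof -
  obtain c\<^sub>3 where c3: "0 < c\<^sub>3" and mom: "\<And>\<epsilon> D. stationary \<epsilon> D \<Longrightarrow> 0 < \<epsilon> \<Longrightarrow> \<epsilon> \<le> 1 / 2 \<Longrightarrow>
    integrable (measure_pmf D) (\<lambda>n. N1 n ^ 3) \<and> E D (\<lambda>n. N1 n ^ 3) \<le> c\<^sub>3 / \<epsilon> ^ 3 \<and>
    integrable (measure_pmf D) N1 \<and> E D N1 \<le> c\<^sub>3 / \<epsilon>"
    using moments by blast
  obtain b where b: "0 < b" "\<And>n l. Wl n l \<le> b * N1 n" using Wl_le_N1 by blast
  define L where "L = real (card Ls)"
  have "E D (\<lambda>n. Ul n l * (\<Sum>l\<in>Ls. Wl n l)) \<le> C\<^sub>s * (L * b * c\<^sub>3) + 1"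
    if D: "stationary \<epsilon> D" and \<epsilon>: "0 < \<epsilon>" "\<epsilon> \<le> 1 / 2" and l: "l \<in> Ls" for \<epsilon> D l
  proof -
    note mo = mom[OF D \<epsilon>]
    define S where "S n = (\<Sum>l\<in>Ls. Wl n l)" for n
    define T where "T n = (\<Sum>l\<in>Ls. Ul n l)" for n
    define c where "c = (\<Sum>l\<in>Ls. C l)"
    have c: "0 \<le> c" "c \<le> C\<^sub>s"
      unfolding c_def C\<^sub>s_def using C_pos by (auto intro!: sum_nonneg sum_mono2 simp: less_imp_le)
    have S: "0 \<le> S n" "S n \<le> L * b * N1 n" for n
    proof -
      show "0 \<le> S n" unfolding S_def by (intro sum_nonneg Wl_nonneg)
      have "S n \<le> (\<Sum>l\<in>Ls. b * N1 n)" unfolding S_def by (intro sum_mono b)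
      then show "S n \<le> L * b * N1 n" by (simp add: L_def)
    qed
    have ST: "S n * (T n - \<epsilon> * c) = (\<Sum>l\<in>Ls. \<Sum>l'\<in>Ls. Wl n l * (Ul n l' - \<epsilon> * C l'))" for n
    proof -
      have "T n - \<epsilon> * c = (\<Sum>l'\<in>Ls. Ul n l' - \<epsilon> * C l')"
        by (simp add: T_def c_def sum_distrib_left sum_subtractf)
      then show ?thesis by (simp only: S_def sum_product)
    qed
    have int_WU: "integrable (measure_pmf D) (\<lambda>n. Wl n l * (Ul n l' - \<epsilon> * C l'))" for l l'
      by (rule integrable_workload_unused) (use D mo \<epsilon> in auto)
    have int_S: "integrable (measure_pmf D) S"
    proof (rule Bochner_Integration.integrable_bound)
      show "integrable (measure_pmf D) (\<lambda>n. L * b * N1 n)" using mo by simp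
      show "AE n in measure_pmf D. norm (S n) \<le> norm (L * b * N1 n)"
        using S by (intro AE_I2) (metis abs_ge_self abs_of_nonneg order_trans real_norm_def)
    qed simp
    have int_ST: "integrable (measure_pmf D) (\<lambda>n. S n * (T n - \<epsilon> * c))"
      unfolding ST using int_WU by simp
    \<comment> \<open>The identities are symmetric in the two links, so the double sum counts every
      product twice.\<close>
    have "2 * E D (\<lambda>n. S n * (T n - \<epsilon> * c)) = E D (\<lambda>n. \<Sum>l\<in>Ls. \<Sum>l'\<in>Ls. Wl n l * (Ul n l' - \<epsilon> * C l') + Wl n l' * (Ul n l - \<epsilon> * C l))"
    proof -
      have "(\<Sum>l\<in>Ls. \<Sum>l'\<in>Ls. Wl n l * (Ul n l' - \<epsilon> * C l') + Wl n l' * (Ul n l - \<epsilon> * C l)) = 2 * (S n * (T n - \<epsilon> * c))" for n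
      proof -
        have "(\<Sum>l\<in>Ls. \<Sum>l'\<in>Ls. Wl n l' * (Ul n l - \<epsilon> * C l)) = (\<Sum>l\<in>Ls. \<Sum>l'\<in>Ls. Wl n l * (Ul n l' - \<epsilon> * C l'))"
          by (rule sum.swap)
        then show ?thesis by (simp only: sum.distrib ST)
      qed
      then show ?thesis by simp
    qed
    also have "\<dots> = (\<Sum>l\<in>Ls. \<Sum>l'\<in>Ls. E D (\<lambda>n. Wl n l * (Ul n l' - \<epsilon> * C l') + Wl n l' * (Ul n l - \<epsilon> * C l)))"
      using int_WU by (simp add: Bochner_Integration.integral_sum)
    also have "\<dots> \<le> 0"
    proof (intro sum_nonpos)
      fix l l' assume "l \<in> Ls" "l' \<in> Ls"
      moreover have "0 \<le> (\<Sum>r | l \<in> route r \<and> l' \<in> route r. w r)"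
        by (intro sum_nonneg less_imp_le w_pos)
      ultimately show "E D (\<lambda>n. Wl n l * (Ul n l' - \<epsilon> * C l') + Wl n l' * (Ul n l - \<epsilon> * C l)) \<le> 0"
        using mo \<epsilon> by (simp add: expectation_workload_product[OF D])
    qed
    finally have le0: "E D (\<lambda>n. S n * (T n - \<epsilon> * c)) \<le> 0" by simp
    have "E D (\<lambda>n. Ul n l * S n) \<le> E D (\<lambda>n. S n * (T n - \<epsilon> * c) + \<epsilon> * c * S n)"
    proof (rule integral_mono_AE)
      show "integrable (measure_pmf D) (\<lambda>n. S n * (T n - \<epsilon> * c) + \<epsilon> * c * S n)"
        using int_ST int_S by simp
      show "integrable (measure_pmf D) (\<lambda>n. Ul n l * S n)"
      proof (rule Bochner_Integration.integrable_bound)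
        show "integrable (measure_pmf D) (\<lambda>n. C\<^sub>s * S n)" using int_S by simp
        show "AE n in measure_pmf D. norm (Ul n l * S n) \<le> norm (C\<^sub>s * S n)"
          using stationary_AE[OF D]
          by eventually_elim (use Ul_bounds S(1) Cs_pos in \<open>auto simp: abs_mult intro!: mult_right_mono\<close>)
      qed simp
      show "AE n in measure_pmf D. Ul n l * S n \<le> S n * (T n - \<epsilon> * c) + \<epsilon> * c * S n"
        using stationary_AE[OF D]
      proof eventually_elim
        case (elim n)
        have "Ul n l \<le> T n"
          unfolding T_def using l Ul_bounds[OF elim] by (intro member_le_sum) auto
        then have "Ul n l * S n \<le> T n * S n" using S(1) by (intro mult_right_mono)
        then show ?case by (simp add: algebra_simps)
      qed
    qed
    also have "\<dots> = E D (\<lambda>n. S n * (T n - \<epsilon> * c)) + \<epsilon> * c * E D S"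
      using int_ST int_S by simp
    also have "\<dots> \<le> \<epsilon> * c * E D S" using le0 by simp
    also have "\<dots> \<le> \<epsilon> * c * (L * b * (c\<^sub>3 / \<epsilon>))"
    proof (rule mult_left_mono)
      have "E D S \<le> E D (\<lambda>n. L * b * N1 n)"
        using int_S mo S by (intro integral_mono) auto
      also have "\<dots> = L * b * E D N1" by simp
      also have "\<dots> \<le> L * b * (c\<^sub>3 / \<epsilon>)"
        using mo b(1) by (intro mult_left_mono) (auto simp: L_def)
      finally show "E D S \<le> L * b * (c\<^sub>3 / \<epsilon>)" .
    qed (use \<epsilon> c in auto)
    also have "\<dots> = c * (L * b * c\<^sub>3)" using \<epsilon> by simp
    also have "\<dots> \<le> C\<^sub>s * (L * b * c\<^sub>3)"
      using c b(1) c3 by (intro mult_right_mono) (auto simp: L_def)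
    finally show ?thesis unfolding S_def by simp
  qed
  moreover have "0 < C\<^sub>s * (L * b * c\<^sub>3) + 1"
    using Cs_pos b(1) c3 by (intro add_nonneg_pos) (auto simp: L_def)
  ultimately show thesis using that by blast
qed

section \<open>The heavy traffic limit\<close>

lemma rs_diff: "rs (\<lambda>l. y l - z l) r = rs y r - rs z r"
  by (simp add: rs_def sum_subtractf)

text \<open>An injective linear map between finite-dimensional spaces is bounded below. This is the
  quantitative form of the full row rank of the routing matrix.\<close>

lemma route_sums_bound:
  obtains c where "0 < c" "\<And>z l. \<bar>z l\<bar> \<le> c * (\<Sum>r\<in>UNIV. \<bar>rs z r\<bar>)"
proof -
  define f :: "real^'l \<Rightarrow> real^'r" where "f z = vec_lambda (\<lambda>r. rs (vec_nth z) r)" for z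
  have f_nth: "vec_nth (f z) r = (\<Sum>l\<in>route r. vec_nth z l)" for z r
    by (simp add: f_def rs_def)
  have lin_f: "linear f"
    by (intro linearI Finite_Cartesian_Product.vec_eq_iff[THEN iffD2] allI)
       (simp_all add: f_nth sum.distrib sum_distrib_left)
  have "inj f"
    unfolding linear_injective_0[OF lin_f]
  proof (intro allI impI)
    fix z :: "real^'l" assume fz: "f z = 0"
    have "(\<Sum>l\<in>route r. vec_nth z l) = 0" for r unfolding f_nth[symmetric] fz by simp
    then have "vec_nth z l = 0" for l by (rule route_sum_inj)
    then show "z = 0" by (intro Finite_Cartesian_Product.vec_eq_iff[THEN iffD2]) simp
  qed
  then obtain B where B: "0 < B" "\<And>z. B * norm z \<le> norm (f z)"
    using linear_inj_bounded_below_pos[OF lin_f] by blast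
  have "\<bar>z l\<bar> \<le> 1 / B * (\<Sum>r\<in>UNIV. \<bar>rs z r\<bar>)" for z l
  proof -
    have "B * \<bar>z l\<bar> \<le> B * norm (vec_lambda z :: real^'l)"
      using component_le_norm_cart[of "vec_lambda z :: real^'l" l] B(1) by simp
    also have "\<dots> \<le> norm (f (vec_lambda z))" by (rule B(2))
    also have "\<dots> \<le> (\<Sum>r\<in>UNIV. \<bar>vec_nth (f (vec_lambda z)) r\<bar>)" by (rule norm_le_l1_cart)
    also have "\<dots> = (\<Sum>r\<in>UNIV. \<bar>rs z r\<bar>)" by (simp add: f_def rs_def)
    finally show ?thesis using B(1) by (simp add: field_simps)
  qed
  with B(1) show thesis by (intro that[of "1 / B"]) auto
qed

text \<open>Strict concavity of the utility: the optimal multipliers are compared with those of the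
  projected state through \<open>\<Sum>r. (rs (p n) r - rs (proj n) r) * (\<Phi> n r - R r) \<ge> 0\<close>.\<close>

lemma projection_unused:
  obtains c where "0 < c" "\<And>n l \<eta>. n \<in> X \<Longrightarrow> 0 < \<eta> \<Longrightarrow> \<eta> \<le> 1 \<Longrightarrow>
    proj n l * Ul n l \<le> Ul n l * (\<eta> * (\<Sum>l\<in>Ls. Wl n l) + c / \<eta> * sqrt (dd n))"
proof -
  define Cm where "Cm = Min (range C)"
  have Cm: "0 < Cm" "\<And>l. Cm \<le> C l" using C_pos by (auto simp: Cm_def)
  define \<sigma> where "\<sigma> = Min (insert 1 ((\<lambda>l. C l - load R l) ` (- Ls)))"
  have \<sigma>: "0 < \<sigma>" "\<And>l. l \<notin> Ls \<Longrightarrow> \<sigma> \<le> C l - load R l"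
    using load_R(2) by (auto simp: \<sigma>_def)
  define Rm where "Rm = Min (range R)"
  have Rm: "0 < Rm" "\<And>r. Rm \<le> R r" using R_pos by (auto simp: Rm_def)
  \<comment> \<open>The error of the projection summed over the phases of a route and scaled by
    \<open>\<kappa> r\<close>; it is linear in \<open>err\<close>, hence at most a multiple of the
    distance.\<close>
  define \<delta> where "\<delta> n r = \<kappa> r * cnt n r - R r * rs (proj n) r" for n r
  obtain c\<^sub>1 where c1: "0 < c\<^sub>1" "\<And>n r. \<bar>\<delta> n r\<bar> \<le> c\<^sub>1 * sqrt (dd n)"
  proof -
    have "\<exists>c>0. \<forall>n. \<bar>\<delta> n r\<bar> \<le> c * sqrt (dd n)" for r
    proof -
      let ?d = "\<lambda>r' (k::nat). if r' = r then \<kappa> r else 0"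
      obtain c where c: "0 < c" "\<And>v. (lin ?d v)\<^sup>2 \<le> c * ip v v"
        using lin_cauchy_schwarz by blast
      have "\<bar>\<delta> n r\<bar> \<le> sqrt c * sqrt (dd n)" for n
      proof -
        have "lin ?d (err n) = (\<Sum>r'\<in>UNIV. if r' = r then \<Sum>k<K r. \<kappa> r * err n r k else 0)"
          unfolding lin_def by (intro sum.cong refl) auto
        also have "\<dots> = (\<Sum>k<K r. \<kappa> r * err n r k)" by simp
        also have "\<dots> = (\<Sum>k<K r. \<kappa> r * re n r k - \<rho> r k * rs (proj n) r)"
          using \<kappa>_pos[of r] by (intro sum.cong refl) (simp add: err_def comb_def field_simps)
        also have "\<dots> = \<delta> n r"
          by (simp add: \<delta>_def sum_subtractf cnt_def re_def R_def sum_distrib_left sum_distrib_right)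
        finally have "(\<delta> n r)\<^sup>2 \<le> c * dd n" using c(2)[of "err n"] by (simp add: dd_def)
        then show ?thesis by (metis real_sqrt_abs real_sqrt_le_mono real_sqrt_mult)
      qed
      with c(1) show ?thesis by (intro exI[of _ "sqrt c"]) auto
    qed
    then obtain c where c: "\<And>r. 0 < c r" "\<And>r n. \<bar>\<delta> n r\<bar> \<le> c r * sqrt (dd n)" by metis
    have "\<bar>\<delta> n r\<bar> \<le> (\<Sum>r\<in>UNIV. c r) * sqrt (dd n)" for n r
    proof -
      have "c r \<le> (\<Sum>r\<in>UNIV. c r)" using c(1) by (intro member_le_sum) (auto simp: less_imp_le)
      then have "c r * sqrt (dd n) \<le> (\<Sum>r\<in>UNIV. c r) * sqrt (dd n)"
        by (intro mult_right_mono) (auto simp: dd_nonneg)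
      with c(2)[of n r] show ?thesis by simp
    qed
    moreover have "0 < (\<Sum>r\<in>UNIV. c r)" using c(1) by (intro sum_pos) auto
    ultimately show ?thesis using that by blast
  qed
  obtain c\<^sub>2 where c2: "0 < c\<^sub>2" "\<And>z l. \<bar>z l\<bar> \<le> c\<^sub>2 * (\<Sum>r\<in>UNIV. \<bar>rs z r\<bar>)"
    using route_sums_bound by blast
  define mm where "mm = Min ((\<lambda>(r, k). m r k / \<kappa> r) ` (SIGMA r:UNIV. {..<K r}))"
  have fin: "finite (SIGMA r:(UNIV::'r set). {..<K r})" by (intro finite_SigmaI) auto
  have ne: "(SIGMA r:(UNIV::'r set). {..<K r}) \<noteq> {}" using K_pos by fastforce
  have mm: "0 < mm" "\<And>r k. k < K r \<Longrightarrow> mm \<le> m r k / \<kappa> r"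
    unfolding mm_def using fin ne m_pos \<kappa>_pos by (auto simp: Min_gr_iff intro!: Min_le)
  define nr where "nr = real CARD('r)"
  have nr: "0 < nr" by (simp add: nr_def)
  define c\<^sub>3 where "c\<^sub>3 = nr * (c\<^sub>1 * C\<^sub>s / Rm)"
  define c\<^sub>4 where "c\<^sub>4 = C\<^sub>s * c\<^sub>3"
  define c\<^sub>5 where "c\<^sub>5 = 1 / (mm * Cm) + c\<^sub>3 / \<sigma>"
  have cs: "0 < c\<^sub>3" "0 < c\<^sub>4" "0 < c\<^sub>5"
    using nr c1(1) Cs_pos Rm(1) mm(1) Cm(1) \<sigma>(1) by (auto simp: c\<^sub>3_def c\<^sub>4_def c\<^sub>5_def add_pos_pos)
  define c\<^sub>6 where "c\<^sub>6 = c\<^sub>2 * nr / Rm"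
  define c\<^sub>7 where "c\<^sub>7 = c\<^sub>6\<^sup>2 * (c\<^sub>5 * c\<^sub>4)"
  have cs': "0 < c\<^sub>6" "0 < c\<^sub>7" using cs c2(1) nr Rm(1) by (auto simp: c\<^sub>6_def c\<^sub>7_def)
  have "proj n l * Ul n l \<le> Ul n l * (\<eta> * (\<Sum>l\<in>Ls. Wl n l) + (c\<^sub>6 * c\<^sub>1 + 1 + c\<^sub>7) / \<eta> * sqrt (dd n))"
    if n: "n \<in> X" and \<eta>: "0 < \<eta>" "\<eta> \<le> 1" for n l \<eta>
  proof (cases "Ul n l = 0")
    case False
    define q where "q = proj n"
    have q: "\<And>l. 0 \<le> q l" "\<And>l. l \<notin> Ls \<Longrightarrow> q l = 0"
      using cone_proj[of n] by (auto simp: cone_def q_def)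
    define d where "d = sqrt (dd n)"
    have d: "0 \<le> d" by (simp add: d_def dd_nonneg)
    define S where "S = (\<Sum>l\<in>Ls. Wl n l)"
    have S: "0 \<le> S" unfolding S_def by (intro sum_nonneg Wl_nonneg)
    define P where "P r = rs (p n) r" for r
    have P: "0 \<le> P r" for r unfolding P_def by (rule rs_nonneg[OF n])
    define y where "y r = \<Phi> n r - R r" for r
    define v where "v r = P r - rs q r" for r
    have y: "\<bar>y r\<bar> \<le> C\<^sub>s" for r
      using \<Phi>_le[OF n, of r] R_le[of r] \<Phi>_nonneg[OF n, of r] R_pos[of r] by (simp add: y_def abs_le_iff)
    \<comment> \<open>From \<open>\<kappa> r * cnt n r = P r * \<Phi> n r\<close> with
      \<open>\<Phi> n r\<close> written as \<open>R r + y r\<close>.\<close>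
    have \<delta>_eq: "R r * v r = \<delta> n r - P r * y r" for r
      using multiplier_route[OF n, of r] by (simp add: v_def y_def \<delta>_def q_def P_def algebra_simps)
    have nc_sum: "(\<Sum>l\<in>UNIV. if l \<in> Ls then 0 else p n l * \<sigma>) \<le> (\<Sum>r\<in>UNIV. v r * y r)"
    proof -
      have "(\<Sum>r\<in>UNIV. v r * y r) = (\<Sum>l\<in>UNIV. (p n l - q l) * (load (\<Phi> n) l - load R l))"
        unfolding v_def P_def y_def rs_diff[symmetric] sum_rs by (simp add: load_diff)
      moreover have "(if l \<in> Ls then 0 else p n l * \<sigma>) \<le> (p n l - q l) * (load (\<Phi> n) l - load R l)" for l
      proof (cases "l \<in> Ls")
        case True
        have "(p n l - q l) * (load (\<Phi> n) l - load R l) = q l * (C l - load (\<Phi> n) l)"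
          using multiplier_load[OF n, of l] True by (simp add: load_R algebra_simps)
        also have "\<dots> \<ge> 0" using q(1) load_\<Phi>_le[OF n, of l] by simp
        finally show ?thesis using True by simp
      next
        case False
        have "p n l * \<sigma> \<le> p n l * (C l - load R l)"
          using \<sigma>(2)[OF False] p_nonneg[OF n] by (intro mult_left_mono) auto
        then show ?thesis
          unfolding q(2)[OF False] diff_zero right_diff_distrib multiplier_load[OF n] using False by simp
      qed
      ultimately show ?thesis by (simp add: sum_mono)
    qed
    \<comment> \<open>Substituting \<open>\<delta>_eq\<close> for \<open>v r\<close> exposes the
      negative square of \<open>y r\<close>. With the lower bound from \<open>nc_sum\<close>, all
      these squares and the noncritical multipliers are of order \<open>d\<close>.\<close>
    have vy: "v r * y r \<le> c\<^sub>1 * C\<^sub>s / Rm * d - P r * (y r)\<^sup>2 / C\<^sub>s" for r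
    proof -
      have "R r * v r * y r = \<delta> n r * y r - P r * (y r)\<^sup>2"
        unfolding \<delta>_eq by (simp add: left_diff_distrib power2_eq_square)
      then have "v r * y r = (\<delta> n r * y r - P r * (y r)\<^sup>2) / R r"
        using R_pos[of r] by (simp add: field_simps)
      also have "\<dots> = \<delta> n r * y r / R r - P r * (y r)\<^sup>2 / R r" by (simp add: diff_divide_distrib)
      also have "\<dots> \<le> c\<^sub>1 * C\<^sub>s / Rm * d - P r * (y r)\<^sup>2 / C\<^sub>s"
      proof (rule diff_mono)
        have "\<delta> n r * y r \<le> \<bar>\<delta> n r\<bar> * \<bar>y r\<bar>" by (simp add: abs_mult[symmetric])
        also have "\<dots> \<le> (c\<^sub>1 * d) * C\<^sub>s"
          using c1 y[of r] d by (intro mult_mono) (auto simp: d_def)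
        finally have "\<delta> n r * y r / R r \<le> (c\<^sub>1 * d) * C\<^sub>s / R r"
          using R_pos[of r] by (intro divide_right_mono) auto
        also have "\<dots> \<le> (c\<^sub>1 * d) * C\<^sub>s / Rm"
          using Rm c1(1) d Cs_pos R_pos[of r] by (intro divide_left_mono) auto
        finally show "\<delta> n r * y r / R r \<le> c\<^sub>1 * C\<^sub>s / Rm * d" by (simp add: mult_ac)
        show "P r * (y r)\<^sup>2 / C\<^sub>s \<le> P r * (y r)\<^sup>2 / R r"
          using R_le[of r] R_pos[of r] P[of r] Cs_pos by (intro divide_left_mono) auto
      qed
      finally show ?thesis .
    qed
    have sums: "(\<Sum>l\<in>UNIV. if l \<in> Ls then 0 else p n l * \<sigma>) + (\<Sum>r\<in>UNIV. P r * (y r)\<^sup>2 / C\<^sub>s) \<le> c\<^sub>3 * d"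
    proof -
      have "(\<Sum>r\<in>UNIV. v r * y r) \<le> (\<Sum>r\<in>(UNIV::'r set). c\<^sub>1 * C\<^sub>s / Rm * d) - (\<Sum>r\<in>UNIV. P r * (y r)\<^sup>2 / C\<^sub>s)"
        unfolding sum_subtractf[symmetric] by (intro sum_mono vy)
      also have "(\<Sum>r\<in>(UNIV::'r set). c\<^sub>1 * C\<^sub>s / Rm * d) = c\<^sub>3 * d" by (simp add: c\<^sub>3_def nr_def)
      finally show ?thesis using nc_sum by simp
    qed
    have pos1: "0 \<le> (\<Sum>r\<in>UNIV. P r * (y r)\<^sup>2 / C\<^sub>s)"
      using P Cs_pos by (intro sum_nonneg) auto
    have pos2: "0 \<le> (\<Sum>l\<in>UNIV. if l \<in> Ls then 0 else p n l * \<sigma>)"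
      using p_nonneg[OF n] \<sigma>(1) by (intro sum_nonneg) auto
    have Py: "P r * (y r)\<^sup>2 \<le> c\<^sub>4 * d" for r
    proof -
      have "P r * (y r)\<^sup>2 / C\<^sub>s \<le> (\<Sum>r\<in>UNIV. P r * (y r)\<^sup>2 / C\<^sub>s)"
        using P Cs_pos by (intro member_le_sum[where f="\<lambda>r. P r * (y r)\<^sup>2 / C\<^sub>s"]) auto
      also have "\<dots> \<le> c\<^sub>3 * d" using sums pos2 by simp
      finally show ?thesis using Cs_pos by (simp add: c\<^sub>4_def field_simps)
    qed
    define M where "M = (\<Sum>l\<in>UNIV. p n l)"
    have PM: "P r \<le> M" for r
      unfolding P_def rs_def M_def by (rule sum_mono2) (auto simp: p_nonneg n)
    have M_le: "M \<le> c\<^sub>5 * (S + d)"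
    proof -
      have crit: "p n l \<le> Wl n l / (mm * Cm)" if "l \<in> Ls" for l
      proof -
        have "Cm * p n l \<le> p n l * load (\<Phi> n) l"
          unfolding multiplier_load[OF n] using mult_left_mono[OF Cm(2) p_nonneg[OF n], of l l]
          by (simp add: mult.commute)
        also have "\<dots> = (\<Sum>r | l \<in> route r. p n l * \<Phi> n r)"
          by (simp add: link_load_def sum_distrib_left)
        also have "\<dots> \<le> (\<Sum>r | l \<in> route r. (\<Sum>k<K r. m r k * re n r k) / mm)"
        proof (rule sum_mono)
          fix r assume "r \<in> {r. l \<in> route r}"
          then have "p n l \<le> rs (p n) r"
            unfolding rs_def using p_nonneg[OF n] by (intro member_le_sum) auto
          then have "p n l * \<Phi> n r \<le> rs (p n) r * \<Phi> n r"
            using \<Phi>_nonneg[OF n] by (intro mult_right_mono)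
          also have "\<dots> = (\<Sum>k<K r. \<kappa> r * re n r k)"
            using multiplier_route[OF n, of r] by (simp add: mult.commute cnt_def re_def sum_distrib_left)
          also have "\<dots> \<le> (\<Sum>k<K r. m r k * re n r k / mm)"
          proof (rule sum_mono)
            fix k assume "k \<in> {..<K r}"
            then have "mm * \<kappa> r \<le> m r k" using mm(2)[of k r] \<kappa>_pos[of r] by (simp add: field_simps)
            then have "mm * \<kappa> r * re n r k \<le> m r k * re n r k" by (intro mult_right_mono) (auto simp: re_def)
            then show "\<kappa> r * re n r k \<le> m r k * re n r k / mm" using mm(1) by (simp add: field_simps)
          qed
          finally show "p n l * \<Phi> n r \<le> (\<Sum>k<K r. m r k * re n r k) / mm" by (simp add: sum_divide_distrib)
        qed
        also have "\<dots> = Wl n l / mm"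
          by (simp add: Wl_def lin_wl link_load_def sum_divide_distrib)
        finally show ?thesis using Cm(1) mm(1) by (simp add: field_simps)
      qed
      have "M = (\<Sum>l\<in>UNIV. if l \<in> Ls then p n l else 0) + (\<Sum>l\<in>UNIV. if l \<in> Ls then 0 else p n l * \<sigma>) / \<sigma>"
        unfolding M_def sum_divide_distrib sum.distrib[symmetric]
        using \<sigma>(1) by (intro sum.cong refl) auto
      also have "(\<Sum>l\<in>UNIV. if l \<in> Ls then p n l else 0) = (\<Sum>l\<in>Ls. p n l)"
        by (intro sum.mono_neutral_cong_right) auto
      also have "\<dots> \<le> (\<Sum>l\<in>Ls. Wl n l / (mm * Cm))" by (rule sum_mono) (rule crit)
      also have "\<dots> = S / (mm * Cm)" by (simp add: S_def sum_divide_distrib)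
      also have "(\<Sum>l\<in>UNIV. if l \<in> Ls then 0 else p n l * \<sigma>) / \<sigma> \<le> c\<^sub>3 * d / \<sigma>"
        using sums pos1 \<sigma>(1) by (intro divide_right_mono) auto
      also have "S / (mm * Cm) + c\<^sub>3 * d / \<sigma> \<le> c\<^sub>5 * (S + d)"
      proof -
        have "c\<^sub>5 * (S + d) = S / (mm * Cm) + c\<^sub>3 * d / \<sigma> + (d / (mm * Cm) + c\<^sub>3 / \<sigma> * S)"
          by (simp add: c\<^sub>5_def algebra_simps add_divide_distrib)
        moreover have "0 \<le> d / (mm * Cm) + c\<^sub>3 / \<sigma> * S" using d S cs mm(1) Cm(1) \<sigma>(1) by simp
        ultimately show ?thesis by simp
      qed
      finally show ?thesis by simp
    qed
    \<comment> \<open>The bound on \<open>P r\<close> itself, of order \<open>S + d\<close>, is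
      combined with the bound on \<open>P r\<close> times the square of \<open>y r\<close>, of order
      \<open>d\<close>; their product is the square of the left side.\<close>
    have Py': "P r * \<bar>y r\<bar> \<le> sqrt (c\<^sub>5 * c\<^sub>4 * (S + d) * d)" for r
    proof (rule real_le_rsqrt)
      have "(P r * \<bar>y r\<bar>)\<^sup>2 = P r * (P r * (y r)\<^sup>2)" by (simp add: power2_eq_square)
      also have "\<dots> \<le> (c\<^sub>5 * (S + d)) * (c\<^sub>4 * d)"
        by (rule mult_mono) (use order_trans[OF PM M_le, of r] Py[of r] P[of r] cs S d in auto)
      finally show "(P r * \<bar>y r\<bar>)\<^sup>2 \<le> c\<^sub>5 * c\<^sub>4 * (S + d) * d" by (simp add: mult_ac)
    qed
    have "\<bar>v r\<bar> \<le> (c\<^sub>1 * d + sqrt (c\<^sub>5 * c\<^sub>4 * (S + d) * d)) / Rm" for r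
    proof -
      have "R r * \<bar>v r\<bar> = \<bar>\<delta> n r - P r * y r\<bar>"
        using R_pos[of r] by (simp add: \<delta>_eq[symmetric] abs_mult)
      also have "\<dots> \<le> \<bar>\<delta> n r\<bar> + P r * \<bar>y r\<bar>"
        using P[of r] abs_triangle_ineq4[of "\<delta> n r" "P r * y r"] by (simp add: abs_mult)
      also have "\<dots> \<le> c\<^sub>1 * d + sqrt (c\<^sub>5 * c\<^sub>4 * (S + d) * d)"
        using c1(2)[of n r] Py'[of r] by (simp add: d_def)
      finally have "R r * \<bar>v r\<bar> \<le> c\<^sub>1 * d + sqrt (c\<^sub>5 * c\<^sub>4 * (S + d) * d)" .
      moreover have "Rm * \<bar>v r\<bar> \<le> R r * \<bar>v r\<bar>" using Rm(2) by (intro mult_right_mono) auto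
      ultimately show ?thesis using Rm(1) by (simp add: field_simps)
    qed
    then have "(\<Sum>r\<in>UNIV. \<bar>v r\<bar>) \<le> (\<Sum>r\<in>(UNIV::'r set). (c\<^sub>1 * d + sqrt (c\<^sub>5 * c\<^sub>4 * (S + d) * d)) / Rm)"
      by (intro sum_mono)
    then have sum_v: "(\<Sum>r\<in>UNIV. \<bar>v r\<bar>) \<le> nr * ((c\<^sub>1 * d + sqrt (c\<^sub>5 * c\<^sub>4 * (S + d) * d)) / Rm)"
      by (simp add: nr_def)
    \<comment> \<open>An unsaturated link has multiplier 0, so its projected multiplier is a pure
      difference, controlled by the route differences \<open>v\<close>.\<close>
    have "p n l = 0" using multiplier_slack[OF n, of l] False by (simp add: Ul_def)
    then have "q l = \<bar>(\<lambda>l. p n l - q l) l\<bar>" using q(1) by simp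
    also have "\<dots> \<le> c\<^sub>2 * (\<Sum>r\<in>UNIV. \<bar>rs (\<lambda>l. p n l - q l) r\<bar>)" by (rule c2(2))
    also have "\<dots> = c\<^sub>2 * (\<Sum>r\<in>UNIV. \<bar>v r\<bar>)" by (simp add: rs_diff v_def P_def)
    also have "\<dots> \<le> c\<^sub>2 * (nr * ((c\<^sub>1 * d + sqrt (c\<^sub>5 * c\<^sub>4 * (S + d) * d)) / Rm))"
      using sum_v c2(1) by (intro mult_left_mono) auto
    also have "\<dots> = c\<^sub>6 * c\<^sub>1 * d + c\<^sub>6 * sqrt (c\<^sub>5 * c\<^sub>4 * (S + d) * d)"
      by (simp add: c\<^sub>6_def algebra_simps add_divide_distrib)
    also have "c\<^sub>6 * sqrt (c\<^sub>5 * c\<^sub>4 * (S + d) * d) = sqrt (c\<^sub>7 * (S + d) * d)"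
      using cs'(1) by (simp add: c\<^sub>7_def real_sqrt_mult mult.assoc)
    \<comment> \<open>The geometric mean of \<open>S + d\<close> and \<open>d\<close> is split with
      the free weight \<open>\<eta>\<close>, so that the large factor \<open>S\<close> receives a
      small coefficient.\<close>
    also have "\<dots> \<le> \<eta> * (S + d) + c\<^sub>7 / \<eta> * d"
    proof (rule real_le_lsqrt)
      show "0 \<le> \<eta> * (S + d) + c\<^sub>7 / \<eta> * d"
        using \<eta> S d cs' by (intro add_nonneg_nonneg mult_nonneg_nonneg) auto
      have "c\<^sub>7 * (S + d) * d = (\<eta> * (S + d)) * (c\<^sub>7 / \<eta> * d)" using \<eta> by simp
      also have "\<dots> \<le> (\<eta> * (S + d) + c\<^sub>7 / \<eta> * d)\<^sup>2"
      proof -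
        have "a * b \<le> (a + b)\<^sup>2" if "0 \<le> a" "0 \<le> b" for a b :: real
          using that by (simp add: power2_sum)
        moreover have "0 \<le> \<eta> * (S + d)" "0 \<le> c\<^sub>7 / \<eta> * d" using \<eta> S d cs' by auto
        ultimately show ?thesis by blast
      qed
      finally show "c\<^sub>7 * (S + d) * d \<le> (\<eta> * (S + d) + c\<^sub>7 / \<eta> * d)\<^sup>2" .
    qed
    finally have "q l \<le> \<eta> * S + (c\<^sub>6 * c\<^sub>1 + \<eta> + c\<^sub>7 / \<eta>) * d"
      by (simp add: algebra_simps)
    also have "(c\<^sub>6 * c\<^sub>1 + \<eta> + c\<^sub>7 / \<eta>) * d \<le> (c\<^sub>6 * c\<^sub>1 + 1 + c\<^sub>7) / \<eta> * d"
    proof (rule mult_right_mono[OF _ d])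
      have "c\<^sub>6 * c\<^sub>1 * \<eta> \<le> c\<^sub>6 * c\<^sub>1 * 1" using \<eta> cs' c1(1) by (intro mult_left_mono) auto
      moreover have "\<eta> * \<eta> \<le> 1 * 1" using \<eta> by (intro mult_mono) auto
      ultimately have "(c\<^sub>6 * c\<^sub>1 + \<eta> + c\<^sub>7 / \<eta>) * \<eta> \<le> c\<^sub>6 * c\<^sub>1 + 1 + c\<^sub>7"
        using \<eta> by (simp add: algebra_simps)
      then show "c\<^sub>6 * c\<^sub>1 + \<eta> + c\<^sub>7 / \<eta> \<le> (c\<^sub>6 * c\<^sub>1 + 1 + c\<^sub>7) / \<eta>"
        using \<eta> by (simp only: pos_le_divide_eq)
    qed
    finally have "q l \<le> \<eta> * S + (c\<^sub>6 * c\<^sub>1 + 1 + c\<^sub>7) / \<eta> * d" by simp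
    from mult_left_mono[OF this Ul_bounds(1)[OF n, of l]] show ?thesis
      by (simp only: S_def d_def q_def mult.commute)
  qed simp
  moreover have "0 < c\<^sub>6 * c\<^sub>1 + 1 + c\<^sub>7" using cs' c1(1) by (intro add_pos_pos) auto
  ultimately show thesis using that by blast
qed

section \<open>The Gram matrix of the critical workloads and its trace identity\<close>

definition B :: "'l \<Rightarrow> 'l \<Rightarrow> real" where
  "B l l' = (\<Sum>r | l \<in> route r \<and> l' \<in> route r. w r / \<kappa> r)"

lemma B_form:
  "(\<Sum>l\<in>Ls. \<Sum>l'\<in>Ls. z l * (B l l' * z l')) = (\<Sum>r\<in>UNIV. w r / \<kappa> r * (\<Sum>l\<in>route r \<inter> Ls. z l)\<^sup>2)"
proof -
  have "(\<Sum>l\<in>Ls. \<Sum>l'\<in>Ls. z l * (B l l' * z l'))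
      = (\<Sum>l\<in>Ls. \<Sum>l'\<in>Ls. \<Sum>r\<in>UNIV. w r / \<kappa> r * ((if l \<in> route r then z l else 0) * (if l' \<in> route r then z l' else 0)))"
    unfolding B_def sum_distrib_left sum_distrib_right
    by (intro sum.cong refl sum.mono_neutral_cong_left) auto
  also have "\<dots> = (\<Sum>r\<in>UNIV. \<Sum>l\<in>Ls. \<Sum>l'\<in>Ls. w r / \<kappa> r * ((if l \<in> route r then z l else 0) * (if l' \<in> route r then z l' else 0)))"
    by (subst (2) sum.swap, subst sum.swap) simp
  also have "\<dots> = (\<Sum>r\<in>UNIV. w r / \<kappa> r * (\<Sum>l\<in>route r \<inter> Ls. z l)\<^sup>2)"
  proof (rule sum.cong[OF refl])
    fix r
    have eq: "(\<Sum>l\<in>route r \<inter> Ls. z l) = (\<Sum>l\<in>Ls. if l \<in> route r then z l else 0)"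
      by (intro sum.mono_neutral_cong_left) auto
    show "(\<Sum>l\<in>Ls. \<Sum>l'\<in>Ls. w r / \<kappa> r * ((if l \<in> route r then z l else 0) * (if l' \<in> route r then z l' else 0)))
        = w r / \<kappa> r * (\<Sum>l\<in>route r \<inter> Ls. z l)\<^sup>2"
      unfolding eq power2_eq_square unfolding sum_product unfolding sum_distrib_left by (rule refl)
  qed
  finally show ?thesis .
qed

text \<open>\<open>B_form\<close> writes \<open>B\<close> as a positively weighted sum of squared
  route sums, so full row rank makes it positive definite and invertible. The last property is
  nonnegativity of the inverse form at indicator vectors, the only vectors that the trace bound
  needs.\<close>

lemma B_inverse:
  obtains M :: "'l \<Rightarrow> 'l \<Rightarrow> real" where "\<And>l l'. M l l' = M l' l"
    "\<And>l l'. l' \<in> Ls \<Longrightarrow> (\<Sum>i\<in>Ls. M l i * B i l') = (if l = l' then 1 else 0)"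
    "\<And>I. I \<subseteq> Ls \<Longrightarrow> 0 \<le> (\<Sum>l\<in>I. \<Sum>l'\<in>I. M l l')"
proof -
  \<comment> \<open>Extending by the identity outside \<open>Ls\<close> gives an invertible matrix
    over the whole link type without changing the critical block.\<close>
  define N :: "real^'l^'l" where "N = vec_lambda (\<lambda>l. vec_lambda (\<lambda>l'.
    if l \<in> Ls \<and> l' \<in> Ls then B l l' else if l = l' then 1 else 0))"
  have N_mult: "vec_nth (N *v z) l = (if l \<in> Ls then \<Sum>l'\<in>Ls. B l l' * vec_nth z l' else vec_nth z l)" for z l
  proof -
    have "vec_nth (N *v z) l = (\<Sum>l'\<in>UNIV. (if l \<in> Ls \<and> l' \<in> Ls then B l l' else if l = l' then 1 else 0) * vec_nth z l')"
      by (simp add: matrix_vector_mult_def N_def)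
    also have "\<dots> = (if l \<in> Ls then \<Sum>l'\<in>Ls. B l l' * vec_nth z l' else vec_nth z l)"
    proof (cases "l \<in> Ls")
      case True
      then show ?thesis by (simp, intro sum.mono_neutral_cong_right) auto
    next
      case False
      then have "(\<Sum>l'\<in>UNIV. (if l \<in> Ls \<and> l' \<in> Ls then B l l' else if l = l' then 1 else 0) * vec_nth z l')
          = (\<Sum>l'\<in>UNIV. if l = l' then vec_nth z l' else 0)"
        by (intro sum.cong) auto
      with False show ?thesis by simp
    qed
    finally show ?thesis .
  qed
  have form: "inner z (N *v z) = (\<Sum>r\<in>UNIV. w r / \<kappa> r * (\<Sum>l\<in>route r \<inter> Ls. vec_nth z l)\<^sup>2) + (\<Sum>l\<in>- Ls. (vec_nth z l)\<^sup>2)" for z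
  proof -
    have "inner z (N *v z) = (\<Sum>l\<in>UNIV. if l \<in> Ls then vec_nth z l * (\<Sum>l'\<in>Ls. B l l' * vec_nth z l') else vec_nth z l * vec_nth z l)"
      unfolding inner_vec_def N_mult by (intro sum.cong) auto
    also have "\<dots> = (\<Sum>l\<in>Ls. vec_nth z l * (\<Sum>l'\<in>Ls. B l l' * vec_nth z l')) + (\<Sum>l\<in>- Ls. (vec_nth z l)\<^sup>2)"
      by (subst sum.If_cases) (simp_all add: power2_eq_square)
    also have "(\<Sum>l\<in>Ls. vec_nth z l * (\<Sum>l'\<in>Ls. B l l' * vec_nth z l'))
        = (\<Sum>r\<in>UNIV. w r / \<kappa> r * (\<Sum>l\<in>route r \<inter> Ls. vec_nth z l)\<^sup>2)"
      unfolding sum_distrib_left by (rule B_form)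
    finally show ?thesis .
  qed
  have form_nonneg: "0 \<le> inner z (N *v z)" for z
    unfolding form using w_pos \<kappa>_pos by (intro add_nonneg_nonneg sum_nonneg mult_nonneg_nonneg) (auto simp: less_imp_le)
  have "z = 0" if Nz: "N *v z = 0" for z
  proof -
    let ?f = "\<lambda>r. w r / \<kappa> r * (\<Sum>l\<in>route r \<inter> Ls. vec_nth z l)\<^sup>2"
    have wk: "0 < w r / \<kappa> r" for r using w_pos \<kappa>_pos by simp
    have f: "0 \<le> ?f r" for r using wk[of r] by (intro mult_nonneg_nonneg) auto
    have "sum ?f UNIV + (\<Sum>l\<in>- Ls. (vec_nth z l)\<^sup>2) = 0"
      unfolding form[symmetric] Nz by simp
    moreover have "0 \<le> sum ?f UNIV" "0 \<le> (\<Sum>l\<in>- Ls. (vec_nth z l)\<^sup>2)"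
      using f by (auto intro!: sum_nonneg)
    ultimately have z0: "sum ?f UNIV = 0" "(\<Sum>l\<in>- Ls. (vec_nth z l)\<^sup>2) = 0" by linarith+
    have out: "vec_nth z l = 0" if "l \<notin> Ls" for l
      using sum_nonneg_eq_0_iff[of "- Ls" "\<lambda>l. (vec_nth z l)\<^sup>2"] z0(2) that by simp
    have "?f r = 0" for r
      using sum_nonneg_eq_0_iff[of UNIV ?f] z0(1) f by simp
    then have "(\<Sum>l\<in>route r \<inter> Ls. vec_nth z l) = 0" for r
      using wk[of r] by (metis mult_eq_0_iff less_irrefl power_eq_0_iff)
    moreover have "(\<Sum>l\<in>route r. vec_nth z l) = (\<Sum>l\<in>route r \<inter> Ls. vec_nth z l)" for r
      by (rule sum.mono_neutral_right) (auto simp: out)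
    ultimately have "(\<Sum>l\<in>route r. vec_nth z l) = 0" for r by metis
    then have "vec_nth z l = 0" for l by (rule route_sum_inj)
    then show "z = 0" by (intro Finite_Cartesian_Product.vec_eq_iff[THEN iffD2]) simp
  qed
  then obtain M where M: "M ** N = Finite_Cartesian_Product.mat 1"
    using matrix_left_invertible_ker[of N] by blast
  have NT: "transpose N = N"
    by (auto simp: Finite_Cartesian_Product.transpose_def N_def Finite_Cartesian_Product.vec_eq_iff B_def conj_commute)
  have NM: "N ** M = Finite_Cartesian_Product.mat 1" using M by (simp add: matrix_left_right_inverse)
  have MT: "transpose M = M"
  proof -
    have "N ** transpose M = Finite_Cartesian_Product.mat 1"
      using arg_cong[OF M, of transpose] by (simp add: matrix_transpose_mul NT)
    then have "M ** (N ** transpose M) = M" by simp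
    then show ?thesis by (simp add: matrix_mul_assoc M)
  qed
  show thesis
  proof (rule that[of "\<lambda>l l'. vec_nth (vec_nth M l) l'"])
    show "vec_nth (vec_nth M l) l' = vec_nth (vec_nth M l') l" for l l'
      using arg_cong[OF MT, of "\<lambda>A. vec_nth (vec_nth A l') l"] by (simp add: Finite_Cartesian_Product.transpose_def)
    show "(\<Sum>i\<in>Ls. vec_nth (vec_nth M l) i * B i l') = (if l = l' then 1 else 0)" if "l' \<in> Ls" for l l'
    proof -
      have "(if l = l' then 1 else 0) = vec_nth (vec_nth (M ** N) l) l'" by (simp add: M Finite_Cartesian_Product.mat_def)
      also have "\<dots> = (\<Sum>i\<in>UNIV. vec_nth (vec_nth M l) i * (if i \<in> Ls \<and> l' \<in> Ls then B i l' else if i = l' then 1 else 0))"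
        by (simp add: matrix_matrix_mult_def N_def)
      also have "\<dots> = (\<Sum>i\<in>Ls. vec_nth (vec_nth M l) i * B i l')"
        using that by (intro sum.mono_neutral_cong_right) auto
      finally show ?thesis by simp
    qed
    show "0 \<le> (\<Sum>l\<in>I. \<Sum>l'\<in>I. vec_nth (vec_nth M l) l')" if "I \<subseteq> Ls" for I
    proof -
      define z :: "real^'l" where "z = vec_lambda (\<lambda>l. if l \<in> I then 1 else 0)"
      \<comment> \<open>The form of the inverse at \<open>z\<close> is the form of \<open>N\<close>
        at the preimage of \<open>z\<close>.\<close>
      have "0 \<le> inner (M *v z) (N *v (M *v z))" by (rule form_nonneg)
      also have "N *v (M *v z) = z" by (simp add: matrix_vector_mul_assoc NM)
      also have "inner (M *v z) z = (\<Sum>l\<in>UNIV. (\<Sum>l'\<in>UNIV. vec_nth (vec_nth M l) l' * vec_nth z l') * vec_nth z l)"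
        by (simp add: inner_vec_def matrix_vector_mult_def)
      also have "\<dots> = (\<Sum>l\<in>I. \<Sum>l'\<in>I. vec_nth (vec_nth M l) l')"
        by (intro sum.mono_neutral_cong_right) (auto simp: z_def intro!: sum.mono_neutral_cong_right)
      finally show ?thesis .
    qed
  qed
qed

lemma route_pair_sum:
  fixes M :: "'l \<Rightarrow> 'l \<Rightarrow> real" and g :: "'r \<Rightarrow> real"
  shows "(\<Sum>r\<in>UNIV. g r * (\<Sum>l\<in>route r \<inter> Ls. \<Sum>l'\<in>route r \<inter> Ls. M l l'))
    = (\<Sum>l\<in>Ls. \<Sum>l'\<in>Ls. M l l' * (\<Sum>r | l \<in> route r \<and> l' \<in> route r. g r))"
proof -
  have "(\<Sum>l\<in>route r \<inter> Ls. \<Sum>l'\<in>route r \<inter> Ls. M l l')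
      = (\<Sum>l\<in>Ls. \<Sum>l'\<in>Ls. if l \<in> route r \<and> l' \<in> route r then M l l' else 0)" for r
  proof -
    have "(\<Sum>l'\<in>route r \<inter> Ls. M l l') = (\<Sum>l'\<in>Ls. if l' \<in> route r then M l l' else 0)" for l
      by (rule sum.mono_neutral_cong_left) auto
    then have "(\<Sum>l\<in>route r \<inter> Ls. \<Sum>l'\<in>route r \<inter> Ls. M l l')
        = (\<Sum>l\<in>Ls. if l \<in> route r then \<Sum>l'\<in>Ls. if l' \<in> route r then M l l' else 0 else 0)"
      by (intro sum.mono_neutral_cong_left) auto
    also have "\<dots> = (\<Sum>l\<in>Ls. \<Sum>l'\<in>Ls. if l \<in> route r \<and> l' \<in> route r then M l l' else 0)"
      by (intro sum.cong refl) auto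
    finally show ?thesis .
  qed
  then have "(\<Sum>r\<in>UNIV. g r * (\<Sum>l\<in>route r \<inter> Ls. \<Sum>l'\<in>route r \<inter> Ls. M l l'))
      = (\<Sum>r\<in>UNIV. g r * (\<Sum>l\<in>Ls. \<Sum>l'\<in>Ls. if l \<in> route r \<and> l' \<in> route r then M l l' else 0))"
    by (simp only:)
  also have "\<dots> = (\<Sum>r\<in>UNIV. \<Sum>l\<in>Ls. \<Sum>l'\<in>Ls. if l \<in> route r \<and> l' \<in> route r then g r * M l l' else 0)"
    unfolding sum_distrib_left by (intro sum.cong refl) auto
  also have "\<dots> = (\<Sum>l\<in>Ls. \<Sum>l'\<in>Ls. \<Sum>r\<in>UNIV. if l \<in> route r \<and> l' \<in> route r then g r * M l l' else 0)"
    by (subst sum.swap, intro sum.cong refl, rule sum.swap)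
  also have "\<dots> = (\<Sum>l\<in>Ls. \<Sum>l'\<in>Ls. M l l' * (\<Sum>r | l \<in> route r \<and> l' \<in> route r. g r))"
  proof (intro sum.cong refl)
    fix l l'
    have "M l l' * (\<Sum>r | l \<in> route r \<and> l' \<in> route r. g r) = (\<Sum>r | l \<in> route r \<and> l' \<in> route r. g r * M l l')"
      by (simp add: sum_distrib_left mult.commute)
    also have "\<dots> = (\<Sum>r\<in>UNIV. if l \<in> route r \<and> l' \<in> route r then g r * M l l' else 0)"
      by (rule sum.mono_neutral_cong_left) auto
    finally show "(\<Sum>r\<in>UNIV. if l \<in> route r \<and> l' \<in> route r then g r * M l l' else 0)
        = M l l' * (\<Sum>r | l \<in> route r \<and> l' \<in> route r. g r)" by simp
  qed
  finally show ?thesis .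
qed

text \<open>The trace of \<open>M B\<close>, namely \<open>card Ls\<close>, splits into nonnegative
  shares \<open>t r\<close> of the routes. \<open>T\<close> is the same sum with each share weighted
  by \<open>\<kappa> r\<close>, hence lies between the extreme weights.\<close>

lemma trace_bounds:
  fixes M :: "'l \<Rightarrow> 'l \<Rightarrow> real"
  assumes inv: "\<And>l l'. l' \<in> Ls \<Longrightarrow> (\<Sum>i\<in>Ls. M l i * B i l') = (if l = l' then 1 else 0)"
    and psd: "\<And>I. I \<subseteq> Ls \<Longrightarrow> 0 \<le> (\<Sum>l\<in>I. \<Sum>l'\<in>I. M l l')"
  defines "T \<equiv> (\<Sum>l\<in>Ls. \<Sum>l'\<in>Ls. M l l' * (\<Sum>r | l \<in> route r \<and> l' \<in> route r. w r))"
  shows "real (card Ls) * Min (range \<kappa>) \<le> T" "T \<le> real (card Ls) * Max (range \<kappa>)"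
proof -
  define t where "t r = w r / \<kappa> r * (\<Sum>l\<in>route r \<inter> Ls. \<Sum>l'\<in>route r \<inter> Ls. M l l')" for r
  have t: "0 \<le> t r" for r
    unfolding t_def using w_pos[of r] \<kappa>_pos[of r] psd[of "route r \<inter> Ls"] by (intro mult_nonneg_nonneg) auto
  have "sum t UNIV = (\<Sum>l\<in>Ls. \<Sum>l'\<in>Ls. M l l' * B l' l)"
    unfolding t_def route_pair_sum B_def by (simp add: conj_commute)
  also have "\<dots> = real (card Ls)" by (simp add: inv)
  finally have sum_t: "sum t UNIV = real (card Ls)" .
  have T: "T = (\<Sum>r\<in>UNIV. \<kappa> r * t r)"
    unfolding T_def route_pair_sum[symmetric] t_def using \<kappa>_pos
    by (intro sum.cong refl) (simp add: less_imp_neq[OF \<kappa>_pos, symmetric])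
  have "(\<Sum>r\<in>UNIV. Min (range \<kappa>) * t r) \<le> T" "T \<le> (\<Sum>r\<in>UNIV. Max (range \<kappa>) * t r)"
    unfolding T using t by (auto intro!: sum_mono mult_right_mono)
  moreover have "(\<Sum>r\<in>UNIV. c * t r) = real (card Ls) * c" for c
    by (simp add: sum_distrib_left[symmetric] sum_t)
  ultimately show "real (card Ls) * Min (range \<kappa>) \<le> T" "T \<le> real (card Ls) * Max (range \<kappa>)"
    by simp_all
qed

text \<open>The mean-zero drift of the quadratic form of \<open>M\<close> in the workloads. Symmetry
  of \<open>M\<close> allows the form to be rearranged into the symmetric pairs whose means are
  explicit.\<close>

lemma expectation_quadratic:
  assumes sym: "\<And>l l'. M l l' = M l' l"
    and D: "stationary \<epsilon> D" and N3: "integrable (measure_pmf D) (\<lambda>n. N1 n ^ 3)"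
    and N: "integrable (measure_pmf D) N1" and \<epsilon>: "0 < \<epsilon>" "\<epsilon> \<le> 1"
  shows "E D (\<lambda>n. \<Sum>l\<in>Ls. (\<Sum>l'\<in>Ls. M l l' * Wl n l') * (Ul n l - \<epsilon> * C l))
    = - ((1 - \<epsilon>) * (\<Sum>l\<in>Ls. \<Sum>l'\<in>Ls. M l l' * (\<Sum>r | l \<in> route r \<and> l' \<in> route r. w r)))"
proof -
  note int = integrable_workload_unused[OF D N \<epsilon>]
  define Y where "Y n l = Ul n l - \<epsilon> * C l" for n l
  have half: "(\<Sum>l\<in>Ls. (\<Sum>l'\<in>Ls. M l l' * Wl n l') * Y n l)
      = (\<Sum>l\<in>Ls. \<Sum>l'\<in>Ls. M l l' / 2 * (Wl n l * Y n l' + Wl n l' * Y n l))" for n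
  proof -
    have "(\<Sum>l\<in>Ls. (\<Sum>l'\<in>Ls. M l l' * Wl n l') * Y n l) = (\<Sum>l\<in>Ls. \<Sum>l'\<in>Ls. M l l' * (Wl n l' * Y n l))"
      by (simp add: sum_distrib_right mult.assoc)
    moreover have "(\<Sum>l\<in>Ls. \<Sum>l'\<in>Ls. M l l' * (Wl n l * Y n l')) = (\<Sum>l\<in>Ls. \<Sum>l'\<in>Ls. M l l' * (Wl n l' * Y n l))"
      by (subst sum.swap) (simp add: sym)
    moreover have "(\<Sum>l\<in>Ls. \<Sum>l'\<in>Ls. M l l' / 2 * (Wl n l * Y n l' + Wl n l' * Y n l))
        = ((\<Sum>l\<in>Ls. \<Sum>l'\<in>Ls. M l l' * (Wl n l * Y n l')) + (\<Sum>l\<in>Ls. \<Sum>l'\<in>Ls. M l l' * (Wl n l' * Y n l))) / 2"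
      unfolding sum.distrib[symmetric] sum_divide_distrib
      by (intro sum.cong refl) (simp add: algebra_simps add_divide_distrib)
    ultimately show ?thesis by simp
  qed
  have "E D (\<lambda>n. \<Sum>l\<in>Ls. (\<Sum>l'\<in>Ls. M l l' * Wl n l') * Y n l)
      = (\<Sum>l\<in>Ls. \<Sum>l'\<in>Ls. M l l' / 2 * E D (\<lambda>n. Wl n l * Y n l' + Wl n l' * Y n l))"
    unfolding half unfolding Y_def using int by (simp add: Bochner_Integration.integral_sum)
  also have "\<dots> = (\<Sum>l\<in>Ls. \<Sum>l'\<in>Ls. - ((1 - \<epsilon>) * (M l l' * (\<Sum>r | l \<in> route r \<and> l' \<in> route r. w r))))"
    unfolding Y_def by (intro sum.cong refl) (simp add: expectation_workload_product[OF D N3 N])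
  also have "\<dots> = - ((1 - \<epsilon>) * (\<Sum>l\<in>Ls. \<Sum>l'\<in>Ls. M l l' * (\<Sum>r | l \<in> route r \<and> l' \<in> route r. w r)))"
    by (simp add: sum_negf sum_distrib_left)
  finally show ?thesis by (simp add: Y_def)
qed

text \<open>On the cone the workloads are \<open>B q\<close>, so applying the inverse of
  \<open>B\<close> to them recovers the multipliers.\<close>

lemma lin_wl_comb:
  assumes q: "cone q" and l: "l \<in> Ls"
  shows "lin (wl l) (comb q) = (\<Sum>l'\<in>Ls. B l l' * q l')"
proof -
  have "lin (wl l) (comb q) = (\<Sum>r | l \<in> route r. w r / \<kappa> r * rs q r)"
    unfolding lin_wl link_load_def comb_def w_def
    by (intro sum.cong refl) (simp add: sum_distrib_left sum_distrib_right sum_divide_distrib mult_ac)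
  also have "\<dots> = (\<Sum>r\<in>UNIV. rs q r * (if l \<in> route r then w r / \<kappa> r else 0))"
    by (rule sum.mono_neutral_cong_left) auto
  also have "\<dots> = (\<Sum>l'\<in>UNIV. q l' * load (\<lambda>r. if l \<in> route r then w r / \<kappa> r else 0) l')"
    by (rule sum_rs)
  also have "\<dots> = (\<Sum>l'\<in>UNIV. q l' * B l l')"
  proof -
    have "load (\<lambda>r. if l \<in> route r then w r / \<kappa> r else 0) l' = B l l'" for l'
      unfolding link_load_def B_def by (rule sum.mono_neutral_cong_right) auto
    then show ?thesis by simp
  qed
  also have "\<dots> = (\<Sum>l'\<in>Ls. B l l' * q l')"
    using q by (intro sum.mono_neutral_cong_right) (auto simp: cone_def)
  finally show ?thesis .
qed

text \<open>Both quantities vanish on the cone and are linear in the state, so they depend only on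
  \<open>err\<close> and are at most a multiple of its norm.\<close>

lemma projection_error:
  assumes inv: "\<And>l l'. l' \<in> Ls \<Longrightarrow> (\<Sum>i\<in>Ls. M l i * B i l') = (if l = l' then 1 else 0)"
  obtains c where "0 < c"
    "\<And>n l. l \<in> Ls \<Longrightarrow> \<bar>(\<Sum>l'\<in>Ls. M l l' * Wl n l') - proj n l\<bar> \<le> c * sqrt (dd n)"
    "\<And>n. \<bar>wc (re n) - (\<Sum>l\<in>Ls. (\<Sum>l'\<in>Ls. M l l' * Wl n l') * C l)\<bar> \<le> c * sqrt (dd n)"
proof -
  have sqrt_bound: "\<exists>c>0. \<forall>n. \<bar>lin d (err n)\<bar> \<le> c * sqrt (dd n)" for d
  proof -
    obtain c where c: "0 < c" "\<And>v. (lin d v)\<^sup>2 \<le> c * ip v v" using lin_cauchy_schwarz by blast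
    have "\<bar>lin d (err n)\<bar> \<le> sqrt c * sqrt (dd n)" for n
      using c(2)[of "err n"] unfolding dd_def by (metis real_sqrt_abs real_sqrt_le_mono real_sqrt_mult)
    with c(1) show ?thesis by (intro exI[of _ "sqrt c"]) auto
  qed
  have "\<forall>l. \<exists>c. 0 < c \<and> (\<forall>n. \<bar>lin (wl l) (err n)\<bar> \<le> c * sqrt (dd n))"
    using sqrt_bound by blast
  from choice[OF this] obtain a where a': "\<forall>l. 0 < a l \<and> (\<forall>n. \<bar>lin (wl l) (err n)\<bar> \<le> a l * sqrt (dd n))"
    by (rule exE)
  then have a: "0 < a l" "\<bar>lin (wl l) (err n)\<bar> \<le> a l * sqrt (dd n)" for l n
    by simp_all
  obtain b where b: "0 < b" "\<And>n. \<bar>wc (err n)\<bar> \<le> b * sqrt (dd n)"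
    using sqrt_bound[of "\<lambda>r k. \<kappa> r"] unfolding wc_def by blast
  define c where "c = (\<Sum>l\<in>Ls. \<Sum>l'\<in>Ls. \<bar>M l l'\<bar> * a l')"
  have c: "0 \<le> c" unfolding c_def using a(1) by (intro sum_nonneg mult_nonneg_nonneg) (auto simp: less_imp_le)
  have dev: "\<bar>(\<Sum>l'\<in>Ls. M l l' * Wl n l') - proj n l\<bar> \<le> c * sqrt (dd n)" if l: "l \<in> Ls" for n l
  proof -
    have "Wl n l' = lin (wl l') (comb (proj n)) + lin (wl l') (err n)" for l'
      unfolding Wl_def err_def[abs_def] lin_diff by simp
    then have "(\<Sum>l'\<in>Ls. M l l' * Wl n l') =
        (\<Sum>l'\<in>Ls. M l l' * (\<Sum>i\<in>Ls. B l' i * proj n i)) + (\<Sum>l'\<in>Ls. M l l' * lin (wl l') (err n))"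
      by (simp add: distrib_left sum.distrib lin_wl_comb[OF cone_proj])
    also have "(\<Sum>l'\<in>Ls. M l l' * (\<Sum>i\<in>Ls. B l' i * proj n i)) = (\<Sum>i\<in>Ls. (\<Sum>l'\<in>Ls. M l l' * B l' i) * proj n i)"
      unfolding sum_distrib_left sum_distrib_right by (subst sum.swap) (simp add: mult.assoc)
    also have "\<dots> = (\<Sum>i\<in>Ls. if l = i then proj n i else 0)"
      by (intro sum.cong refl) (simp add: inv)
    also have "\<dots> = proj n l" using l by simp
    finally have "\<bar>(\<Sum>l'\<in>Ls. M l l' * Wl n l') - proj n l\<bar> = \<bar>\<Sum>l'\<in>Ls. M l l' * lin (wl l') (err n)\<bar>" by simp
    also have "\<dots> \<le> (\<Sum>l'\<in>Ls. \<bar>M l l' * lin (wl l') (err n)\<bar>)" by (rule sum_abs)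
    also have "\<dots> \<le> (\<Sum>l'\<in>Ls. \<bar>M l l'\<bar> * (a l' * sqrt (dd n)))"
      unfolding abs_mult by (intro sum_mono mult_left_mono a) auto
    also have "\<dots> = (\<Sum>l'\<in>Ls. \<bar>M l l'\<bar> * a l') * sqrt (dd n)" by (simp add: sum_distrib_right mult.assoc)
    also have "\<dots> \<le> c * sqrt (dd n)"
    proof (rule mult_right_mono)
      show "(\<Sum>l'\<in>Ls. \<bar>M l l'\<bar> * a l') \<le> c"
        unfolding c_def using l a(1)
        by (intro member_le_sum[where f="\<lambda>l. \<Sum>l'\<in>Ls. \<bar>M l l'\<bar> * a l'"]) (auto intro!: sum_nonneg simp: less_imp_le)
    qed (simp add: dd_nonneg)
    finally show ?thesis .
  qed
  have "\<bar>wc (re n) - (\<Sum>l\<in>Ls. (\<Sum>l'\<in>Ls. M l l' * Wl n l') * C l)\<bar> \<le> (b + real (card Ls) * (c * C\<^sub>s)) * sqrt (dd n)" for n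
  proof -
    have "wc (re n) = wc (err n) + wc (comb (proj n))"
      unfolding err_def[abs_def] wc_diff by simp
    also have "wc (comb (proj n)) = (\<Sum>l\<in>Ls. proj n l * C l)"
      unfolding wc_comb_cone[OF cone_proj] using cone_proj[of n]
      by (intro sum.mono_neutral_right) (auto simp: cone_def)
    finally have "wc (re n) - (\<Sum>l\<in>Ls. (\<Sum>l'\<in>Ls. M l l' * Wl n l') * C l)
        = wc (err n) - (\<Sum>l\<in>Ls. ((\<Sum>l'\<in>Ls. M l l' * Wl n l') - proj n l) * C l)"
      unfolding left_diff_distrib sum_subtractf by linarith
    then have "\<bar>wc (re n) - (\<Sum>l\<in>Ls. (\<Sum>l'\<in>Ls. M l l' * Wl n l') * C l)\<bar>
        \<le> \<bar>wc (err n)\<bar> + \<bar>\<Sum>l\<in>Ls. ((\<Sum>l'\<in>Ls. M l l' * Wl n l') - proj n l) * C l\<bar>"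
      by (simp only: abs_triangle_ineq4)
    moreover have "\<bar>\<Sum>l\<in>Ls. ((\<Sum>l'\<in>Ls. M l l' * Wl n l') - proj n l) * C l\<bar> \<le> (\<Sum>l\<in>Ls. c * sqrt (dd n) * C\<^sub>s)"
    proof (rule order_trans[OF sum_abs], rule sum_mono)
      fix l assume l: "l \<in> Ls"
      have "\<bar>C l\<bar> \<le> C\<^sub>s" using C_le_Cs[of l] C_pos[of l] by simp
      moreover have "0 \<le> c * sqrt (dd n)" using c dd_nonneg[of n] by simp
      ultimately show "\<bar>((\<Sum>l'\<in>Ls. M l l' * Wl n l') - proj n l) * C l\<bar> \<le> c * sqrt (dd n) * C\<^sub>s"
        unfolding abs_mult by (intro mult_mono dev l) auto
    qed
    moreover have "(\<Sum>l\<in>Ls. c * sqrt (dd n) * C\<^sub>s) = real (card Ls) * (c * C\<^sub>s) * sqrt (dd n)" by simp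
    ultimately show ?thesis using b(2)[of n] unfolding distrib_right by linarith
  qed
  moreover have "b + real (card Ls) * (c * C\<^sub>s) \<le> b + c + real (card Ls) * (c * C\<^sub>s)" "c \<le> b + c + real (card Ls) * (c * C\<^sub>s)"
    using b(1) c Cs_pos by auto
  moreover have "0 < b + c + real (card Ls) * (c * C\<^sub>s)"
    using b(1) c Cs_pos by (intro add_pos_nonneg) auto
  moreover have "0 \<le> sqrt (dd n)" for n by (simp add: dd_nonneg)
  ultimately show thesis
    using dev by (intro that[of "b + c + real (card Ls) * (c * C\<^sub>s)"]) (meson mult_right_mono order_trans)+
qed

section \<open>Rates of the error terms and the limit\<close>

lemma sqrt_dd_le_N1:
  obtains c where "0 < c" "\<And>n. sqrt (dd n) \<le> c * N1 n"
proof -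
  obtain b where b: "0 < b" "\<And>n. ip (re n) (re n) \<le> b * (wc (re n))\<^sup>2" using ip_le_wc by blast
  have "sqrt (dd n) \<le> sqrt b * N1 n" for n
  proof -
    have "cone (\<lambda>_. 0)" by (simp add: cone_def)
    from dd_le[OF this, of n] have "dd n \<le> ip (re n) (re n)" by (simp add: comb_def rs_def)
    also have "\<dots> \<le> b * (wc (re n))\<^sup>2" by (rule b(2))
    also have "\<dots> \<le> b * (N1 n)\<^sup>2"
      using b(1) wc_nonneg[of n] by (intro mult_left_mono power_mono) (auto simp: N1_def)
    finally have "sqrt (dd n) \<le> sqrt (b * (N1 n)\<^sup>2)" by simp
    then show ?thesis using N1_ge[of n] by (simp add: real_sqrt_mult)
  qed
  with b(1) show thesis by (intro that[of "sqrt b"]) auto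
qed

text \<open>In powers of \<open>\<epsilon>\<close> the bounds are of order -1/2 and 1/8. The first
  shows that the distance is negligible against the state, of order -1. The second combines the
  smallness of the mean of \<open>U\<close> with collapse; its exponent only has to exceed the loss
  of one factor \<open>\<theta>\<close> later.\<close>

lemma distance_expectations:
  obtains c where "0 < c" "\<And>\<theta> D l. stationary (\<theta> ^ 16) D \<Longrightarrow> 0 < \<theta> \<Longrightarrow> \<theta> ^ 16 \<le> 1 / 2 \<Longrightarrow> l \<in> Ls \<Longrightarrow>
    integrable (measure_pmf D) (\<lambda>n. sqrt (dd n)) \<and> E D (\<lambda>n. sqrt (dd n)) \<le> c / \<theta> ^ 8 \<and>
    integrable (measure_pmf D) (\<lambda>n. Ul n l * sqrt (dd n)) \<and> E D (\<lambda>n. Ul n l * sqrt (dd n)) \<le> c * \<theta>\<^sup>2"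
proof -
  obtain c\<^sub>3 where c3: "0 < c\<^sub>3" and mom: "\<And>\<epsilon> D. stationary \<epsilon> D \<Longrightarrow> 0 < \<epsilon> \<Longrightarrow> \<epsilon> \<le> 1 / 2 \<Longrightarrow>
    integrable (measure_pmf D) (\<lambda>n. N1 n ^ 3) \<and> E D (\<lambda>n. N1 n ^ 3) \<le> c\<^sub>3 / \<epsilon> ^ 3 \<and>
    integrable (measure_pmf D) N1 \<and> E D N1 \<le> c\<^sub>3 / \<epsilon>"
    using moments by blast
  obtain c\<^sub>4 where c4: "0 < c\<^sub>4" and col: "\<And>\<epsilon> D. stationary \<epsilon> D \<Longrightarrow> 0 < \<epsilon> \<Longrightarrow> \<epsilon> \<le> 1 / 2 \<Longrightarrow>
    integrable (measure_pmf D) (\<lambda>n. (dd n)\<^sup>2 / N1 n) \<and> E D (\<lambda>n. (dd n)\<^sup>2 / N1 n) \<le> c\<^sub>4 / \<epsilon>"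
    using collapse by blast
  obtain b where b: "0 < b" "\<And>n. sqrt (dd n) \<le> b * N1 n" using sqrt_dd_le_N1 by blast
  define c where "c = (c\<^sub>4 + c\<^sub>3 + 1) + (C\<^sub>s + c\<^sub>4 + C\<^sub>s * (C\<^sub>s + C\<^sub>s * c\<^sub>3))"
  have c: "0 < c" using c3 c4 Cs_pos by (simp add: c_def add_pos_pos)
  have "integrable (measure_pmf D) (\<lambda>n. sqrt (dd n)) \<and> E D (\<lambda>n. sqrt (dd n)) \<le> c / \<theta> ^ 8 \<and>
    integrable (measure_pmf D) (\<lambda>n. Ul n l * sqrt (dd n)) \<and> E D (\<lambda>n. Ul n l * sqrt (dd n)) \<le> c * \<theta>\<^sup>2"
    if D: "stationary (\<theta> ^ 16) D" and \<theta>: "0 < \<theta>" "\<theta> ^ 16 \<le> 1 / 2" and l: "l \<in> Ls" for \<theta> D l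
  proof -
    have \<theta>1: "\<theta> \<le> 1"
    proof (rule ccontr)
      assume "\<not> \<theta> \<le> 1"
      then have "1 \<le> \<theta> ^ 16" by (intro one_le_power) auto
      with \<theta> show False by simp
    qed
    have e0: "0 < \<theta> ^ 16" using \<theta> by simp
    note mo = mom[OF D e0 \<theta>(2)] and co = col[OF D e0 \<theta>(2)]
    have N: "0 < N1 n" for n using N1_ge[of n] by simp
    have int_d: "integrable (measure_pmf D) (\<lambda>n. sqrt (dd n))"
    proof (rule Bochner_Integration.integrable_bound)
      show "integrable (measure_pmf D) (\<lambda>n. b * N1 n)" using mo by simp
      show "AE n in measure_pmf D. norm (sqrt (dd n)) \<le> norm (b * N1 n)"
        using b by (intro AE_I2) (simp add: dd_nonneg abs_mult abs_of_pos[OF N])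
    qed simp
    have int_Ud: "integrable (measure_pmf D) (\<lambda>n. Ul n l * sqrt (dd n))"
    proof (rule Bochner_Integration.integrable_bound)
      show "integrable (measure_pmf D) (\<lambda>n. C\<^sub>s * sqrt (dd n))" using int_d by simp
      show "AE n in measure_pmf D. norm (Ul n l * sqrt (dd n)) \<le> norm (C\<^sub>s * sqrt (dd n))"
        using stationary_AE[OF D]
        by eventually_elim (use Ul_bounds Cs_pos dd_nonneg in \<open>auto simp: abs_mult intro!: mult_right_mono\<close>)
    qed simp
    \<comment> \<open>Two weighted mean inequalities; the factor \<open>\<theta> ^ 8\<close>
      balances means of order \<open>1 / \<theta> ^ 16\<close> against the additive
      \<open>1 / \<theta> ^ 8\<close>.\<close>
    have "sqrt (dd n) \<le> \<theta> ^ 8 * ((dd n)\<^sup>2 / N1 n + N1 n) + 1 / \<theta> ^ 8" for n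
    proof -
      let ?d = "sqrt (dd n)" and ?s = "\<theta> ^ 8"
      have s: "0 < ?s" using \<theta> by simp
      have "0 \<le> (?s * ?d - 1)\<^sup>2 + 1" by simp
      then have "2 * (?s * ?d) \<le> ?s\<^sup>2 * dd n + 2"
        using dd_nonneg[of n] by (simp add: power2_diff power_mult_distrib)
      then have "?d \<le> (?s\<^sup>2 * dd n + 2) / (2 * ?s)" using s by (simp add: pos_le_divide_eq mult_ac)
      also have "\<dots> = ?s * dd n / 2 + 1 / ?s" using s by (simp add: field_simps power2_eq_square)
      also have "?s * dd n / 2 \<le> ?s * ((dd n)\<^sup>2 / N1 n + N1 n)"
      proof -
        have "0 \<le> (dd n - N1 n)\<^sup>2 / N1 n" using N[of n] by simp
        also have "\<dots> = (dd n)\<^sup>2 / N1 n + N1 n - 2 * dd n"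
          using N[of n] by (simp add: power2_eq_square field_simps)
        finally have "dd n / 2 \<le> (dd n)\<^sup>2 / N1 n + N1 n" using dd_nonneg[of n] by linarith
        from mult_left_mono[OF this, of ?s] s show ?thesis by simp
      qed
      finally show ?thesis by simp
    qed
    then have "E D (\<lambda>n. sqrt (dd n)) \<le> E D (\<lambda>n. \<theta> ^ 8 * ((dd n)\<^sup>2 / N1 n + N1 n) + 1 / \<theta> ^ 8)"
      using int_d mo co by (intro integral_mono) auto
    also have "\<dots> = \<theta> ^ 8 * (E D (\<lambda>n. (dd n)\<^sup>2 / N1 n) + E D N1) + 1 / \<theta> ^ 8"
      using mo co by simp
    also have "\<dots> \<le> \<theta> ^ 8 * (c\<^sub>4 / \<theta> ^ 16 + c\<^sub>3 / \<theta> ^ 16) + 1 / \<theta> ^ 8"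
      using mo co \<theta> by (intro add_right_mono mult_left_mono add_mono) auto
    also have "\<dots> = (c\<^sub>4 + c\<^sub>3 + 1) / \<theta> ^ 8"
    proof -
      have "\<theta> ^ 16 = \<theta> ^ 8 * \<theta> ^ 8" by (simp flip: power_add)
      then show ?thesis using \<theta> by (simp add: field_simps)
    qed
    also have "\<dots> \<le> c / \<theta> ^ 8"
      using \<theta> c3 c4 Cs_pos by (intro divide_right_mono) (auto simp: c_def)
    finally have Ed: "E D (\<lambda>n. sqrt (dd n)) \<le> c / \<theta> ^ 8" .
    \<comment> \<open>The weights balance the errors: the mean of \<open>U\<close> is of order
      \<open>\<theta> ^ 16\<close>, that of \<open>dd\<^sup>2 / N1\<close> of order
      \<open>1 / \<theta> ^ 16\<close>, and states with \<open>N1\<close> above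
      \<open>1 / \<theta> ^ 24\<close> are left to the third moment, of order
      \<open>1 / \<theta> ^ 48\<close>. Three terms have order \<open>\<theta>\<^sup>2\<close> and
      the tail has order \<open>\<theta> ^ 10\<close>.\<close>
    let ?b = "\<theta> ^ 14" and ?t = "\<theta> ^ 4"
    let ?h = "\<lambda>n. 1 / ?b * Ul n l + ?b * ?t * ((dd n)\<^sup>2 / N1 n)
        + C\<^sub>s * \<theta> ^ 10 * (1 / \<theta> ^ 24 * Ul n l + C\<^sub>s * \<theta> ^ 48 * N1 n ^ 3)"
    have ptw: "Ul n l * sqrt (dd n) \<le> ?h n" if n: "n \<in> X" for n
    proof -
      let ?u = "Ul n l" and ?d = "sqrt (dd n)"
      have u: "0 \<le> ?u" "?u \<le> C\<^sub>s" using Ul_bounds[OF n] by auto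
      have pw: "0 < ?b" "0 < ?t" "0 < \<theta> ^ 24" using \<theta> by auto
      have d1: "?d \<le> 1 / ?b + ?b * dd n"
      proof -
        have "0 \<le> (?b * ?d - 1)\<^sup>2 + ?b * ?d" using pw dd_nonneg[of n] by simp
        then have "?b * ?d \<le> 1 + ?b\<^sup>2 * dd n"
          using dd_nonneg[of n] by (simp add: power2_diff power_mult_distrib)
        then have "?d \<le> (1 + ?b\<^sup>2 * dd n) / ?b" using pw by (simp add: pos_le_divide_eq mult_ac)
        also have "\<dots> = 1 / ?b + ?b * dd n" using pw by (simp add: field_simps power2_eq_square)
        finally show ?thesis .
      qed
      have d2: "?u * dd n \<le> ?t * ((dd n)\<^sup>2 / N1 n) + ?u\<^sup>2 * N1 n / ?t"
      proof -
        have "0 \<le> (?t * dd n - ?u * N1 n)\<^sup>2 / (?t * N1 n) + ?u * dd n" using pw N[of n] u dd_nonneg[of n] by simp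
        also have "(?t * dd n - ?u * N1 n)\<^sup>2 / (?t * N1 n) = ?t * ((dd n)\<^sup>2 / N1 n) + ?u\<^sup>2 * N1 n / ?t - 2 * (?u * dd n)"
        proof -
          have "(t * y - v * z)\<^sup>2 / (t * z) = t * (y\<^sup>2 / z) + v\<^sup>2 * z / t - 2 * (v * y)"
            if "0 < t" "0 < z" for t y v z :: real
            using that by (simp add: field_simps power2_eq_square)
          then show ?thesis using pw N[of n] by blast
        qed
        finally show ?thesis by simp
      qed
      have d3: "?u\<^sup>2 * N1 n \<le> C\<^sub>s * (1 / \<theta> ^ 24 * ?u + C\<^sub>s * \<theta> ^ 48 * N1 n ^ 3)"
      proof -
        have "?u * N1 n \<le> 1 / \<theta> ^ 24 * ?u + C\<^sub>s * \<theta> ^ 48 * N1 n ^ 3"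
        proof (cases "N1 n \<le> 1 / \<theta> ^ 24")
          case True
          then have "?u * N1 n \<le> ?u * (1 / \<theta> ^ 24)" using u by (intro mult_left_mono)
          moreover have "0 \<le> C\<^sub>s * \<theta> ^ 48 * N1 n ^ 3" using Cs_pos \<theta> N[of n] by simp
          ultimately show ?thesis by (simp add: mult.commute)
        next
          case False
          then have "1 \<le> \<theta> ^ 24 * N1 n" using pw by (simp add: field_simps)
          then have "1 \<le> (\<theta> ^ 24 * N1 n)\<^sup>2" by simp
          then have "N1 n * 1 \<le> N1 n * (\<theta> ^ 24 * N1 n)\<^sup>2" using N[of n] by (intro mult_left_mono) auto
          also have "\<dots> = \<theta> ^ 48 * N1 n ^ 3"
            by (simp add: power_mult_distrib power_mult[symmetric] power2_eq_square[of "N1 n"] power3_eq_cube)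
          finally have "?u * N1 n \<le> C\<^sub>s * (\<theta> ^ 48 * N1 n ^ 3)"
            using u N[of n] Cs_pos by (intro mult_mono) auto
          moreover have "0 \<le> 1 / \<theta> ^ 24 * ?u" using u pw by simp
          ultimately show ?thesis by (simp add: mult.assoc)
        qed
        moreover have "?u\<^sup>2 * N1 n \<le> C\<^sub>s * (?u * N1 n)"
          unfolding power2_eq_square mult.assoc using u N[of n] by (intro mult_right_mono) auto
        ultimately show ?thesis using Cs_pos mult_left_mono[of "?u * N1 n" _ C\<^sub>s] by (meson less_imp_le order_trans)
      qed
      have "?u * ?d \<le> ?u * (1 / ?b + ?b * dd n)" using d1 u by (intro mult_left_mono) auto
      also have "\<dots> = 1 / ?b * ?u + ?b * (?u * dd n)" by (simp add: algebra_simps)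
      also have "?b * (?u * dd n) \<le> ?b * (?t * ((dd n)\<^sup>2 / N1 n) + ?u\<^sup>2 * N1 n / ?t)"
        using d2 pw by (intro mult_left_mono) auto
      also have "\<dots> = ?b * ?t * ((dd n)\<^sup>2 / N1 n) + \<theta> ^ 10 * (?u\<^sup>2 * N1 n)"
      proof -
        have b_eq: "?b = \<theta> ^ 10 * ?t" by (simp flip: power_add)
        have "?b * (z / ?t) = \<theta> ^ 10 * z" for z
        proof -
          have "y * t * (z / t) = y * z" if "0 < t" for y t :: real using that by simp
          from this[OF pw(2)] show ?thesis unfolding b_eq .
        qed
        then show ?thesis by (simp add: distrib_left mult.assoc)
      qed
      also have "\<theta> ^ 10 * (?u\<^sup>2 * N1 n) \<le> \<theta> ^ 10 * (C\<^sub>s * (1 / \<theta> ^ 24 * ?u + C\<^sub>s * \<theta> ^ 48 * N1 n ^ 3))"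
        using d3 \<theta> by (intro mult_left_mono) auto
      finally show ?thesis by (simp add: mult_ac)
    qed
    note intU = integrable_Ul[OF D, of l]
    have combination: "integrable (measure_pmf D) (\<lambda>n. k\<^sub>1 * Ul n l + k\<^sub>2 * F n + k\<^sub>3 * (k\<^sub>4 * Ul n l + k\<^sub>5 * N1 n ^ 3))"
      "E D (\<lambda>n. k\<^sub>1 * Ul n l + k\<^sub>2 * F n + k\<^sub>3 * (k\<^sub>4 * Ul n l + k\<^sub>5 * N1 n ^ 3)) =
        k\<^sub>1 * E D (\<lambda>n. Ul n l) + k\<^sub>2 * E D F + k\<^sub>3 * (k\<^sub>4 * E D (\<lambda>n. Ul n l) + k\<^sub>5 * E D (\<lambda>n. N1 n ^ 3))"
      if "integrable (measure_pmf D) F" for k\<^sub>1 k\<^sub>2 k\<^sub>3 k\<^sub>4 k\<^sub>5 F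
      using intU mo that by simp_all
    have EU: "E D (\<lambda>n. Ul n l) \<le> \<theta> ^ 16 * C\<^sub>s"
      using expectation_Ul[OF D _ l] mo C_le_Cs[of l] \<theta> by simp
    have "E D (\<lambda>n. Ul n l * sqrt (dd n)) \<le> E D ?h"
    proof (rule integral_mono_AE[OF int_Ud])
      show "integrable (measure_pmf D) ?h" using co by (intro combination) auto
      show "AE n in measure_pmf D. Ul n l * sqrt (dd n) \<le> ?h n"
        using stationary_AE[OF D] by eventually_elim (rule ptw)
    qed
    also have "\<dots> = 1 / ?b * E D (\<lambda>n. Ul n l) + ?b * ?t * E D (\<lambda>n. (dd n)\<^sup>2 / N1 n)
        + C\<^sub>s * \<theta> ^ 10 * (1 / \<theta> ^ 24 * E D (\<lambda>n. Ul n l) + C\<^sub>s * \<theta> ^ 48 * E D (\<lambda>n. N1 n ^ 3))"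
      using co by (intro combination) auto
    also have "\<dots> \<le> 1 / ?b * (\<theta> ^ 16 * C\<^sub>s) + ?b * ?t * (c\<^sub>4 / \<theta> ^ 16)
        + C\<^sub>s * \<theta> ^ 10 * (1 / \<theta> ^ 24 * (\<theta> ^ 16 * C\<^sub>s) + C\<^sub>s * \<theta> ^ 48 * (c\<^sub>3 / (\<theta> ^ 16) ^ 3))"
      using EU mo co \<theta> Cs_pos by (intro add_mono mult_left_mono) auto
    also have "\<dots> = \<theta>\<^sup>2 * C\<^sub>s + \<theta>\<^sup>2 * c\<^sub>4 + C\<^sub>s * (\<theta>\<^sup>2 * C\<^sub>s + \<theta> ^ 10 * (C\<^sub>s * c\<^sub>3))"
    proof -
      have "\<theta> ^ 16 = ?b * \<theta>\<^sup>2" "?b * ?t = \<theta>\<^sup>2 * \<theta> ^ 16" "\<theta> ^ 10 * \<theta> ^ 16 = \<theta>\<^sup>2 * \<theta> ^ 24" "(\<theta> ^ 16) ^ 3 = \<theta> ^ 48"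
        by (simp_all flip: power_add power_mult)
      then have "1 / ?b * (\<theta> ^ 16 * C\<^sub>s) = \<theta>\<^sup>2 * C\<^sub>s" "?b * ?t * (c\<^sub>4 / \<theta> ^ 16) = \<theta>\<^sup>2 * c\<^sub>4"
        "\<theta> ^ 10 * (1 / \<theta> ^ 24 * (\<theta> ^ 16 * C\<^sub>s)) = \<theta>\<^sup>2 * C\<^sub>s" "C\<^sub>s * \<theta> ^ 48 * (c\<^sub>3 / (\<theta> ^ 16) ^ 3) = C\<^sub>s * c\<^sub>3"
        using \<theta> by (simp_all add: field_simps)
      then show ?thesis by (simp only: mult.assoc distrib_left)
    qed
    also have "\<dots> \<le> c * \<theta>\<^sup>2"
    proof -
      have "\<theta> ^ 10 \<le> \<theta>\<^sup>2" using \<theta> \<theta>1 by (intro power_decreasing) auto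
      then have "C\<^sub>s * (\<theta> ^ 10 * (C\<^sub>s * c\<^sub>3)) \<le> C\<^sub>s * (\<theta>\<^sup>2 * (C\<^sub>s * c\<^sub>3))"
        using Cs_pos c3 by (intro mult_left_mono mult_right_mono) auto
      moreover have "0 \<le> (c\<^sub>4 + c\<^sub>3 + 1) * \<theta>\<^sup>2" using c3 c4 by simp
      ultimately show ?thesis by (simp add: c_def algebra_simps)
    qed
    finally show ?thesis using Ed int_d int_Ud by blast
  qed
  with c show thesis using that by blast
qed

text \<open>The exact identity is compared with its value on the cone, where \<open>ql\<close> is
  the multiplier vector of the projection and its priced capacity is the weighted count. The
  constants do not depend on \<open>\<theta>\<close> or \<open>D\<close>, which gives a rate of
  convergence.\<close>

lemma heavy_traffic_limit:
  assumes "Ls \<noteq> {}"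
  obtains T c where "real (card Ls) * Min (range \<kappa>) \<le> T" "T \<le> real (card Ls) * Max (range \<kappa>)" "0 < c"
    "\<And>\<theta> D. stationary (\<theta> ^ 16) D \<Longrightarrow> 0 < \<theta> \<Longrightarrow> \<theta> ^ 16 \<le> 1 / 2 \<Longrightarrow>
      integrable (measure_pmf D) (\<lambda>n. wc (re n)) \<and> \<bar>\<theta> ^ 16 * E D (\<lambda>n. wc (re n)) - T\<bar> \<le> c * \<theta>"
proof -
  obtain M :: "'l \<Rightarrow> 'l \<Rightarrow> real" where M: "\<And>l l'. M l l' = M l' l"
    "\<And>l l'. l' \<in> Ls \<Longrightarrow> (\<Sum>i\<in>Ls. M l i * B i l') = (if l = l' then 1 else 0)"
    "\<And>I. I \<subseteq> Ls \<Longrightarrow> 0 \<le> (\<Sum>l\<in>I. \<Sum>l'\<in>I. M l l')"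
    using B_inverse by blast
  define T where "T = (\<Sum>l\<in>Ls. \<Sum>l'\<in>Ls. M l l' * (\<Sum>r | l \<in> route r \<and> l' \<in> route r. w r))"
  have T: "real (card Ls) * Min (range \<kappa>) \<le> T" "T \<le> real (card Ls) * Max (range \<kappa>)"
    unfolding T_def using trace_bounds[OF M(2,3)] by auto
  have "0 \<le> T"
  proof (rule order_trans[OF _ T(1)])
    show "0 \<le> real (card Ls) * Min (range \<kappa>)"
      using \<kappa>_pos by (intro mult_nonneg_nonneg) (auto simp: less_imp_le)
  qed
  define ql where "ql n l = (\<Sum>l'\<in>Ls. M l l' * Wl n l')" for n l
  define S where "S n = (\<Sum>l\<in>Ls. Wl n l)" for n
  define d where "d n = sqrt (dd n)" for n
  have d: "0 \<le> d n" for n by (simp add: d_def dd_nonneg)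
  have S: "0 \<le> S n" for n unfolding S_def by (intro sum_nonneg Wl_nonneg)
  obtain c\<^sub>1 where c1: "0 < c\<^sub>1" "\<And>n l. l \<in> Ls \<Longrightarrow> \<bar>ql n l - proj n l\<bar> \<le> c\<^sub>1 * d n"
    "\<And>n. \<bar>wc (re n) - (\<Sum>l\<in>Ls. ql n l * C l)\<bar> \<le> c\<^sub>1 * d n"
    using projection_error[OF M(2)] unfolding ql_def d_def by blast
  obtain c\<^sub>2 where c2: "0 < c\<^sub>2" "\<And>n l \<eta>. n \<in> X \<Longrightarrow> 0 < \<eta> \<Longrightarrow> \<eta> \<le> 1 \<Longrightarrow>
    proj n l * Ul n l \<le> Ul n l * (\<eta> * S n + c\<^sub>2 / \<eta> * d n)"
    using projection_unused unfolding S_def d_def by blast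
  obtain c\<^sub>3 where c3: "0 < c\<^sub>3" and dist: "\<And>\<theta> D l. stationary (\<theta> ^ 16) D \<Longrightarrow> 0 < \<theta> \<Longrightarrow> \<theta> ^ 16 \<le> 1 / 2 \<Longrightarrow> l \<in> Ls \<Longrightarrow>
    integrable (measure_pmf D) d \<and> E D d \<le> c\<^sub>3 / \<theta> ^ 8 \<and>
    integrable (measure_pmf D) (\<lambda>n. Ul n l * d n) \<and> E D (\<lambda>n. Ul n l * d n) \<le> c\<^sub>3 * \<theta>\<^sup>2"
    using distance_expectations unfolding d_def[abs_def] by blast
  obtain c\<^sub>4 where c4: "0 < c\<^sub>4" and WU': "\<And>\<epsilon> D l. stationary \<epsilon> D \<Longrightarrow> 0 < \<epsilon> \<Longrightarrow> \<epsilon> \<le> 1 / 2 \<Longrightarrow>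
    l \<in> Ls \<Longrightarrow> E D (\<lambda>n. Ul n l * (\<Sum>l\<in>Ls. Wl n l)) \<le> c\<^sub>4"
    using workload_unused by blast
  note WU = WU'[folded S_def]
  obtain c\<^sub>5 where "0 < c\<^sub>5" and mom: "\<And>\<epsilon> D. stationary \<epsilon> D \<Longrightarrow> 0 < \<epsilon> \<Longrightarrow> \<epsilon> \<le> 1 / 2 \<Longrightarrow>
    integrable (measure_pmf D) (\<lambda>n. N1 n ^ 3) \<and> E D (\<lambda>n. N1 n ^ 3) \<le> c\<^sub>5 / \<epsilon> ^ 3 \<and>
    integrable (measure_pmf D) N1 \<and> E D N1 \<le> c\<^sub>5 / \<epsilon>"
    using moments by blast
  define L where "L = real (card Ls)"
  define c where "c = L * (c\<^sub>1 * c\<^sub>3 + c\<^sub>4 + c\<^sub>2 * c\<^sub>3) + T + c\<^sub>1 * c\<^sub>3 + 1"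
  have c: "0 < c"
    unfolding c_def L_def using c1(1) c2(1) c3 c4 \<open>0 \<le> T\<close> by (intro add_nonneg_pos add_nonneg_nonneg mult_nonneg_nonneg) auto
  have "integrable (measure_pmf D) (\<lambda>n. wc (re n)) \<and> \<bar>\<theta> ^ 16 * E D (\<lambda>n. wc (re n)) - T\<bar> \<le> c * \<theta>"
    if D: "stationary (\<theta> ^ 16) D" and \<theta>: "0 < \<theta>" "\<theta> ^ 16 \<le> 1 / 2" for \<theta> D
  proof -
    have \<theta>1: "\<theta> \<le> 1"
    proof (rule ccontr)
      assume "\<not> \<theta> \<le> 1"
      then have "1 \<le> \<theta> ^ 16" by (intro one_le_power) auto
      with \<theta> show False by simp
    qed
    define \<epsilon> where "\<epsilon> = \<theta> ^ 16"
    have \<epsilon>: "0 < \<epsilon>" "\<epsilon> \<le> 1 / 2" and D\<epsilon>: "stationary \<epsilon> D" using \<theta> D by (auto simp: \<epsilon>_def)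
    note mo = mom[OF D\<epsilon> \<epsilon>]
    have int_wc: "integrable (measure_pmf D) (\<lambda>n. wc (re n))"
    proof -
      have "integrable (measure_pmf D) (\<lambda>n. N1 n - 1)" using mo by simp
      then show ?thesis by (simp add: N1_def)
    qed
    \<comment> \<open>The bound is stated for a critical link, so some critical link must
      exist.\<close>
    have int_d: "integrable (measure_pmf D) d" "E D d \<le> c\<^sub>3 / \<theta> ^ 8"
      using dist[OF D \<theta>] assms by auto
    have int_Ud: "integrable (measure_pmf D) (\<lambda>n. Ul n l * d n)" "E D (\<lambda>n. Ul n l * d n) \<le> c\<^sub>3 * \<theta>\<^sup>2" if "l \<in> Ls" for l
      using dist[OF D \<theta> that] by auto
    have int_US: "integrable (measure_pmf D) (\<lambda>n. Ul n l * S n)" for l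
    proof -
      have "integrable (measure_pmf D) (\<lambda>n. Wl n l')" for l'
      proof -
        obtain b where b: "\<And>n. \<bar>lin (wl l') (re n)\<bar> \<le> b * N1 n" using lin_le_N1 by blast
        show ?thesis
        proof (rule Bochner_Integration.integrable_bound)
          show "integrable (measure_pmf D) (\<lambda>n. b * N1 n)" using mo by simp
          show "AE n in measure_pmf D. norm (Wl n l') \<le> norm (b * N1 n)"
            using b unfolding Wl_def by (intro AE_I2) (metis abs_ge_self order_trans real_norm_def)
        qed simp
      qed
      then have "integrable (measure_pmf D) (\<lambda>n. Wl n l' * (Ul n l - \<epsilon> * C l) + Wl n l' * (\<epsilon> * C l))" for l'
        using integrable_workload_unused[OF D\<epsilon>] mo \<epsilon> by simp
      then have "integrable (measure_pmf D) (\<lambda>n. Wl n l' * Ul n l)" for l'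
        by (simp add: algebra_simps)
      then have "integrable (measure_pmf D) (\<lambda>n. \<Sum>l'\<in>Ls. Wl n l' * Ul n l)"
        by (intro Bochner_Integration.integrable_sum)
      moreover have "(\<Sum>l'\<in>Ls. Wl n l' * Ul n l) = Ul n l * S n" for n
        unfolding S_def sum_distrib_left by (simp only: mult.commute)
      ultimately show ?thesis by simp
    qed
    define Y where "Y n = (\<Sum>l\<in>Ls. ql n l * (Ul n l - \<epsilon> * C l))" for n
    have int_Y: "integrable (measure_pmf D) Y"
      unfolding Y_def ql_def sum_distrib_right mult.assoc
      using integrable_workload_unused[OF D\<epsilon>] mo \<epsilon> by simp
    have EY: "E D Y = - ((1 - \<epsilon>) * T)"
      unfolding Y_def[abs_def] ql_def T_def
      using expectation_quadratic[OF M(1) D\<epsilon>] mo \<epsilon> by simp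
    define Z where "Z n = \<epsilon> * wc (re n) + Y n" for n
    have Z_eq: "Z n = \<epsilon> * (wc (re n) - (\<Sum>l\<in>Ls. ql n l * C l)) + (\<Sum>l\<in>Ls. ql n l * Ul n l)" for n
      by (simp add: Z_def Y_def right_diff_distrib sum_subtractf sum_distrib_left mult_ac)
    \<comment> \<open>Here \<open>\<eta> = \<theta>\<close> is chosen in
      \<open>projection_unused\<close>: the bounded workload term gains a factor
      \<open>\<theta>\<close>, and the distance term of order \<open>\<theta>\<^sup>2\<close> loses
      only one.\<close>
    define h where "h n = \<epsilon> * c\<^sub>1 * d n + (\<Sum>l\<in>Ls. (c\<^sub>1 + c\<^sub>2 / \<theta>) * (Ul n l * d n) + \<theta> * (Ul n l * S n))" for n
    have Z_le: "\<bar>Z n\<bar> \<le> h n" if n: "n \<in> X" for n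
    proof -
      have "\<bar>ql n l * Ul n l\<bar> \<le> (c\<^sub>1 + c\<^sub>2 / \<theta>) * (Ul n l * d n) + \<theta> * (Ul n l * S n)" if l: "l \<in> Ls" for l
      proof -
        have u: "0 \<le> Ul n l" by (rule Ul_bounds(1)[OF n])
        have "\<bar>ql n l * Ul n l\<bar> = \<bar>(ql n l - proj n l) * Ul n l + proj n l * Ul n l\<bar>" by (simp add: algebra_simps)
        also have "\<dots> \<le> \<bar>ql n l - proj n l\<bar> * Ul n l + proj n l * Ul n l"
          using abs_triangle_ineq[of "(ql n l - proj n l) * Ul n l" "proj n l * Ul n l"] u cone_proj[of n]
          by (simp add: abs_mult cone_def)
        also have "\<dots> \<le> c\<^sub>1 * d n * Ul n l + Ul n l * (\<theta> * S n + c\<^sub>2 / \<theta> * d n)"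
          using c1(2)[OF l, of n] u c2(2)[OF n \<theta>(1) \<theta>1, of l] by (intro add_mono mult_right_mono) auto
        also have "\<dots> = (c\<^sub>1 + c\<^sub>2 / \<theta>) * (Ul n l * d n) + \<theta> * (Ul n l * S n)" by (simp add: algebra_simps)
        finally show ?thesis .
      qed
      then have "\<bar>\<Sum>l\<in>Ls. ql n l * Ul n l\<bar> \<le> (\<Sum>l\<in>Ls. (c\<^sub>1 + c\<^sub>2 / \<theta>) * (Ul n l * d n) + \<theta> * (Ul n l * S n))"
        by (intro order_trans[OF sum_abs] sum_mono)
      moreover have "\<bar>\<epsilon> * (wc (re n) - (\<Sum>l\<in>Ls. ql n l * C l))\<bar> \<le> \<epsilon> * (c\<^sub>1 * d n)"
        unfolding abs_mult using c1(3)[of n] \<epsilon> by (intro mult_mono) auto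
      ultimately show ?thesis unfolding Z_eq h_def by linarith
    qed
    have int_Z: "integrable (measure_pmf D) Z" unfolding Z_def using int_wc int_Y by simp
    have int_h: "integrable (measure_pmf D) h"
      unfolding h_def using int_d int_Ud int_US by simp
    have "\<bar>E D Z\<bar> \<le> E D (\<lambda>n. \<bar>Z n\<bar>)" using integral_norm_bound[of "measure_pmf D" Z] by simp
    also have "\<dots> \<le> E D h"
    proof (rule integral_mono_AE[OF _ int_h])
      show "integrable (measure_pmf D) (\<lambda>n. \<bar>Z n\<bar>)" using int_Z by simp
      show "AE n in measure_pmf D. \<bar>Z n\<bar> \<le> h n"
        using stationary_AE[OF D] by eventually_elim (rule Z_le)
    qed
    also have "E D h = \<epsilon> * c\<^sub>1 * E D d +
        (\<Sum>l\<in>Ls. (c\<^sub>1 + c\<^sub>2 / \<theta>) * E D (\<lambda>n. Ul n l * d n) + \<theta> * E D (\<lambda>n. Ul n l * S n))"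
      unfolding h_def using int_d int_Ud int_US by (simp add: Bochner_Integration.integral_sum)
    also have "\<dots> \<le> \<epsilon> * c\<^sub>1 * (c\<^sub>3 / \<theta> ^ 8) + (\<Sum>l\<in>Ls. (c\<^sub>1 + c\<^sub>2 / \<theta>) * (c\<^sub>3 * \<theta>\<^sup>2) + \<theta> * c\<^sub>4)"
      using int_d int_Ud WU[OF D\<epsilon> \<epsilon>] \<epsilon> \<theta> c1(1) c2(1)
      by (intro add_mono sum_mono mult_left_mono) auto
    also have "\<dots> = c\<^sub>1 * c\<^sub>3 * \<theta> ^ 8 + L * (c\<^sub>1 * c\<^sub>3 * \<theta>\<^sup>2 + c\<^sub>2 * c\<^sub>3 * \<theta> + c\<^sub>4 * \<theta>)"
    proof -
      have \<epsilon>_eq: "\<epsilon> = \<theta> ^ 8 * \<theta> ^ 8" by (simp add: \<epsilon>_def flip: power_add)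
      have "y * y * u * (v / y) = u * v * y" if "0 < y" for y u v :: real using that by simp
      from this[of "\<theta> ^ 8" c\<^sub>1 c\<^sub>3] \<theta>(1)
      have "\<epsilon> * c\<^sub>1 * (c\<^sub>3 / \<theta> ^ 8) = c\<^sub>1 * c\<^sub>3 * \<theta> ^ 8" unfolding \<epsilon>_eq by (metis zero_less_power)
      moreover have "(c\<^sub>1 + c\<^sub>2 / \<theta>) * (c\<^sub>3 * \<theta>\<^sup>2) + \<theta> * c\<^sub>4 = c\<^sub>1 * c\<^sub>3 * \<theta>\<^sup>2 + c\<^sub>2 * c\<^sub>3 * \<theta> + c\<^sub>4 * \<theta>"
        using \<theta> by (simp add: field_simps power2_eq_square)
      ultimately show ?thesis by (simp add: L_def)
    qed
    also have "\<dots> \<le> c\<^sub>1 * c\<^sub>3 * \<theta> + L * (c\<^sub>1 * c\<^sub>3 * \<theta> + c\<^sub>2 * c\<^sub>3 * \<theta> + c\<^sub>4 * \<theta>)"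
    proof -
      have "\<theta> ^ 8 \<le> \<theta> ^ 1" "\<theta>\<^sup>2 \<le> \<theta> ^ 1" using \<theta> \<theta>1 by (intro power_decreasing; simp)+
      then show ?thesis using c1(1) c2(1) c3 c4 by (intro add_mono mult_left_mono) (auto simp: L_def)
    qed
    finally have "\<bar>E D Z\<bar> \<le> c\<^sub>1 * c\<^sub>3 * \<theta> + L * (c\<^sub>1 * c\<^sub>3 * \<theta> + c\<^sub>2 * c\<^sub>3 * \<theta> + c\<^sub>4 * \<theta>)" .
    moreover have "E D Z = \<epsilon> * E D (\<lambda>n. wc (re n)) - (1 - \<epsilon>) * T"
      unfolding Z_def using int_wc int_Y EY by simp
    moreover have "\<epsilon> * T \<le> \<theta> * T"
    proof (rule mult_right_mono[OF _ \<open>0 \<le> T\<close>])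
      have "\<theta> ^ 16 \<le> \<theta> ^ 1" using \<theta> \<theta>1 by (intro power_decreasing) auto
      then show "\<epsilon> \<le> \<theta>" by (simp add: \<epsilon>_def)
    qed
    moreover have "0 \<le> \<epsilon> * T" using \<epsilon> \<open>0 \<le> T\<close> by simp
    moreover have "c * \<theta> = c\<^sub>1 * c\<^sub>3 * \<theta> + L * (c\<^sub>1 * c\<^sub>3 * \<theta> + c\<^sub>2 * c\<^sub>3 * \<theta> + c\<^sub>4 * \<theta>) + \<theta> * T + \<theta>"
      by (simp add: c_def algebra_simps)
    moreover have "(1 - \<epsilon>) * T = T - \<epsilon> * T" by (simp add: algebra_simps)
    ultimately have "\<bar>\<epsilon> * E D (\<lambda>n. wc (re n)) - T\<bar> \<le> c * \<theta>" using \<theta>(1) by linarith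
    with int_wc show ?thesis by (simp add: \<epsilon>_def)
  qed
  with T c show thesis using that by blast
qed

section \<open>Instantiating the abstract network with the given chain\<close>

lemma stationaryI:
  assumes P: "ctmc X q P" and D: "stationary_distribution X P D" and \<epsilon>: "0 \<le> \<epsilon>" "\<epsilon> \<le> 1"
    and q: "\<And>n m. n \<in> X \<Longrightarrow> m \<in> X \<Longrightarrow> q n m = (\<Sum>j\<in>J. if m = \<tau> j n then rate \<epsilon> j n else 0)"
  shows "stationary \<epsilon> D"
proof -
  interpret chain: bounded_rate_chain X q P D J \<tau> "rate \<epsilon>" Q
    by unfold_locales (use P D \<epsilon> q finite_J in \<open>auto simp: rate_nonneg rate_sum_le step\<close>)
  show ?thesis
    unfolding stationary_def
  proof (intro conjI allI impI)
    show "set_pmf D \<subseteq> X" using D by (simp add: stationary_distribution_def)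
  next
    fix f :: "'r state \<Rightarrow> real"
    assume f: "integrable (measure_pmf D) f" "\<forall>n\<in>X. 0 \<le> f n"
    show "integrable (measure_pmf D) (G \<epsilon> f)" "measure_pmf.expectation D (G \<epsilon> f) = 0"
      by (rule chain.gen_integrable chain.gen_expectation; use f in blast)+
  next
    fix f g h :: "'r state \<Rightarrow> real"
    assume fgh: "\<forall>n\<in>X. 0 \<le> f n \<and> 0 \<le> g n \<and> 0 \<le> h n \<and> G \<epsilon> f n \<le> h n - g n"
      "integrable (measure_pmf D) h"
    show "integrable (measure_pmf D) g"
      by (rule chain.foster_integrable[of f g h]; use fgh in blast)
    show "measure_pmf.expectation D g \<le> measure_pmf.expectation D h"
      by (rule chain.foster_expectation[of f g h]; use fgh in blast)
  qed
qed

lemma flow_rate_eq: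
  fixes \<pi> :: "'r \<Rightarrow> real Matrix.vec" and S :: "'r \<Rightarrow> real mat"
  assumes "\<And>r. S r \<in> carrier_mat (K r) (K r)" "\<And>r k j. s r k j = S r $$ (k, j)" "\<And>r k. a r k = \<pi> r $ k"
  shows "flow_rate (\<lambda>r. (1 - \<epsilon>) * lam r) \<pi> S x n m' = (\<Sum>j\<in>J. if m' = \<tau> j n then rate \<epsilon> j n else 0)"
proof -
  have dims: "dim_row (S r) = K r" "dim_col (S r) = K r" for r using assms(1)[of r] by auto
  have exit: "(\<Sum>k'<K r. (- S r) $$ (k, k')) = (\<Sum>k'<K r. - S r $$ (k, k'))" if "k < K r" for r k
    using that dims by (intro sum.cong refl) auto
  show ?thesis
    unfolding flow_rate_def sum_J dims rate_def \<tau>_def \<phi>_def assms(2,3) sum.case prod.case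
    by (intro arg_cong2[where f="(+)"] sum.cong refl) (simp_all add: exit)
qed

end

text \<open>Full row rank makes the transposed routing matrix injective, and its entries applied to
  \<open>z\<close> are the route sums.\<close>

lemma full_row_rank_route_sums:
  fixes route :: "'r::finite \<Rightarrow> 'l::finite set" and z :: "'l \<Rightarrow> real"
  assumes rank: "rank (routing_matrix route) = CARD('l)" and z: "\<And>r. (\<Sum>l\<in>route r. z l) = 0"
  shows "z l = 0"
proof -
  let ?A = "Finite_Cartesian_Product.transpose (routing_matrix route)"
  have "inj ((*v) ?A)"
    using rank full_rank_injective[of ?A] by (simp add: rank_transpose)
  moreover have "?A *v vec_lambda z = ?A *v 0"
  proof (intro Finite_Cartesian_Product.vec_eq_iff[THEN iffD2] allI)
    fix r
    have "vec_nth (?A *v vec_lambda z) r = (\<Sum>l\<in>UNIV. (if l \<in> route r then 1 else 0) * z l)"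
      by (simp add: matrix_vector_mult_def Finite_Cartesian_Product.transpose_def routing_matrix_def)
    also have "\<dots> = (\<Sum>l\<in>route r. z l)" by (intro sum.mono_neutral_cong_right) auto
    finally show "vec_nth (?A *v vec_lambda z) r = vec_nth (?A *v 0) r" by (simp add: z)
  qed
  ultimately have "vec_lambda z = (0 :: real^'l)" by (rule injD)
  then have "vec_nth (vec_lambda z :: real^'l) l = 0" by simp
  then show ?thesis by simp
qed

lemma smallo_of_root_bound:
  fixes f :: "real \<Rightarrow> real"
  assumes "\<And>\<epsilon>. 0 < \<epsilon> \<Longrightarrow> \<epsilon> \<le> 1 / 2 \<Longrightarrow> \<bar>\<epsilon> * f \<epsilon>\<bar> \<le> c * root 16 \<epsilon>"
  shows "f \<in> o[at_right 0](\<lambda>\<epsilon>. 1 / \<epsilon>)"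
proof (rule smalloI_tendsto)
  have ev: "\<forall>\<^sub>F \<epsilon>::real in at_right 0. 0 < \<epsilon> \<and> \<epsilon> \<le> 1 / 2"
    unfolding eventually_at_right_field by (intro exI[of _ "1 / 2"]) auto
  then show "\<forall>\<^sub>F \<epsilon>::real in at_right 0. 1 / \<epsilon> \<noteq> 0" by eventually_elim simp
  have "((\<lambda>\<epsilon>. c * root 16 \<epsilon>) \<longlongrightarrow> c * root 16 0) (at_right 0)"
    by (intro tendsto_intros)
  then have lim: "((\<lambda>\<epsilon>. c * root 16 \<epsilon>) \<longlongrightarrow> 0) (at_right 0)" by simp
  show "((\<lambda>\<epsilon>. f \<epsilon> / (1 / \<epsilon>)) \<longlongrightarrow> 0) (at_right 0)"
  proof (rule Lim_null_comparison[OF _ lim])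
    show "\<forall>\<^sub>F \<epsilon> in at_right 0. norm (f \<epsilon> / (1 / \<epsilon>)) \<le> c * root 16 \<epsilon>"
      using ev by eventually_elim (use assms in \<open>simp add: mult.commute\<close>)
  qed
qed

theorem theorem4:
  fixes route :: "'r::finite \<Rightarrow> 'l::finite set"
    and C :: "'l \<Rightarrow> real"
    and \<kappa> lam0 :: "'r \<Rightarrow> real"
    and \<pi> :: "'r \<Rightarrow> real Matrix.vec"
    and S :: "'r \<Rightarrow> real mat"
    and Ls :: "'l set"
    and x :: "'r state \<Rightarrow> 'r \<Rightarrow> real"
    and P :: "real \<Rightarrow> real \<Rightarrow> 'r state \<Rightarrow> 'r state pmf"
    and Nbar :: "real \<Rightarrow> 'r state pmf"
  assumes "\<And>l. 0 < C l"
    and "\<And>r. route r \<noteq> {}"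
    and "rank (routing_matrix route) = CARD('l)"
    and "\<And>r. 0 < \<kappa> r"
    and "\<And>r. class_D (\<pi> r) (S r)"
    and "\<And>n. n \<in> states S \<Longrightarrow> prop_fair route C \<kappa> (route_count S n) (x n)"
    and "\<And>r. 0 < lam0 r"
    and "Ls \<noteq> {}"
    and "\<And>l. l \<in> Ls \<Longrightarrow> link_load route (offered_load lam0 \<pi> S) l = C l"
    and "\<And>l. l \<notin> Ls \<Longrightarrow> link_load route (offered_load lam0 \<pi> S) l < C l"
    and "\<And>\<epsilon>. 0 < \<epsilon> \<Longrightarrow> \<epsilon> < 1 \<Longrightarrow>
           ctmc (states S) (flow_rate (\<lambda>r. (1 - \<epsilon>) * lam0 r) \<pi> S x) (P \<epsilon>)"
    and "\<And>\<epsilon>. 0 < \<epsilon> \<Longrightarrow> \<epsilon> < 1 \<Longrightarrow> stationary_distribution (states S) (P \<epsilon>) (Nbar \<epsilon>)"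
  shows "\<exists>f g. f \<in> o[at_right 0](\<lambda>\<epsilon>::real. 1 / \<epsilon>) \<and> g \<in> o[at_right 0](\<lambda>\<epsilon>::real. 1 / \<epsilon>) \<and>
           (\<forall>\<^sub>F \<epsilon> in at_right 0.
              integrable (measure_pmf (Nbar \<epsilon>)) (weighted_count \<kappa> S) \<and>
              real (card Ls) * Min (range \<kappa>) / \<epsilon> + f \<epsilon>
                \<le> measure_pmf.expectation (Nbar \<epsilon>) (weighted_count \<kappa> S) \<and>
              measure_pmf.expectation (Nbar \<epsilon>) (weighted_count \<kappa> S)
                \<le> real (card Ls) * Max (range \<kappa>) / \<epsilon> + (g \<epsilon> :: real))"
proof -
  define K where "K r = dim_row (S r)" for r
  define good where "good r m u c \<longleftrightarrow> (\<forall>k<K r. 0 < m k) \<and> (\<forall>k<K r. 0 < u k) \<and> 0 < c \<and>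
      (\<forall>k<K r. (\<Sum>j<K r. S r $$ (k, j) * m j) = - 1) \<and>
      (\<forall>j<K r. (\<Sum>k<K r. u k * S r $$ (k, j)) = - \<pi> r $ j) \<and>
      (\<Sum>k<K r. u k) = mean_file_size (\<pi> r) (S r) \<and>
      (\<forall>v. c * (\<Sum>k<K r. (v k)\<^sup>2) \<le> - (\<Sum>k<K r. \<Sum>j<K r. v k * S r $$ (k, j) * (m j / u j * v j))) \<and>
      (\<forall>k<K r. \<forall>j<K r. j \<noteq> k \<longrightarrow> 0 \<le> S r $$ (k, j)) \<and>
      (\<forall>k<K r. (\<Sum>j<K r. S r $$ (k, j)) \<le> 0)" for r m u c
  have "\<forall>r. \<exists>m u c. good r m u c"
  proof
    fix r
    show "\<exists>m u c. good r m u c"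
      unfolding good_def
      by (rule class_D_phases[OF assms(5)[of r], folded K_def]) (intro exI conjI allI impI; assumption)
  qed
  then obtain m u c where "\<And>r. good r (m r) (u r) (c r)" by metis
  note phases = this[unfolded good_def]
  \<comment> \<open>Arrival rate times expected time per phase; the total over the phases is the
    offered load of the route.\<close>
  define \<rho> where "\<rho> r k = lam0 r * u r k" for r k
  \<comment> \<open>The weights of the network are \<open>\<kappa> r / lam0 r\<close> times
    \<open>m / u\<close>, so each coercivity constant is rescaled by that factor before the minimum
    over routes is taken.\<close>
  define c0 where "c0 = Min (range (\<lambda>r. c r * \<kappa> r / lam0 r))"
  have c0: "0 < c0" "\<And>r. c0 \<le> c r * \<kappa> r / lam0 r"
    using phases assms(4,7) by (auto simp: c0_def)
  have coercive: "c0 * (\<Sum>k<K r. (v k)\<^sup>2) \<le> - (\<Sum>k<K r. \<Sum>j<K r. v k * S r $$ (k, j) * (\<kappa> r * m r j / \<rho> r j * v j))" for r v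
  proof -
    have "c0 * (\<Sum>k<K r. (v k)\<^sup>2) \<le> c r * \<kappa> r / lam0 r * (\<Sum>k<K r. (v k)\<^sup>2)"
      using c0(2) by (intro mult_right_mono sum_nonneg) auto
    also have "\<dots> = \<kappa> r / lam0 r * (c r * (\<Sum>k<K r. (v k)\<^sup>2))" by simp
    also have "\<dots> \<le> \<kappa> r / lam0 r * - (\<Sum>k<K r. \<Sum>j<K r. v k * S r $$ (k, j) * (m r j / u r j * v j))"
      using phases[of r] assms(4)[of r] assms(7)[of r] by (intro mult_left_mono) auto
    also have "\<dots> = - (\<Sum>k<K r. \<Sum>j<K r. v k * S r $$ (k, j) * (\<kappa> r * m r j / \<rho> r j * v j))"
      by (simp add: \<rho>_def sum_distrib_left mult_ac)
    finally show ?thesis .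
  qed
  have class_D: "dim_vec (\<pi> r) = K r" "\<forall>k<K r. 0 \<le> \<pi> r $ k" "(\<Sum>k<K r. \<pi> r $ k) = 1" for r
    using assms(5)[of r] unfolding class_D_def K_def by auto
  have K_pos: "0 < K r" for r
    using class_D(3)[of r] by (cases "K r = 0") auto
  have carrier: "S r \<in> carrier_mat (K r) (K r)" for r
    unfolding K_def by (rule class_D_bidiagonal[OF assms(5)[of r]])
  have load0: "offered_load lam0 \<pi> S r = (\<Sum>k<K r. \<rho> r k)" for r
    using phases[of r] by (simp add: offered_load_def \<rho>_def sum_distrib_left[symmetric])
  have count: "real (route_count S n r) = (\<Sum>k<K r. real (n r k))" for n r
    by (simp add: route_count_def K_def)
  have fair: "prop_fair route C \<kappa> (route_count S n) (x n)" if "n \<in> states S" for n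
    using assms(6) that .
  have feas: "0 \<le> x n r" "link_load route (\<lambda>r. (\<Sum>k<K r. real (n r k)) * x n r) l \<le> C l"
    if "n \<in> states S" for n r l
    using fair[OF that] by (auto simp: prop_fair_def feasible_def count)
  have "\<forall>n. \<exists>q. n \<in> states S \<longrightarrow> (\<forall>l. 0 \<le> q l) \<and>
      (\<forall>r. (\<Sum>k<K r. real (n r k)) * x n r * (\<Sum>l\<in>route r. q l) = \<kappa> r * (\<Sum>k<K r. real (n r k))) \<and>
      (\<forall>l. q l * (C l - link_load route (\<lambda>r. (\<Sum>k<K r. real (n r k)) * x n r) l) = 0)"
  proof
    fix n
    show "\<exists>q. n \<in> states S \<longrightarrow> (\<forall>l. 0 \<le> q l) \<and>
      (\<forall>r. (\<Sum>k<K r. real (n r k)) * x n r * (\<Sum>l\<in>route r. q l) = \<kappa> r * (\<Sum>k<K r. real (n r k))) \<and>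
      (\<forall>l. q l * (C l - link_load route (\<lambda>r. (\<Sum>k<K r. real (n r k)) * x n r) l) = 0)"
    proof (cases "n \<in> states S")
      case True
      show ?thesis
        by (rule prop_fair_multipliers[OF assms(1,4) fair[OF True], unfolded count])
           (intro exI impI conjI allI; assumption)
    qed simp
  qed
  from choice[OF this] obtain p where p: "\<And>n. n \<in> states S \<Longrightarrow> (\<forall>l. 0 \<le> p n l) \<and>
      (\<forall>r. (\<Sum>k<K r. real (n r k)) * x n r * (\<Sum>l\<in>route r. p n l) = \<kappa> r * (\<Sum>k<K r. real (n r k))) \<and>
      (\<forall>l. p n l * (C l - link_load route (\<lambda>r. (\<Sum>k<K r. real (n r k)) * x n r) l) = 0)"
    by blast
  interpret net: bandwidth_network route C \<kappa> lam0 K "\<lambda>r k j. S r $$ (k, j)" "\<lambda>r k. \<pi> r $ k" m \<rho> c0 Ls x p "states S"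
  proof
    show "z l = 0" if "\<And>r. (\<Sum>l\<in>route r. z l) = 0" for z :: "'l \<Rightarrow> real" and l
      by (rule full_row_rank_route_sums[OF assms(3) that])
    show "(\<Sum>k<K r. \<rho> r k * S r $$ (k, j)) = - (lam0 r * \<pi> r $ j)" if "j < K r" for r j
    proof -
      have "(\<Sum>k<K r. \<rho> r k * S r $$ (k, j)) = lam0 r * (\<Sum>k<K r. u r k * S r $$ (k, j))"
        by (simp add: \<rho>_def sum_distrib_left mult.assoc)
      then show ?thesis using phases[of r] that by simp
    qed
    show "states S = {n. \<forall>r k. K r \<le> k \<longrightarrow> n r k = 0}"
      by (simp add: states_def K_def)
    show "link_load route (\<lambda>r. \<Sum>k<K r. \<rho> r k) l = C l" if "l \<in> Ls" for l
      using assms(9)[OF that] by (simp add: load0[abs_def])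
    show "link_load route (\<lambda>r. \<Sum>k<K r. \<rho> r k) l < C l" if "l \<notin> Ls" for l
      using assms(10)[OF that] by (simp add: load0[abs_def])
    show "0 < \<rho> r k" if "k < K r" for r k
      using phases[of r] assms(7)[of r] that by (simp add: \<rho>_def)
  qed (use assms(1,2,4,7) K_pos class_D phases c0 coercive feas p in auto)
  have stationary: "net.stationary \<epsilon> (Nbar \<epsilon>)" if "0 < \<epsilon>" "\<epsilon> < 1" for \<epsilon>
    by (rule net.stationaryI[OF assms(11)[OF that] assms(12)[OF that]])
       (use that net.flow_rate_eq[OF carrier refl refl] in auto)
  obtain T b where T: "real (card Ls) * Min (range \<kappa>) \<le> T" "T \<le> real (card Ls) * Max (range \<kappa>)"
    and lim: "\<And>\<theta> D. net.stationary (\<theta> ^ 16) D \<Longrightarrow> 0 < \<theta> \<Longrightarrow> \<theta> ^ 16 \<le> 1 / 2 \<Longrightarrow>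
      integrable (measure_pmf D) (\<lambda>n. net.wc (net.re n)) \<and>
      \<bar>\<theta> ^ 16 * measure_pmf.expectation D (\<lambda>n. net.wc (net.re n)) - T\<bar> \<le> b * \<theta>"
    using net.heavy_traffic_limit[OF assms(8)] by metis
  have wc: "net.wc (net.re n) = weighted_count \<kappa> S n" for n
    unfolding net.wc_eq weighted_count_def count net.cnt_def by simp
  define E where "E \<epsilon> = measure_pmf.expectation (Nbar \<epsilon>) (weighted_count \<kappa> S)" for \<epsilon>
  have bound: "integrable (measure_pmf (Nbar \<epsilon>)) (weighted_count \<kappa> S) \<and> \<bar>\<epsilon> * E \<epsilon> - T\<bar> \<le> b * root 16 \<epsilon>"
    if \<epsilon>: "0 < \<epsilon>" "\<epsilon> \<le> 1 / 2" for \<epsilon>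
    using lim[of "root 16 \<epsilon>" "Nbar \<epsilon>"] stationary[of \<epsilon>] \<epsilon> by (simp add: wc E_def)
  \<comment> \<open>The deviation from the exact limit \<open>T / \<epsilon>\<close> serves as error
    term on both sides, since \<open>T\<close> lies between the two constants of the
    theorem.\<close>
  define f where "f \<epsilon> = E \<epsilon> - T / \<epsilon>" for \<epsilon>
  have f: "f \<in> o[at_right 0](\<lambda>\<epsilon>. 1 / \<epsilon>)"
  proof (rule smallo_of_root_bound)
    show "\<bar>\<epsilon> * f \<epsilon>\<bar> \<le> b * root 16 \<epsilon>" if "0 < \<epsilon>" "\<epsilon> \<le> 1 / 2" for \<epsilon>
      using bound[OF that] that by (simp add: f_def right_diff_distrib)
  qed
  have "\<forall>\<^sub>F \<epsilon>::real in at_right 0. 0 < \<epsilon> \<and> \<epsilon> \<le> 1 / 2"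
    unfolding eventually_at_right_field by (intro exI[of _ "1 / 2"]) auto
  then have "\<forall>\<^sub>F \<epsilon> in at_right 0.
      integrable (measure_pmf (Nbar \<epsilon>)) (weighted_count \<kappa> S) \<and>
      real (card Ls) * Min (range \<kappa>) / \<epsilon> + f \<epsilon> \<le> E \<epsilon> \<and>
      E \<epsilon> \<le> real (card Ls) * Max (range \<kappa>) / \<epsilon> + f \<epsilon>"
  proof eventually_elim
    case (elim \<epsilon>)
    then show ?case
      using bound[of \<epsilon>] T divide_right_mono[OF T(1), of \<epsilon>] divide_right_mono[OF T(2), of \<epsilon>] by (simp add: f_def)
  qed
  with f show ?thesis unfolding E_def by blast
qed

end
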